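(* Let $N\ge 3$. If $\Gamma$ is a $4$-valent non-oriented planar graph, then $\langle\Gamma\rangle_N\in\mathbb{Z}_{\ge 0}[q,q^{-1}]$.
   Context: Notation: $q$ is a formal variable, $[k]=\frac{q^k-q^{-k}}{q-q^{-1}}$, $[2]^{[k]}=\prod_{i=1}^k(q^i+q^{-i})$ for $k\ge0$. Webs. A web is a finite graph embedded in the oriented plane $\mathbb{R}^2$ (not necessarily connected; multiple edges and vertexless loops allowed), all of whose vertices are trivalent, with three types of edges: vectorial (unoriented), spin-even (oriented), spin-odd (oriented). Each vertex is incident to exactly one edge of each type, and exactly one of the two spin edges at the vertex points into it, the other one pointing out of it (the cyclic order of the three edges is arbitrary). "Spin" means spin-even or spin-odd. Colorings. A coloring of a web is a pair $(o,c)$ where $o$ is an orientation of all vectorial edges and $c$ assigns to each edge a subset of $\{1,\dots,N\}$, of cardinality $1$ on vectorial edges, even cardinality on spin-even edges, odd cardinality on spin-odd edges, such that at each vertex, with vectorial edge colored $\{a\}$, incoming spin edge colored $A$, outgoing spin edge colored $B$: if the vectorial edge is oriented by $o$ into the vertex then $a\notin A$ and $B=A\cup\{a\}$; if it is oriented out of the vertex then $a\notin B$ and $A=B\cup\{a\}$. Degree. For $1\le a<b\le N$, let $C_{a'b}$ be the collection of oriented cycles formed by: vectorial edges colored $\{b\}$ with orientation $o$; vectorial edges colored $\{a\}$ with orientation opposite to $o$; spin edges whose color contains $b$ but not $a$, with their orientation in the web; spin edges whose color contains $a$ but not $b$, with reversed orientation. Let $C_{a^\star b}$ be the collection of oriented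 cycles formed by: vectorial edges colored $\{a\}$ or $\{b\}$ with orientation $o$; spin edges whose color contains both $a$ and $b$, with their orientation in the web; spin edges whose color contains neither $a$ nor $b$, with reversed orientation. (Both are disjoint unions of oriented simple closed curves.) The rotational $\rho(C)$ of such a collection is the number of counterclockwise cycles minus the number of clockwise cycles. Put $\deg(o,c)=\sum_{1\le a<b\le N}\big(\rho(C_{a'b})+\rho(C_{a^\star b})\big)$ and, for a web $W$, $\langle W\rangle_N=\sum_{(o,c)}q^{\deg(o,c)}$, the sum being over all colorings of $W$. $4$-valent graphs. A $4$-valent non-oriented planar graph is a finite plane graph with all vertices $4$-valent (loops, multiple edges, vertexless circles allowed); all its edges are regarded as vectorial. Let $v$ be the number of its vertices. Replace each vertex, inside a small disc around it, by a square: a $4$-cycle of spin edges bounding a small disc, whose four corners are attached, in cyclic order, to the four vectorial half-edges, whose sides are alternately spin-even and spin-odd, and which is coherently oriented (clockwise or counterclockwise). This gives a web $\Gamma_\square$, and $\langle\Gamma\rangle_N$ is defined by $\big([2]^{[N-3]}\big)^{v}\langle\Gamma\rangle_N=\langle\Gamma_\square\rangle_N$; at each vertex any of the four possible squares (two choices of parity, two of orientation) may be used, all choices giving the same value. *)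

theory Defs
  imports
    "HOL-Complex_Analysis.Complex_Analysis"
    "HOL-Computational_Algebra.Formal_Laurent_Series"
begin

text \<open>
  The oriented plane is \<open>\<complex>\<close>. An edge of a plane graph is a parametrised curve on \<open>[0,1]\<close>.
  For an unoriented edge the direction of the parametrisation is auxiliary; an oriented edge
  is oriented by its parametrisation.
\<close>

type_synonym curve = "real \<Rightarrow> complex"

section \<open>Plane graphs\<close>

text \<open>
  A simple path is an arc or a simple closed curve. So an edge is an arc between two vertices,
  a loop based at a vertex, or a vertexless circle (whose base point is then no vertex).
\<close>

definition plane_graph :: "complex set \<Rightarrow> curve set \<Rightarrow> bool" where
  "plane_graph V E \<longleftrightarrow>
     finite V \<and> finite E \<and>
     (\<forall>e\<in>E. simple_path e \<and>
        (pathstart e \<in> V \<and> pathfinish e \<in> V \<or>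
         pathstart e \<notin> V \<and> pathfinish e = pathstart e) \<and>
        e ` {0<..<1} \<inter> V = {}) \<and>
     (\<forall>e\<in>E. \<forall>f\<in>E. e \<noteq> f \<longrightarrow> path_image e \<inter> path_image f \<subseteq> V)"

definition orient :: "bool \<Rightarrow> curve \<Rightarrow> curve" where
  "orient d e = (if d then e else reversepath e)"

text \<open>
  A half-edge at \<open>v\<close> is an edge together with one of its two directions, namely the one ending
  at \<open>v\<close>; in particular a loop based at \<open>v\<close> gives two half-edges.
\<close>

definition half_edges :: "curve set \<Rightarrow> complex \<Rightarrow> (curve \<times> bool) set" where
  "half_edges E v = {(e, d). e \<in> E \<and> pathfinish (orient d e) = v}"

section \<open>Webs and their colorings\<close>

record web =
  verts :: "complex set"
  vect :: "curve set"
  spin_even :: "curve set"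
  spin_odd :: "curve set"

definition spin :: "web \<Rightarrow> curve set" where
  "spin W = spin_even W \<union> spin_odd W"

definition web :: "web \<Rightarrow> bool" where
  "web W \<longleftrightarrow>
     plane_graph (verts W) (vect W \<union> spin W) \<and>
     vect W \<inter> spin W = {} \<and> spin_even W \<inter> spin_odd W = {} \<and>
     (\<forall>v\<in>verts W.
        (\<exists>!h. h \<in> half_edges (vect W) v) \<and>
        (\<exists>!h. h \<in> half_edges (spin_even W) v) \<and>
        (\<exists>!h. h \<in> half_edges (spin_odd W) v) \<and>
        (\<exists>!e. e \<in> spin W \<and> pathfinish e = v) \<and>
        (\<exists>!e. e \<in> spin W \<and> pathstart e = v))"

text \<open>
  In a coloring \<open>(d, c)\<close> the vectorial edge \<open>e\<close> is oriented as \<open>orient (d e) e\<close>. Both maps are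
  extensional, so that colorings which agree on the edges of the web are counted once.
\<close>

definition colorings :: "nat \<Rightarrow> web \<Rightarrow> ((curve \<Rightarrow> bool) \<times> (curve \<Rightarrow> nat set)) set" where
  "colorings N W = {(d, c).
     d \<in> vect W \<rightarrow>\<^sub>E UNIV \<and>
     c \<in> vect W \<union> spin W \<rightarrow>\<^sub>E Pow {1..N} \<and>
     (\<forall>e\<in>vect W. card (c e) = 1) \<and>
     (\<forall>e\<in>spin_even W. even (card (c e))) \<and>
     (\<forall>e\<in>spin_odd W. odd (card (c e))) \<and>
     (\<forall>v\<in>verts W. \<forall>e\<in>vect W. \<forall>f\<in>spin W. \<forall>g\<in>spin W. \<forall>a.
        c e = {a} \<longrightarrow> pathfinish f = v \<longrightarrow> pathstart g = v \<longrightarrow>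
        (pathfinish (orient (d e) e) = v \<longrightarrow> a \<notin> c f \<and> c g = c f \<union> {a}) \<and>
        (pathstart (orient (d e) e) = v \<longrightarrow> a \<notin> c g \<and> c f = c g \<union> {a}))}"

section \<open>Oriented cycles and the rotational\<close>

fun join_list :: "curve list \<Rightarrow> curve" where
  "join_list [] = (\<lambda>_. 0)"
| "join_list [p] = p"
| "join_list (p # q # ps) = p +++ join_list (q # ps)"

definition closed_chain :: "curve list \<Rightarrow> bool" where
  "closed_chain ps \<longleftrightarrow>
     ps \<noteq> [] \<and> distinct ps \<and>
     (\<forall>i<length ps. pathfinish (ps ! i) = pathstart (ps ! (Suc i mod length ps)))"

text \<open>
  In the sets \<open>C_prime\<close> and \<open>C_star\<close> below, which consist of oriented edges, every vertex is
  the end of at most one element and the start of at most one element. An oriented cycle is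
  identified with the set of its oriented edges, so that the choice of a starting point on it
  does not matter.
\<close>

definition cycles :: "curve set \<Rightarrow> curve set set" where
  "cycles S = {set ps | ps. set ps \<subseteq> S \<and> closed_chain ps}"

definition cycle_with_index :: "complex \<Rightarrow> curve set \<Rightarrow> bool" where
  "cycle_with_index w X \<longleftrightarrow>
     (\<exists>ps. set ps = X \<and> closed_chain ps \<and> simple_path (join_list ps) \<and>
           (\<forall>z\<in>inside (path_image (join_list ps)). winding_number (join_list ps) z = w))"

definition counterclockwise :: "curve set \<Rightarrow> bool" where
  "counterclockwise = cycle_with_index 1"

definition clockwise :: "curve set \<Rightarrow> bool" where
  "clockwise = cycle_with_index (-1)"

definition rotational :: "curve set \<Rightarrow> int" where
  "rotational S = int (card {X \<in> cycles S. counterclockwise X}) -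
                  int (card {X \<in> cycles S. clockwise X})"

section \<open>Degree and evaluation of webs\<close>

definition C_prime ::
  "web \<Rightarrow> (curve \<Rightarrow> bool) \<Rightarrow> (curve \<Rightarrow> nat set) \<Rightarrow> nat \<Rightarrow> nat \<Rightarrow> curve set" where
  "C_prime W d c a b =
     {orient (d e) e | e. e \<in> vect W \<and> c e = {b}} \<union>
     {orient (\<not> d e) e | e. e \<in> vect W \<and> c e = {a}} \<union>
     {e. e \<in> spin W \<and> b \<in> c e \<and> a \<notin> c e} \<union>
     {reversepath e | e. e \<in> spin W \<and> a \<in> c e \<and> b \<notin> c e}"

definition C_star ::
  "web \<Rightarrow> (curve \<Rightarrow> bool) \<Rightarrow> (curve \<Rightarrow> nat set) \<Rightarrow> nat \<Rightarrow> nat \<Rightarrow> curve set" where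
  "C_star W d c a b =
     {orient (d e) e | e. e \<in> vect W \<and> (c e = {a} \<or> c e = {b})} \<union>
     {e. e \<in> spin W \<and> a \<in> c e \<and> b \<in> c e} \<union>
     {reversepath e | e. e \<in> spin W \<and> a \<notin> c e \<and> b \<notin> c e}"

definition degree_of ::
  "nat \<Rightarrow> web \<Rightarrow> (curve \<Rightarrow> bool) \<Rightarrow> (curve \<Rightarrow> nat set) \<Rightarrow> int" where
  "degree_of N W d c =
     (\<Sum>(a, b) \<in> {(a, b). 1 \<le> a \<and> a < b \<and> b \<le> N}.
        rotational (C_prime W d c a b) + rotational (C_star W d c a b))"

text \<open>
  Laurent polynomials in \<open>q\<close> are regarded as elements of the field of formal Laurent series
  over the rationals; \<open>q\<close> is \<open>fls_X\<close> and \<open>fls_X_intpow k\<close> is its \<open>k\<close>-th power, for any integer \<open>k\<close>.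
\<close>

definition web_eval :: "nat \<Rightarrow> web \<Rightarrow> rat fls" where
  "web_eval N W = (\<Sum>(d, c) \<in> colorings N W. fls_X_intpow (degree_of N W d c))"

definition q_two :: "nat \<Rightarrow> rat fls" where
  "q_two k = (\<Prod>i=1..k. fls_X_intpow (int i) + fls_X_intpow (- int i))"

definition nonneg_laurent_polys :: "rat fls set" where
  "nonneg_laurent_polys = {f. finite {n. fls_nth f n \<noteq> 0} \<and> (\<forall>n. fls_nth f n \<in> \<nat>)}"

section \<open>4-valent plane graphs\<close>

record graph =
  gverts :: "complex set"
  gedges :: "curve set"

definition four_valent :: "graph \<Rightarrow> bool" where
  "four_valent G \<longleftrightarrow> plane_graph (gverts G) (gedges G) \<and>
     (\<forall>v\<in>gverts G. card (half_edges (gedges G) v) = 4)"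

definition circles :: "graph \<Rightarrow> curve set" where
  "circles G = {e \<in> gedges G. pathstart e \<notin> gverts G}"

definition proper_edges :: "graph \<Rightarrow> curve set" where
  "proper_edges G = {e \<in> gedges G. pathstart e \<in> gverts G}"

text \<open>
  The list of the four sides of a square, in their order along the square. That they form a
  closed chain means that the square is coherently oriented; it may be clockwise or
  counterclockwise.
\<close>

definition square :: "curve list \<Rightarrow> bool" where
  "square ps \<longleftrightarrow> length ps = 4 \<and> closed_chain ps \<and> simple_path (join_list ps)"

definition sq_inside :: "curve list \<Rightarrow> complex set" where
  "sq_inside ps = inside (path_image (join_list ps))"

definition sq_disc :: "curve list \<Rightarrow> complex set" where
  "sq_disc ps = path_image (join_list ps) \<union> sq_inside ps"

definition corners :: "curve list \<Rightarrow> complex set" where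
  "corners ps = pathstart ` set ps"

text \<open>
  \<open>W\<close> arises from \<open>G\<close> by replacing each vertex \<open>v\<close> by the square \<open>sq v\<close>. This square bounds a
  disc around \<open>v\<close>, which meets \<open>G\<close> only in the four initial pieces at \<open>v\<close> of the half-edges
  at \<open>v\<close>. Each of these pieces hits the boundary of the disc exactly once, in a corner of the
  square. The pieces are removed, leaving the part between the parameters \<open>s e\<close> and \<open>t e\<close> of
  each edge \<open>e\<close>. As the four corners are the points where the half-edges leave the disc, their
  order along the square is the cyclic order of the half-edges at \<open>v\<close>. The first and third side
  are spin-even, the second and fourth spin-odd; as any side may be listed first, both choices
  of parity are covered.
\<close>

definition square_resolution :: "graph \<Rightarrow> web \<Rightarrow> bool" where
  "square_resolution G W \<longleftrightarrow> web W \<and> (\<exists>sq s t.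
     (\<forall>v\<in>gverts G. square (sq v) \<and> v \<in> sq_inside (sq v)) \<and>
     (\<forall>v\<in>gverts G. \<forall>w\<in>gverts G. v \<noteq> w \<longrightarrow> sq_disc (sq v) \<inter> sq_disc (sq w) = {}) \<and>
     (\<forall>e\<in>circles G. \<forall>v\<in>gverts G. path_image e \<inter> sq_disc (sq v) = {}) \<and>
     (\<forall>e\<in>proper_edges G.
        0 < s e \<and> s e < t e \<and> t e < 1 \<and>
        e ` {0..<s e} \<subseteq> sq_inside (sq (pathstart e)) \<and>
        e ` {t e<..1} \<subseteq> sq_inside (sq (pathfinish e)) \<and>
        (\<forall>v\<in>gverts G. e ` {s e<..<t e} \<inter> sq_disc (sq v) = {})) \<and>
     (\<forall>v\<in>gverts G. corners (sq v) =
        {e (s e) | e. e \<in> proper_edges G \<and> pathstart e = v} \<union>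
        {e (t e) | e. e \<in> proper_edges G \<and> pathfinish e = v}) \<and>
     verts W = (\<Union>v\<in>gverts G. corners (sq v)) \<and>
     vect W = (\<lambda>e. subpath (s e) (t e) e) ` proper_edges G \<union> circles G \<and>
     spin_even W = (\<Union>v\<in>gverts G. {sq v ! 0, sq v ! 2}) \<and>
     spin_odd W = (\<Union>v\<in>gverts G. {sq v ! 1, sq v ! 3}))"

text \<open>
  \<open>is_graph_eval N G p\<close> states that \<open>p\<close> is a value of the evaluation of \<open>G\<close>, computed with some
  choice of squares. For each choice there is exactly one \<open>p\<close>, since \<open>q_two (N - 3)\<close> is nonzero.
\<close>

definition is_graph_eval :: "nat \<Rightarrow> graph \<Rightarrow> rat fls \<Rightarrow> bool" where
  "is_graph_eval N G p \<longleftrightarrow>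
     (\<exists>W. square_resolution G W \<and> q_two (N - 3) ^ card (gverts G) * p = web_eval N W)"

end

theory Submission
  imports Defs
begin

text \<open>
  Fix the orientations and colors of the vectorial edges. At a vertex of the 4-valent graph, the
  four edges carry either two colors, each twice, or one color \<open>x\<close> four times; the sides of the
  square are then determined up to a set \<open>A\<close> of the remaining colors, of prescribed parity.

  Adding a color \<open>b\<close> to \<open>A\<close> replaces, in the cycles of each pair \<open>a, b\<close>, some sides of the square
  by the reversed complementary sides. Evaluating the winding numbers of the cycles along the
  square at a point of the disc shows that the rotational changes by \<open>2 - n\<close> times the sign of the
  square, where \<open>n\<close> is the number of cycles before and after the change that meet the square. Here
  \<open>n\<close> is 1, 2 or 3 if \<open>a\<close> occurs 0, 2 or 4 times at the vertex. Hence the sum over \<open>A\<close> is, up to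
  a power of \<open>q\<close>, a product of factors \<open>q^m + q^(-m)\<close> which contains the factor \<open>q_two (N - 3)\<close>;
  cancelling the latter at every vertex leaves nonnegative coefficients.
\<close>

text \<open>The \<open>2\<close> in \<open>2 - n\<close> is twice the winding number of the square
  around a point of its disc. Each cycle meeting the square costs one sign, because twice its
  winding number there is its own sign plus that of the square. The obstacle is parity: adding a
  single color to a square leaves the set of colorings. Degrees are therefore compared on the larger
  class \<open>flow_coloring\<close>, and parity returns only in the sum over \<open>A\<close>. That
  sum factors because the sign \<open>1\<close>, \<open>0\<close> or \<open>-1\<close> with which a
  color \<open>a\<close> enters depends on the vectorial edges alone: an uninvolved \<open>a\<close>
  lies on all four sides or on none, and both cases give \<open>1\<close>. So exponents add over the
  colors in \<open>A\<close> and over the vertices. Up to the factor \<open>2\<close> and the sign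
  of the square, the exponent of \<open>b\<close> is the sum of the signs of the colors below
  \<open>b\<close>. Two involved colors leave exponents \<open>0, ..., N - 3\<close>; the exponent
  \<open>0\<close> absorbs the parity condition and the others give \<open>q_two (N - 3)\<close>.
  For one involved color, its \<open>-1\<close> cancels the \<open>1\<close> of a neighboring color,
  which leaves the same list and one spare factor.\<close>

text \<open>A disjoint union of oriented simple closed curves, cut into edges: unique successors and
  predecessors, no contact except at shared ends. A vertexless circle is its own successor.\<close>

definition cycle_system :: "curve set \<Rightarrow> bool" where
  "cycle_system S \<longleftrightarrow> finite S \<and> (\<forall>x\<in>S. simple_path x) \<and>
     inj_on pathstart S \<and> inj_on pathfinish S \<and> pathstart ` S = pathfinish ` S \<and>
     (\<forall>x\<in>S. \<forall>y\<in>S. x \<noteq> y \<longrightarrow>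
        path_image x \<inter> path_image y \<subseteq> {pathstart x, pathfinish x} \<inter> {pathstart y, pathfinish y})"

lemma cycle_systemD:
  assumes "cycle_system S"
  shows "finite S" "\<And>x. x \<in> S \<Longrightarrow> simple_path x" "\<And>x. x \<in> S \<Longrightarrow> path x"
    "\<And>x y. x \<in> S \<Longrightarrow> y \<in> S \<Longrightarrow> pathstart x = pathstart y \<Longrightarrow> x = y"
    "\<And>x y. x \<in> S \<Longrightarrow> y \<in> S \<Longrightarrow> pathfinish x = pathfinish y \<Longrightarrow> x = y"
    "\<And>x. x \<in> S \<Longrightarrow> \<exists>y\<in>S. pathstart y = pathfinish x"
    "\<And>x. x \<in> S \<Longrightarrow> \<exists>y\<in>S. pathfinish y = pathstart x"
    "\<And>x y. x \<in> S \<Longrightarrow> y \<in> S \<Longrightarrow> x \<noteq> y \<Longrightarrow>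
       path_image x \<inter> path_image y \<subseteq> {pathstart x, pathfinish x} \<inter> {pathstart y, pathfinish y}"
proof -
  have eq: "pathstart ` S = pathfinish ` S" using assms by (simp add: cycle_system_def)
  show "finite S" "\<And>x. x \<in> S \<Longrightarrow> simple_path x" "\<And>x. x \<in> S \<Longrightarrow> path x"
    using assms by (auto simp: cycle_system_def simple_path_def)
  show "\<And>x y. x \<in> S \<Longrightarrow> y \<in> S \<Longrightarrow> pathstart x = pathstart y \<Longrightarrow> x = y"
    "\<And>x y. x \<in> S \<Longrightarrow> y \<in> S \<Longrightarrow> pathfinish x = pathfinish y \<Longrightarrow> x = y"
    using assms by (auto simp: cycle_system_def inj_on_def)
  show "\<exists>y\<in>S. pathstart y = pathfinish x" if "x \<in> S" for x
  proof -
    have "pathfinish x \<in> pathstart ` S" using that eq by simp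
    thus ?thesis by force
  qed
  show "\<exists>y\<in>S. pathfinish y = pathstart x" if "x \<in> S" for x
  proof -
    have "pathstart x \<in> pathfinish ` S" using that eq by (metis imageI)
    thus ?thesis by force
  qed
  show "\<And>x y. x \<in> S \<Longrightarrow> y \<in> S \<Longrightarrow> x \<noteq> y \<Longrightarrow>
       path_image x \<inter> path_image y \<subseteq> {pathstart x, pathfinish x} \<inter> {pathstart y, pathfinish y}"
    using assms unfolding cycle_system_def by blast
qed

section \<open>Closed chains and the decomposition of a system into cycles\<close>

lemma closed_chain_last:
  assumes "closed_chain ps"
  shows "pathfinish (last ps) = pathstart (hd ps)"
proof -
  have ne: "ps \<noteq> []" using assms by (simp add: closed_chain_def)
  have "pathfinish (ps ! (length ps - 1)) = pathstart (ps ! (Suc (length ps - 1) mod length ps))"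
    using assms ne unfolding closed_chain_def by (metis diff_less length_greater_0_conv zero_less_one)
  thus ?thesis using ne by (simp add: last_conv_nth hd_conv_nth)
qed

lemma closed_chain_Suc:
  assumes "closed_chain ps" "Suc i < length ps"
  shows "pathfinish (ps ! i) = pathstart (ps ! Suc i)"
  using assms unfolding closed_chain_def by (metis Suc_lessD mod_less)

lemma closed_chainI:
  assumes "ps \<noteq> []" "distinct ps"
    "\<And>i. Suc i < length ps \<Longrightarrow> pathfinish (ps ! i) = pathstart (ps ! Suc i)"
    "pathfinish (last ps) = pathstart (hd ps)"
  shows "closed_chain ps"
  unfolding closed_chain_def
proof (intro conjI allI impI)
  fix i assume i: "i < length ps"
  show "pathfinish (ps ! i) = pathstart (ps ! (Suc i mod length ps))"
  proof (cases "Suc i = length ps")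
    case True
    hence "i = length ps - 1" by simp
    thus ?thesis using assms(1,4) True by (simp add: last_conv_nth hd_conv_nth)
  next
    case False
    thus ?thesis using assms(3)[of i] i by simp
  qed
qed (use assms in auto)

text \<open>A longest chain starting with \<open>e\<close> closes up. The successor of its last
  curve already lies on the chain; if it were not \<open>e\<close>, its predecessor in the chain and
  the last curve would have the same end.\<close>

lemma closed_chain_exists:
  assumes "cycle_system S" "e \<in> S"
  obtains ps where "closed_chain (e # ps)" "set (e # ps) \<subseteq> S"
proof -
  note CS = cycle_systemD[OF assms(1)]
  define P where "P ps \<longleftrightarrow> distinct (e # ps) \<and> set (e # ps) \<subseteq> S \<and>
    (\<forall>i. Suc i < length (e # ps) \<longrightarrow> pathfinish ((e # ps) ! i) = pathstart ((e # ps) ! Suc i))" for ps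
  have bd: "length ps \<le> card S" if "P ps" for ps
  proof -
    have "length (e # ps) = card (set (e # ps))"
      using that distinct_card unfolding P_def by metis
    also have "\<dots> \<le> card S" using that CS(1) card_mono unfolding P_def by metis
    finally show ?thesis by simp
  qed
  have P0: "P []" using assms(2) by (simp add: P_def)
  have "\<forall>ps. P ps \<longrightarrow> length ps < Suc (card S)" using bd by (simp add: less_Suc_eq_le)
  from ex_has_greatest_nat[OF P0 this]
  obtain ps where ps: "P ps" and max: "\<And>qs. P qs \<Longrightarrow> length qs \<le> length ps" by auto
  define l where "l = last (e # ps)"
  have d: "distinct (e # ps)" and sub: "set (e # ps) \<subseteq> S" using ps by (auto simp: P_def)
  have lS: "l \<in> S" using sub unfolding l_def using last_in_set[of "e # ps"] by blast
  then obtain y where y: "y \<in> S" "pathstart y = pathfinish l" using CS(6) by blast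
  have ch: "pathfinish ((e # ps) ! i) = pathstart ((e # ps) ! Suc i)" if "Suc i < length (e # ps)" for i
    using ps that unfolding P_def by blast
  have l': "l = (e # ps) ! length ps" by (simp add: l_def last_conv_nth)
  have "y \<in> set (e # ps)"
  proof (rule ccontr)
    assume n: "y \<notin> set (e # ps)"
    have "P (ps @ [y])" unfolding P_def
    proof (intro conjI allI impI)
      show "distinct (e # ps @ [y])" "set (e # ps @ [y]) \<subseteq> S" using n d sub y by auto
      fix i assume i: "Suc i < length (e # ps @ [y])"
      show "pathfinish ((e # ps @ [y]) ! i) = pathstart ((e # ps @ [y]) ! Suc i)"
      proof (cases "Suc i < length (e # ps)")
        case True
        thus ?thesis using ch[OF True] by (cases i) (simp_all add: nth_append)
      next
        case False
        hence "i = length ps" using i by simp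
        thus ?thesis using y l' by (simp add: nth_append nth_Cons')
      qed
    qed
    from max[OF this] show False by simp
  qed
  hence "\<exists>i<length (e # ps). (e # ps) ! i = y" by (simp only: in_set_conv_nth)
  then obtain i where i: "i < length (e # ps)" "y = (e # ps) ! i" by blast
  have "i = 0"
  proof (rule ccontr)
    assume "i \<noteq> 0"
    then obtain j where j: "i = Suc j" by (cases i) auto
    have "pathfinish ((e # ps) ! j) = pathfinish l" using ch[of j] i j y by simp
    moreover have "(e # ps) ! j \<in> S" using sub i j by (metis Suc_lessD nth_mem subsetD)
    ultimately have "(e # ps) ! j = (e # ps) ! length ps" using CS(5) lS l' by metis
    hence "j = length ps" using d i j nth_eq_iff_index_eq[OF d, of j "length ps"] by simp
    thus False using i j by simp
  qed
  hence "pathfinish l = pathstart e" using y i by simp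
  hence "closed_chain (e # ps)" using closed_chainI[of "e # ps"] d ch unfolding l_def by simp
  with sub that show ?thesis by blast
qed

lemma cycles_subset: "X \<in> cycles S \<Longrightarrow> X \<subseteq> S" by (auto simp: cycles_def)

lemma finite_cycles: "finite S \<Longrightarrow> finite (cycles S)"
  by (rule finite_subset[of _ "Pow S"]) (auto simp: cycles_def)

lemma cycle_closed:
  assumes "cycle_system S" "X \<in> cycles S" "x \<in> X" "y \<in> S" "pathstart y = pathfinish x"
  shows "y \<in> X"
proof -
  obtain ps where ps: "X = set ps" "set ps \<subseteq> S" "closed_chain ps" using assms(2) by (auto simp: cycles_def)
  obtain i where i: "i < length ps" "x = ps ! i" using assms(3) by (auto simp: ps(1) in_set_conv_nth)
  let ?z = "ps ! (Suc i mod length ps)"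
  have n: "0 < length ps" using i(1) by (cases ps) auto
  have z: "?z \<in> set ps" using mod_less_divisor[OF n] by (rule nth_mem)
  moreover have "pathstart ?z = pathstart y" using ps(3) i assms(5) by (simp add: closed_chain_def)
  ultimately have "?z = y" using cycle_systemD(4)[OF assms(1)] assms(4) ps(2) by blast
  thus ?thesis using z ps(1) by simp
qed

text \<open>A cycle contains with each curve its only successor in \<open>S\<close>, so walking
  around one cycle from the common curve never leaves the other.\<close>

lemma cycle_eqI:
  assumes S: "cycle_system S" and X: "X \<in> cycles S" and Y: "Y \<in> cycles S" and x: "x \<in> X" "x \<in> Y"
  shows "X = Y"
proof -
  have sub: "A \<subseteq> B" if A: "A \<in> cycles S" and B: "B \<in> cycles S" and x: "x \<in> A" "x \<in> B" for A B
  proof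
    fix y assume "y \<in> A"
    obtain ps where ps: "A = set ps" "set ps \<subseteq> S" "closed_chain ps" using A by (auto simp: cycles_def)
    let ?n = "length ps"
    obtain i where i: "i < ?n" "x = ps ! i" using x(1) by (auto simp: ps(1) in_set_conv_nth)
    obtain j where j: "j < ?n" "y = ps ! j" using \<open>y \<in> A\<close> by (auto simp: ps(1) in_set_conv_nth)
    have step: "ps ! ((i + k) mod ?n) \<in> B" for k
    proof (induction k)
      case 0 thus ?case using i x by simp
    next
      case (Suc k)
      let ?m = "(i + k) mod ?n"
      have "?m < ?n" using i by (intro mod_less_divisor) auto
      moreover have "Suc ?m mod ?n = (i + Suc k) mod ?n" by (simp add: mod_Suc_eq)
      ultimately have "pathstart (ps ! ((i + Suc k) mod ?n)) = pathfinish (ps ! ?m)"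
        using ps(3) unfolding closed_chain_def by metis
      moreover have "ps ! ((i + Suc k) mod ?n) \<in> S"
        using ps(2) nth_mem[OF mod_less_divisor] i by (metis gr_implies_not0 neq0_conv subsetD)
      ultimately show ?case using cycle_closed[OF S B Suc] by blast
    qed
    \<comment> \<open>Going \<open>?n - i + j\<close> steps from index \<open>i\<close> wraps around
      to index \<open>j\<close>, whether or not \<open>i\<close> precedes \<open>j\<close>.\<close>
    have "(i + (?n - i + j)) mod ?n = j" using i j by simp
    with step[of "?n - i + j"] j show "y \<in> B" by simp
  qed
  show ?thesis using sub[OF X Y x] sub[OF Y X x(2,1)] by blast
qed

lemma cycle_through:
  assumes "cycle_system S" "e \<in> S"
  obtains X where "X \<in> cycles S" "e \<in> X"
proof -
  obtain ps where "closed_chain (e # ps)" "set (e # ps) \<subseteq> S" using closed_chain_exists[OF assms] .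
  hence "set (e # ps) \<in> cycles S" unfolding cycles_def by blast
  moreover have "e \<in> set (e # ps)" by simp
  ultimately show ?thesis using that by blast
qed

text \<open>Any curve of a cycle can serve as its first one. This allows a cycle to be cut at a
  prescribed edge.\<close>

lemma cycle_as_chain:
  assumes "cycle_system S" "X \<in> cycles S" "e \<in> X"
  obtains ps where "X = set (e # ps)" "closed_chain (e # ps)"
proof -
  obtain ps where ps: "closed_chain (e # ps)" "set (e # ps) \<subseteq> S"
    using closed_chain_exists[OF assms(1)] assms cycles_subset by blast
  hence "set (e # ps) \<in> cycles S" unfolding cycles_def by blast
  hence "X = set (e # ps)" using cycle_eqI[OF assms(1,2) _ assms(3)] by simp
  thus ?thesis using that ps by blast
qed

lemma cycle_closed_back:
  assumes "cycle_system S" "X \<in> cycles S" "y \<in> X" "x \<in> S" "pathstart y = pathfinish x"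
  shows "x \<in> X"
proof -
  obtain Y where Y: "Y \<in> cycles S" "x \<in> Y" using cycle_through[OF assms(1,4)] by blast
  have "y \<in> Y" using cycle_closed[OF assms(1) Y _ assms(5)] assms(2,3) cycles_subset by blast
  hence "X = Y" using cycle_eqI[OF assms(1,2) Y(1) assms(3)] by blast
  thus ?thesis using Y by simp
qed

lemma cycles_partition:
  assumes "cycle_system S"
  shows "\<Union>(cycles S) = S" "\<And>X Y. X \<in> cycles S \<Longrightarrow> Y \<in> cycles S \<Longrightarrow> X \<noteq> Y \<Longrightarrow> X \<inter> Y = {}"
proof -
  show "\<Union>(cycles S) = S"
    using cycles_subset cycle_through[OF assms] by blast
  show "X \<inter> Y = {}" if "X \<in> cycles S" "Y \<in> cycles S" "X \<noteq> Y" for X Y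
    using cycle_eqI[OF assms that(1,2)] that(3) by blast
qed

section \<open>Cycles as simple closed curves\<close>

definition union_image :: "curve set \<Rightarrow> complex set" where
  "union_image X = (\<Union>x\<in>X. path_image x)"

text \<open>
  Winding numbers of open paths are not integral, but they are additive, so that systems of
  cycles can be compared edge by edge.
\<close>

definition total_winding :: "curve set \<Rightarrow> complex \<Rightarrow> complex" where
  "total_winding X z = (\<Sum>x\<in>X. winding_number x z)"

lemma join_list_Cons: "ps \<noteq> [] \<Longrightarrow> join_list (p # ps) = p +++ join_list ps"
  by (cases ps) auto

text \<open>By the last part, the winding number of the concatenation forgets the order of the
  pieces and can be read off the set of edges.\<close>

lemma join_list_props:
  assumes "ps \<noteq> []" "\<And>p. p \<in> set ps \<Longrightarrow> path p"
    "\<And>i. Suc i < length ps \<Longrightarrow> pathfinish (ps ! i) = pathstart (ps ! Suc i)"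
  shows "path (join_list ps)" "pathstart (join_list ps) = pathstart (hd ps)"
    "pathfinish (join_list ps) = pathfinish (last ps)" "path_image (join_list ps) = union_image (set ps)"
    "distinct ps \<Longrightarrow> z \<notin> union_image (set ps) \<Longrightarrow> winding_number (join_list ps) z = total_winding (set ps) z"
proof -
  have "path (join_list ps) \<and> pathstart (join_list ps) = pathstart (hd ps) \<and>
    pathfinish (join_list ps) = pathfinish (last ps) \<and> path_image (join_list ps) = union_image (set ps) \<and>
    (distinct ps \<longrightarrow> z \<notin> union_image (set ps) \<longrightarrow> winding_number (join_list ps) z = total_winding (set ps) z)"
    using assms
  proof (induction ps)
    case Nil thus ?case by simp
  next
    case (Cons p ps)
    show ?case
    proof (cases "ps = []")
      case True thus ?thesis using Cons.prems by (simp add: union_image_def total_winding_def)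
    next
      case False
      have c: "pathfinish (ps ! i) = pathstart (ps ! Suc i)" if "Suc i < length ps" for i
        using Cons.prems(3)[of "Suc i"] that by simp
      note IH = Cons.IH[OF False _ c, simplified]
      have IH': "path (join_list ps)" "pathstart (join_list ps) = pathstart (hd ps)"
        "pathfinish (join_list ps) = pathfinish (last ps)" "path_image (join_list ps) = union_image (set ps)"
        "distinct ps \<Longrightarrow> z \<notin> union_image (set ps) \<Longrightarrow> winding_number (join_list ps) z = total_winding (set ps) z"
        using IH Cons.prems(2) by auto
      have j: "pathfinish p = pathstart (join_list ps)"
        using Cons.prems(3)[of 0] False IH'(2) by (simp add: hd_conv_nth)
      have p: "path p" using Cons.prems(2) by simp
      show ?thesis unfolding join_list_Cons[OF False]
        using IH' j p False
        by (auto simp: path_image_join union_image_def total_winding_def winding_number_join)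
    qed
  qed
  thus "path (join_list ps)" "pathstart (join_list ps) = pathstart (hd ps)"
    "pathfinish (join_list ps) = pathfinish (last ps)" "path_image (join_list ps) = union_image (set ps)"
    "distinct ps \<Longrightarrow> z \<notin> union_image (set ps) \<Longrightarrow> winding_number (join_list ps) z = total_winding (set ps) z"
    by blast+
qed

lemma arc_join_list:
  assumes "ps \<noteq> []" "\<And>p. p \<in> set ps \<Longrightarrow> arc p"
    "\<And>i. Suc i < length ps \<Longrightarrow> pathfinish (ps ! i) = pathstart (ps ! Suc i)"
    "\<And>i j. i < j \<Longrightarrow> j < length ps \<Longrightarrow>
       path_image (ps ! i) \<inter> path_image (ps ! j) \<subseteq> (if j = Suc i then {pathstart (ps ! j)} else {})"
  shows "arc (join_list ps)"
  using assms
proof (induction ps)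
  case Nil thus ?case by simp
next
  case (Cons p ps)
  show ?case
  proof (cases "ps = []")
    case True thus ?thesis using Cons.prems by simp
  next
    case False
    have c: "pathfinish (ps ! i) = pathstart (ps ! Suc i)" if "Suc i < length ps" for i
      using Cons.prems(3)[of "Suc i"] that by simp
    have a: "arc (join_list ps)"
    proof (rule Cons.IH[OF False _ c])
      show "\<And>p. p \<in> set ps \<Longrightarrow> arc p" using Cons.prems(2) by simp
      fix i j assume "i < j" "j < length ps"
      thus "path_image (ps ! i) \<inter> path_image (ps ! j) \<subseteq> (if j = Suc i then {pathstart (ps ! j)} else {})"
        using Cons.prems(4)[of "Suc i" "Suc j"] by (simp split: if_splits)
    qed
    have pp: "\<And>p. p \<in> set ps \<Longrightarrow> path p" using Cons.prems(2) arc_imp_path by auto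
    note J = join_list_props[OF False pp c]
    have j: "pathfinish p = pathstart (join_list ps)"
      using Cons.prems(3)[of 0] False J(2) by (simp add: hd_conv_nth)
    have "path_image p \<inter> union_image (set ps) \<subseteq> {pathstart (join_list ps)}"
    proof
      fix z assume z: "z \<in> path_image p \<inter> union_image (set ps)"
      then obtain j where jj: "j < length ps" "z \<in> path_image (ps ! j)"
        by (auto simp: union_image_def in_set_conv_nth)
      have "z \<in> (if j = 0 then {pathstart (ps ! j)} else {})"
        using Cons.prems(4)[of 0 "Suc j"] jj z by (auto split: if_splits)
      thus "z \<in> {pathstart (join_list ps)}" using J(2) False by (auto simp: hd_conv_nth split: if_splits)
    qed
    thus ?thesis unfolding join_list_Cons[OF False]
      using a j Cons.prems(2) J(4) by (intro arc_join) auto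
  qed
qed

text \<open>Cuts a cycle at \<open>p\<close>: the edge \<open>p\<close> and the rest are two arcs
  with the same ends and no other common point. This shows that cycles are simple, and it later
  serves to remove an edge shared by two cycles.\<close>

lemma cycle_arcs:
  assumes S: "cycle_system S" and ps: "closed_chain (p # ps)" "set (p # ps) \<subseteq> S" and ne: "ps \<noteq> []"
  shows "arc p" "arc (join_list ps)" "pathfinish p = pathstart (join_list ps)"
    "pathfinish (join_list ps) = pathstart p" "path (join_list ps)" "path_image (join_list ps) = union_image (set ps)"
    "z \<notin> union_image (set ps) \<Longrightarrow> winding_number (join_list ps) z = total_winding (set ps) z"
    "path_image p \<inter> path_image (join_list ps) \<subseteq> {pathstart p, pathstart (join_list ps)}"
proof -
  note CS = cycle_systemD[OF S]
  let ?l = "p # ps"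
  have d: "distinct ?l" using ps(1) by (simp add: closed_chain_def)
  have lS: "?l ! i \<in> S" if "i < length ?l" for i using ps(2) that nth_mem by blast
  have c: "pathfinish (?l ! i) = pathstart (?l ! (Suc i mod length ?l))" if "i < length ?l" for i
    using ps(1) that by (simp only: closed_chain_def)
  have cS: "pathfinish (?l ! i) = pathstart (?l ! Suc i)" if "Suc i < length ?l" for i
    using closed_chain_Suc[OF ps(1) that] .
  have st: "i = j" if "pathstart (?l ! i) = pathstart (?l ! j)" "i < length ?l" "j < length ?l" for i j
    using CS(4)[OF lS lS] that d nth_eq_iff_index_eq by blast
  have ft: "i = j" if "pathfinish (?l ! i) = pathfinish (?l ! j)" "i < length ?l" "j < length ?l" for i j
    using CS(5)[OF lS lS] that d nth_eq_iff_index_eq by blast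
  have len: "length ?l \<ge> 2" using ne by (cases ps) auto
  have arcs: "arc (?l ! i)" if i: "i < length ?l" for i
  proof -
    \<comment> \<open>A closed curve would be its own successor, but the chain has at least two
      distinct curves.\<close>
    have "pathfinish (?l ! i) \<noteq> pathstart (?l ! i)"
    proof
      assume "pathfinish (?l ! i) = pathstart (?l ! i)"
      hence "Suc i mod length ?l = i" using c[OF i] st[of "Suc i mod length ?l" i] i
        by (metis length_pos_if_in_set list.set_intros(1) mod_less_divisor)
      thus False using i len by (cases "Suc i = length ?l") auto
    qed
    thus ?thesis using CS(2)[OF lS[OF i]] simple_path_imp_arc by blast
  qed
  \<comment> \<open>Two curves of the chain touch only where one ends and the other starts, so they
    are neighbors. The second set accounts for the last and the first curve meeting at the base
    point; for a chain of two curves both exceptions occur.\<close>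
  have disj: "path_image (?l ! i) \<inter> path_image (?l ! j)
     \<subseteq> (if j = Suc i then {pathstart (?l ! j)} else {}) \<union> (if i = 0 \<and> Suc j = length ?l then {pathstart (?l ! 0)} else {})"
    if ij: "i < j" "j < length ?l" for i j
  proof
    fix z assume z: "z \<in> path_image (?l ! i) \<inter> path_image (?l ! j)"
    have i: "i < length ?l" using ij by simp
    have "?l ! i \<noteq> ?l ! j" using ij i d nth_eq_iff_index_eq by (metis less_irrefl)
    hence zz: "z \<in> {pathstart (?l ! i), pathfinish (?l ! i)} \<inter> {pathstart (?l ! j), pathfinish (?l ! j)}"
      using CS(8)[OF lS[OF i] lS[OF ij(2)]] z by blast
    have "pathstart (?l ! i) \<noteq> pathstart (?l ! j)" using st[OF _ i ij(2)] ij by auto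
    moreover have "pathfinish (?l ! i) \<noteq> pathfinish (?l ! j)" using ft[OF _ i ij(2)] ij by auto
    ultimately consider "z = pathfinish (?l ! i)" "z = pathstart (?l ! j)"
      | "z = pathstart (?l ! i)" "z = pathfinish (?l ! j)" using zz by auto
    thus "z \<in> (if j = Suc i then {pathstart (?l ! j)} else {}) \<union> (if i = 0 \<and> Suc j = length ?l then {pathstart (?l ! 0)} else {})"
    proof cases
      case 1
      have "Suc i = j" using cS[of i] 1 ij st[of "Suc i" j] by simp
      thus ?thesis using 1 by simp
    next
      case 2
      have "Suc j mod length ?l = i" using c[OF ij(2)] 2 st[of "Suc j mod length ?l" i] i by simp
      hence "Suc j = length ?l" "i = 0" using ij by (cases "Suc j = length ?l"; simp)+
      thus ?thesis using 2 by simp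
    qed
  qed
  show "arc p" using arcs[of 0] by simp
  have arcs': "arc q" if "q \<in> set ps" for q
  proof -
    from that have "\<exists>i<length ps. ps ! i = q" by (simp only: in_set_conv_nth)
    then obtain i where "i < length ps" "ps ! i = q" by blast
    thus ?thesis using arcs[of "Suc i"] by simp
  qed
  have c': "pathfinish (ps ! i) = pathstart (ps ! Suc i)" if "Suc i < length ps" for i
    using cS[of "Suc i"] that by simp
  show "arc (join_list ps)"
  proof (rule arc_join_list[OF ne arcs' c'])
    fix i j assume "i < j" "j < length ps"
    thus "path_image (ps ! i) \<inter> path_image (ps ! j) \<subseteq> (if j = Suc i then {pathstart (ps ! j)} else {})"
      using disj[of "Suc i" "Suc j"] by (simp split: if_splits)
  qed
  note J = join_list_props[OF ne _ c']
  have pp: "\<And>q. q \<in> set ps \<Longrightarrow> path q" using arcs' arc_imp_path by blast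
  show 1: "pathfinish p = pathstart (join_list ps)" using J(2)[OF pp] cS[of 0] ne by (simp add: hd_conv_nth)
  show "pathfinish (join_list ps) = pathstart p" using J(3)[OF pp] closed_chain_last[OF ps(1)] ne by simp
  show "path (join_list ps)" "path_image (join_list ps) = union_image (set ps)"
    using J(1,4)[OF pp] by blast+
  show "winding_number (join_list ps) z = total_winding (set ps) z" if "z \<notin> union_image (set ps)"
    using J(5)[OF pp] that d by simp
  show "path_image p \<inter> path_image (join_list ps) \<subseteq> {pathstart p, pathstart (join_list ps)}"
  proof
    fix z assume z: "z \<in> path_image p \<inter> path_image (join_list ps)"
    hence "z \<in> union_image (set ps)" using J(4)[OF pp] by blast
    then obtain j where jj: "j < length ps" "z \<in> path_image (ps ! j)"
      by (auto simp: union_image_def in_set_conv_nth)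
    show "z \<in> {pathstart p, pathstart (join_list ps)}"
      using disj[of 0 "Suc j"] jj z 1 cS[of 0] ne
      by (cases "j = 0"; auto simp: hd_conv_nth split: if_splits)
  qed
qed

lemma cycle_loop:
  assumes S: "cycle_system S" and ps: "closed_chain ps" "set ps \<subseteq> S"
  shows "simple_path (join_list ps)" "pathfinish (join_list ps) = pathstart (join_list ps)"
    "path_image (join_list ps) = union_image (set ps)"
    "z \<notin> union_image (set ps) \<Longrightarrow> winding_number (join_list ps) z = total_winding (set ps) z"
proof -
  have ne: "ps \<noteq> []" using ps by (simp add: closed_chain_def)
  have pp: "\<And>p. p \<in> set ps \<Longrightarrow> path p" using ps(2) cycle_systemD(3)[OF S] by blast
  have c': "pathfinish (ps ! i) = pathstart (ps ! Suc i)" if "Suc i < length ps" for i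
    using closed_chain_Suc[OF ps(1) that] .
  note J = join_list_props[OF ne pp c']
  show "pathfinish (join_list ps) = pathstart (join_list ps)"
    using J(2,3) closed_chain_last[OF ps(1)] by simp
  show "path_image (join_list ps) = union_image (set ps)" using J(4) .
  show "winding_number (join_list ps) z = total_winding (set ps) z" if "z \<notin> union_image (set ps)"
    using J(5) that ps(1) by (simp add: closed_chain_def)
  show "simple_path (join_list ps)"
  proof (cases ps)
    case Nil thus ?thesis using ne by simp
  next
    case (Cons p qs)
    show ?thesis
    proof (cases "qs = []")
      case True
      thus ?thesis using Cons ps(2) cycle_systemD(2)[OF S] by simp
    next
      case False
      note A = cycle_arcs[OF S _ _ False, of p]
      show ?thesis unfolding Cons join_list_Cons[OF False]
        using A ps unfolding Cons by (intro simple_path_join_loop) auto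
    qed
  qed
qed

text \<open>The sign of a cycle. The default \<open>- 1\<close> is the clockwise case, since by
  \<open>cycle_winding\<close> a cycle of a \<open>cycle_system\<close> has exactly one of the two
  orientations.\<close>

definition turn :: "curve set \<Rightarrow> int" where
  "turn X = (if counterclockwise X then 1 else - 1)"

text \<open>The Jordan curve theorem and the index of simple closed curves, restated for edge sets.
  The existential over chains in \<open>cycle_with_index\<close> is harmless because the winding
  number depends on the edge set only.\<close>

lemma cycle_winding:
  assumes S: "cycle_system S" and X: "X \<in> cycles S"
  shows "z \<in> inside (union_image X) \<Longrightarrow> total_winding X z = of_int (turn X)"
    "z \<in> outside (union_image X) \<Longrightarrow> total_winding X z = 0"
    "counterclockwise X \<longleftrightarrow> \<not> clockwise X"
    "inside (union_image X) \<noteq> {}" "open (inside (union_image X))" "connected (inside (union_image X))"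
    "inside (union_image X) \<union> outside (union_image X) = - union_image X"
    "frontier (inside (union_image X)) = union_image X" "frontier (outside (union_image X)) = union_image X"
    "inside (union_image X) \<inter> outside (union_image X) = {}" "open (outside (union_image X))"
proof -
  obtain ps where ps: "X = set ps" "set ps \<subseteq> S" "closed_chain ps" using X by (auto simp: cycles_def)
  note L = cycle_loop[OF S ps(3,2)]
  note Jo = Jordan_inside_outside[OF L(1,2), unfolded L(3)]
  show ne: "inside (union_image X) \<noteq> {}" and "open (inside (union_image X))" "connected (inside (union_image X))"
    "inside (union_image X) \<union> outside (union_image X) = - union_image X"
    "frontier (inside (union_image X)) = union_image X" "frontier (outside (union_image X)) = union_image X"
    "inside (union_image X) \<inter> outside (union_image X) = {}" "open (outside (union_image X))"
    using Jo ps(1) by blast+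
  have wn: "winding_number (join_list qs) z = total_winding X z"
    if "set qs = X" "closed_chain qs" "z \<notin> union_image X" for qs z
    using cycle_loop(4)[OF S that(2)] that(1,3) ps by simp
  have im: "path_image (join_list qs) = union_image X" if "set qs = X" "closed_chain qs" for qs
    using cycle_loop(3)[OF S that(2)] that ps by simp
  have iff: "cycle_with_index w X \<longleftrightarrow> (\<forall>z\<in>inside (union_image X). total_winding X z = w)" for w
  proof
    assume "cycle_with_index w X"
    then obtain qs where qs: "set qs = X" "closed_chain qs"
      "\<forall>z\<in>inside (path_image (join_list qs)). winding_number (join_list qs) z = w"
      unfolding cycle_with_index_def by blast
    show "\<forall>z\<in>inside (union_image X). total_winding X z = w"
    proof
      fix z assume z: "z \<in> inside (union_image X)"
      hence "z \<notin> union_image X" using inside_no_overlap by blast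
      thus "total_winding X z = w" using wn[OF qs(1,2), of z, symmetric] qs(3) z im[OF qs(1,2)] by simp
    qed
  next
    assume w: "\<forall>z\<in>inside (union_image X). total_winding X z = w"
    have "winding_number (join_list ps) z = w" if z: "z \<in> inside (path_image (join_list ps))" for z
    proof -
      have z': "z \<in> inside (union_image X)" using z L(3) ps(1) by simp
      hence "z \<notin> union_image X" using inside_no_overlap by blast
      thus ?thesis using wn[OF ps(1)[symmetric] ps(3), of z] w z' by simp
    qed
    thus "cycle_with_index w X" unfolding cycle_with_index_def using ps L(1) by metis
  qed
  have sp: "simple_path (join_list ps)" "pathfinish (join_list ps) = pathstart (join_list ps)" using L by auto
  have "(\<forall>z\<in>inside (union_image X). total_winding X z = 1) \<or> (\<forall>z\<in>inside (union_image X). total_winding X z = -1)"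
  proof -
    have "z \<notin> union_image X" if "z \<in> inside (union_image X)" for z using that inside_no_overlap by blast
    hence "total_winding X z = winding_number (join_list ps) z" if "z \<in> inside (path_image (join_list ps))" for z
      using that wn[OF ps(1)[symmetric] ps(3)] im[OF ps(1)[symmetric] ps(3)] by simp
    thus ?thesis using im[OF ps(1)[symmetric] ps(3)] by (metis simple_closed_path_winding_number_inside[OF sp(1)])
  qed
  moreover have "\<not> ((\<forall>z\<in>inside (union_image X). total_winding X z = 1) \<and> (\<forall>z\<in>inside (union_image X). total_winding X z = -1))"
  proof -
    obtain z where "z \<in> inside (union_image X)" using ne by blast
    thus ?thesis by force
  qed
  ultimately show "counterclockwise X \<longleftrightarrow> \<not> clockwise X"
    and "z \<in> inside (union_image X) \<Longrightarrow> total_winding X z = of_int (turn X)"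
    unfolding turn_def counterclockwise_def clockwise_def iff by auto
  show "total_winding X z = 0" if "z \<in> outside (union_image X)"
  proof -
    have "z \<notin> union_image X" using that outside_no_overlap by blast
    thus ?thesis using wn[OF ps(1)[symmetric] ps(3)]
        winding_number_zero_in_outside[OF simple_path_imp_path[OF sp(1)] sp(2), of z] that L(3) ps(1) by simp
  qed
qed

lemma turn_cases: "turn X = 1 \<or> turn X = - 1" by (simp add: turn_def)

lemma rotational_eq_sum_turn:
  assumes "cycle_system S"
  shows "rotational S = (\<Sum>X\<in>cycles S. turn X)"
proof -
  have f: "finite (cycles S)" using finite_cycles cycle_systemD(1)[OF assms] by blast
  have "(\<Sum>X\<in>cycles S. turn X) =
     (\<Sum>X\<in>cycles S. (if counterclockwise X then 1 else 0) - (if clockwise X then 1 else 0))"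
    using cycle_winding(3)[OF assms] by (intro sum.cong) (auto simp: turn_def)
  also have "\<dots> = rotational S" using f
    by (simp add: sum_subtractf rotational_def sum.If_cases Int_def)
  finally show ?thesis by simp
qed

lemma total_winding_eq_sum_cycles:
  assumes "cycle_system S"
  shows "total_winding S z = (\<Sum>X\<in>cycles S. total_winding X z)"
proof -
  have "total_winding S z = sum (\<lambda>x. winding_number x z) (\<Union>(cycles S))"
    using cycles_partition(1)[OF assms] by (simp add: total_winding_def)
  also have "\<dots> = (\<Sum>X\<in>cycles S. total_winding X z)"
  proof -
    have "\<forall>X\<in>cycles S. finite X" using cycle_systemD(1)[OF assms] cycles_subset finite_subset by metis
    moreover have "\<forall>X\<in>cycles S. \<forall>Y\<in>cycles S. X \<noteq> Y \<longrightarrow> X \<inter> Y = {}"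
      using cycles_partition(2)[OF assms] by blast
    ultimately show ?thesis unfolding total_winding_def by (subst sum.Union_disjoint) simp_all
  qed
  finally show ?thesis .
qed

text \<open>
  Crossing the common edge \<open>\<alpha>\<close> at its midpoint changes the winding numbers of \<open>X\<close> and of \<open>Q\<close> by
  the same amount, because the difference of the two cycles does not contain \<open>\<alpha>\<close>. As \<open>X\<close> has
  only the winding numbers \<open>0\<close> and \<open>turn X\<close>, this decides on which side of \<open>X\<close> the disc lies.
\<close>

lemma cycle_winding_beside:
  assumes S: "cycle_system S" "X \<in> cycles S" and Q: "cycle_system Q" "Q \<in> cycles Q"
    and \<alpha>: "\<alpha> \<in> X" "\<alpha> \<in> Q" "pathfinish \<alpha> \<noteq> pathstart \<alpha>"
    and disj: "union_image X \<inter> inside (union_image Q) = {}" and z: "z \<in> inside (union_image Q)"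
  shows "2 * total_winding X z = of_int (turn X + turn Q)"
proof -
  obtain ps where ps: "X = set (\<alpha> # ps)" "closed_chain (\<alpha> # ps)"
    using cycle_as_chain[OF S \<alpha>(1)] .
  obtain qs where qs: "Q = set (\<alpha> # qs)" "closed_chain (\<alpha> # qs)"
    using cycle_as_chain[OF Q \<alpha>(2)] .
  have pne: "ps \<noteq> []" and qne: "qs \<noteq> []"
    using closed_chain_last[OF ps(2)] closed_chain_last[OF qs(2)] \<alpha>(3) by auto
  have psS: "set (\<alpha> # ps) \<subseteq> S" using cycles_subset[OF S(2)] ps(1) by simp
  have qsQ: "set (\<alpha> # qs) \<subseteq> Q" using qs(1) by simp
  note P = cycle_arcs[OF S(1) ps(2) psS pne]
  note R = cycle_arcs[OF Q(1) qs(2) qsQ qne]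
  note WX = cycle_winding[OF S]
  note WQ = cycle_winding[OF Q]
  have imX: "union_image X = path_image \<alpha> \<union> union_image (set ps)" by (simp add: ps(1) union_image_def)
  have imQ: "union_image Q = path_image \<alpha> \<union> union_image (set qs)" by (simp add: qs(1) union_image_def)
  define K where "K = union_image (set ps) \<union> union_image (set qs)"
  \<comment> \<open>Both remainders run from the end of \<open>\<alpha>\<close> to its start, so
    going along one and back along the other closes up. Its winding number is that of
    \<open>X\<close> minus that of \<open>Q\<close>, the contribution of \<open>\<alpha>\<close>
    cancelling.\<close>
  define \<gamma> where "\<gamma> = join_list ps +++ reversepath (join_list qs)"
  have \<gamma>: "path \<gamma>" "pathfinish \<gamma> = pathstart \<gamma>" "path_image \<gamma> = K"
    unfolding \<gamma>_def K_def using P(3-6) R(3-6) by (simp_all add: path_image_join)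
  have wn\<gamma>: "winding_number \<gamma> x = total_winding X x - total_winding Q x" if "x \<notin> K" for x
  proof -
    have x: "x \<notin> union_image (set ps)" "x \<notin> union_image (set qs)" using that by (auto simp: K_def)
    have "winding_number \<gamma> x = total_winding (set ps) x - total_winding (set qs) x"
      unfolding \<gamma>_def using P(3-6) R(3-6) P(7)[OF x(1)] R(7)[OF x(2)] x
      by (subst winding_number_join) (auto simp: winding_number_reversepath)
    moreover have "total_winding X x = winding_number \<alpha> x + total_winding (set ps) x" "total_winding Q x = winding_number \<alpha> x + total_winding (set qs) x"
      using ps qs by (auto simp: total_winding_def closed_chain_def)
    ultimately show ?thesis by simp
  qed
  define m where "m = \<alpha> (1/2)"
  have m: "m \<in> path_image \<alpha>" by (auto simp: m_def path_image_def)
  have m': "m \<noteq> pathstart \<alpha>" "m \<noteq> pathfinish \<alpha>"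
    using P(1) inj_onD[of \<alpha> "{0..1}" "1/2" 0] inj_onD[of \<alpha> "{0..1}" "1/2" 1]
    unfolding arc_def m_def pathstart_def pathfinish_def by auto
  have "m \<notin> path_image (join_list ps)"
    using subsetD[OF P(8), of m] m m' P(3) by auto
  moreover have "m \<notin> path_image (join_list qs)"
    using subsetD[OF R(8), of m] m m' R(3) by auto
  ultimately have mK: "m \<notin> K" using P(6) R(6) unfolding K_def by blast
  have "closed K" using \<gamma>(1,3) closed_path_image by metis
  then obtain e where e: "e > 0" "ball m e \<subseteq> - K"
    using mK open_contains_ball[of "- K"] by (auto simp: closed_def)
  \<comment> \<open>Every point of a Jordan curve is on the frontier of both sides, so the ball
    around \<open>m\<close>, which misses \<open>\<gamma>\<close>, contains points on either side of
    \<open>Q\<close>.\<close>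
  have "m \<in> closure (inside (union_image Q))" "m \<in> closure (outside (union_image Q))"
    using m imQ WQ(8,9) by (auto simp: frontier_def)
  then obtain z' u where z': "z' \<in> inside (union_image Q)" "z' \<in> ball m e"
    and u: "u \<in> outside (union_image Q)" "u \<in> ball m e"
    using e(1) unfolding closure_approachable by (metis dist_commute mem_ball)
  have "winding_number \<gamma> z' = winding_number \<gamma> u"
    using winding_number_eq[OF \<gamma>(1,2) z'(2) u(2)] e(2) \<gamma>(3) by auto
  hence eq: "total_winding X z' - total_winding Q z' = total_winding X u - total_winding Q u"
    using wn\<gamma> z'(2) u(2) e(2) by (metis ComplD subsetD)
  have wQ: "total_winding Q z' = of_int (turn Q)" "total_winding Q u = 0" using WQ(1)[OF z'(1)] WQ(2)[OF u(1)] by auto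
  have "z' \<notin> union_image X" using z'(1) disj by blast
  hence 1: "total_winding X z' = of_int (turn X) \<or> total_winding X z' = 0" using WX(1,2,7) by blast
  have "u \<notin> union_image X" using u e(2) outside_no_overlap[of "union_image Q"] unfolding imX imQ K_def by blast
  hence 2: "total_winding X u = of_int (turn X) \<or> total_winding X u = 0" using WX(1,2,7) by blast
  note L = cycle_loop[OF S(1) ps(2) psS]
  \<comment> \<open>The disc is connected and misses \<open>X\<close>, so the value found near
    \<open>m\<close> also holds at \<open>z\<close>.\<close>
  have "winding_number (join_list (\<alpha> # ps)) z = winding_number (join_list (\<alpha> # ps)) z'"
    using winding_number_eq[OF simple_path_imp_path[OF L(1)] L(2) z z'(1) WQ(6)] L(3) ps(1) disj by auto
  moreover have "z \<notin> union_image (set (\<alpha> # ps))" "z' \<notin> union_image (set (\<alpha> # ps))"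
    using z z'(1) disj unfolding ps(1)[symmetric] by blast+
  ultimately have "total_winding X z = total_winding X z'" using L(4) unfolding ps(1) by simp
  moreover have "total_winding X z' = total_winding X u + of_int (turn Q)" using eq wQ by (simp add: algebra_simps)
  \<comment> \<open>Entering the disc adds \<open>turn Q\<close>, and both values lie in
    \<open>{0, turn X}\<close>. If the signs agree, the value in the disc is \<open>turn X\<close>;
    if they differ, it is \<open>0\<close>. In both cases it is half of
    \<open>turn X + turn Q\<close>.\<close>
  ultimately show ?thesis using 1 2 turn_cases[of X] turn_cases[of Q] by (elim disjE) simp_all
qed

section \<open>Switching from some sides of a disc to the reversed complementary sides\<close>

lemma inj_reversepath: "inj_on reversepath A"
  by (metis inj_onI reversepath_reversepath)

lemma union_image_reversepath: "union_image (reversepath ` X) = union_image X"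
  by (simp add: union_image_def)

text \<open>The hypothesis \<open>Q \<in> cycles Q\<close> says that \<open>Q\<close> is a single
  cycle. Reversal keeps its inside and negates the winding number there, hence the sign.\<close>

lemma cycle_system_reversepath:
  assumes "cycle_system Q" "Q \<in> cycles Q"
  shows "cycle_system (reversepath ` Q)" "reversepath ` Q \<in> cycles (reversepath ` Q)"
    "turn (reversepath ` Q) = - turn Q"
proof -
  note CS = cycle_systemD[OF assms(1)]
  show *: "cycle_system (reversepath ` Q)"
    unfolding cycle_system_def
  proof (intro conjI ballI impI)
    show "finite (reversepath ` Q)" using CS(1) by simp
    show "simple_path x" if "x \<in> reversepath ` Q" for x
      using that CS(2) simple_path_reversepath by auto
    show "inj_on pathstart (reversepath ` Q)" using CS(5) by (auto simp: inj_on_def)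
    show "inj_on pathfinish (reversepath ` Q)" using CS(4) by (auto simp: inj_on_def)
    show "pathstart ` reversepath ` Q = pathfinish ` reversepath ` Q"
      using assms(1) by (simp add: image_image cycle_system_def)
    fix x y assume "x \<in> reversepath ` Q" "y \<in> reversepath ` Q" "x \<noteq> y"
    then obtain x' y' where xy: "x' \<in> Q" "y' \<in> Q" "x = reversepath x'" "y = reversepath y'" "x' \<noteq> y'" by blast
    show "path_image x \<inter> path_image y \<subseteq> {pathstart x, pathfinish x} \<inter> {pathstart y, pathfinish y}"
      using CS(8)[OF xy(1,2,5)] by (auto simp: xy(3,4))
  qed
  obtain ps where ps: "Q = set ps" "closed_chain ps" using assms(2) by (auto simp: cycles_def)
  let ?r = "rev (map reversepath ps)"
  have ne: "ps \<noteq> []" and d: "distinct ps" using ps(2) by (auto simp: closed_chain_def)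
  have "closed_chain ?r"
  proof (rule closed_chainI)
    show "?r \<noteq> []" using ne by simp
    show "distinct ?r" using d inj_reversepath by (simp add: distinct_map)
    show "pathfinish (last ?r) = pathstart (hd ?r)"
      using closed_chain_last[OF ps(2)] ne by (simp add: last_rev hd_rev hd_map last_map)
    fix i assume i: "Suc i < length ?r"
    hence j: "Suc (length ps - Suc (Suc i)) = length ps - Suc i" "length ps - Suc i < length ps" by auto
    have "pathfinish (ps ! (length ps - Suc (Suc i))) = pathstart (ps ! (length ps - Suc i))"
      using closed_chain_Suc[OF ps(2), of "length ps - Suc (Suc i)"] j by simp
    thus "pathfinish (?r ! i) = pathstart (?r ! Suc i)" using i by (simp add: rev_nth)
  qed
  thus cyc: "reversepath ` Q \<in> cycles (reversepath ` Q)" unfolding cycles_def ps(1)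
    by (intro CollectI exI[of _ ?r]) simp
  obtain z where z: "z \<in> inside (union_image Q)" using cycle_winding(4)[OF assms] by blast
  have "winding_number (reversepath x) z = - winding_number x z" if "x \<in> Q" for x
  proof (rule winding_number_reversepath[OF CS(3)[OF that]])
    have "z \<notin> union_image Q" using z inside_no_overlap by blast
    thus "z \<notin> path_image x" using that by (auto simp: union_image_def)
  qed
  hence "total_winding (reversepath ` Q) z = - total_winding Q z"
    unfolding total_winding_def using inj_reversepath[of Q] by (simp add: sum.reindex sum_negf)
  hence "of_int (turn (reversepath ` Q)) = (of_int (- turn Q) :: complex)"
    using cycle_winding(1)[OF * cyc] cycle_winding(1)[OF assms] z union_image_reversepath by simp
  thus "turn (reversepath ` Q) = - turn Q" by (simp only: of_int_eq_iff)
qed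

text \<open>The two systems differ by one copy of the closed curve \<open>Q\<close>, so their
  winding numbers at a point of the disc differ by \<open>turn Q\<close>. Expand twice these numbers
  over cycles: a cycle meeting the switched sides gives its own \<open>turn\<close> plus
  \<open>turn Q\<close> on the \<open>A\<close> side, minus \<open>turn Q\<close> on the reversed
  side. Cycles within \<open>R\<close> belong to both systems and cancel.\<close>

lemma rotational_switch:
  assumes S: "cycle_system (R \<union> A)" and S': "cycle_system (R \<union> reversepath ` B)"
    and Q: "cycle_system Q" "Q \<in> cycles Q" and AB: "A \<union> B = Q" "A \<inter> B = {}"
    and RA: "R \<inter> A = {}" "R \<inter> reversepath ` B = {}"
    and noloop: "\<And>x. x \<in> Q \<Longrightarrow> pathfinish x \<noteq> pathstart x"
    and disj: "\<And>x. x \<in> R \<Longrightarrow> path_image x \<inter> inside (union_image Q) = {}"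
  shows "rotational (R \<union> A) - rotational (R \<union> reversepath ` B) =
    turn Q * (2 - int (card {X \<in> cycles (R \<union> A). X \<inter> A \<noteq> {}})
                - int (card {X \<in> cycles (R \<union> reversepath ` B). X \<inter> reversepath ` B \<noteq> {}}))"
proof -
  obtain z where z: "z \<in> inside (union_image Q)" using cycle_winding(4)[OF Q] by blast
  have avoid: "union_image X \<inter> inside (union_image Q) = {}" if "X \<subseteq> R \<union> Q \<union> reversepath ` Q" for X
    using that disj inside_no_overlap[of "union_image Q"] unfolding union_image_def by fastforce
  note Q' = cycle_system_reversepath[OF Q]
  \<comment> \<open>Used with \<open>T\<close> equal to \<open>Q\<close> for the sides
    \<open>A\<close>, and to the reversed \<open>Q\<close> for the reversed sides. The set
    \<open>R\<close> alone need not be a cycle system, but \<open>cycles R\<close> still consists of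
    the cycles that avoid \<open>C\<close>.\<close>
  have split: "2 * total_winding S z = of_int (rotational S - (\<Sum>X\<in>cycles R. turn X))
       + of_int (turn T) * of_nat (card {X \<in> cycles S. X \<inter> C \<noteq> {}}) + (\<Sum>X\<in>cycles R. 2 * total_winding X z)"
    if S: "cycle_system S" and T: "cycle_system T" "T \<in> cycles T" "union_image T = union_image Q"
      and C: "S = R \<union> C" "C \<subseteq> T" "R \<inter> C = {}" "C \<subseteq> Q \<union> reversepath ` Q"
      and nl: "\<And>x. x \<in> C \<Longrightarrow> pathfinish x \<noteq> pathstart x" for S T C
  proof -
    let ?M = "{X \<in> cycles S. X \<inter> C \<noteq> {}}"
    have fin: "finite (cycles S)" using finite_cycles cycle_systemD(1)[OF S] by blast
    have R: "cycles S - ?M = cycles R" using C(1,3) cycles_subset unfolding cycles_def by blast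
    have sum: "(\<Sum>X\<in>cycles S. f X) = (\<Sum>X\<in>?M. f X) + (\<Sum>X\<in>cycles R. f X)"
      for f :: "curve set \<Rightarrow> 'x::ab_group_add"
      using sum.subset_diff[of ?M "cycles S" f] fin unfolding R by (simp add: add.commute)
    have M: "2 * total_winding X z = of_int (turn X + turn T)" if X: "X \<in> ?M" for X
    proof -
      obtain \<alpha> where a: "\<alpha> \<in> X" "\<alpha> \<in> C" using X by blast
      have "X \<subseteq> R \<union> Q \<union> reversepath ` Q" using X cycles_subset[of X S] C by blast
      thus ?thesis using cycle_winding_beside[OF S _ T(1,2) a(1) _ nl[OF a(2)]] X a C(2) z avoid T(3) by auto
    qed
    have "2 * total_winding S z = (\<Sum>X\<in>cycles S. 2 * total_winding X z)"
      using total_winding_eq_sum_cycles[OF S] by (simp add: sum_distrib_left)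
    also have "\<dots> = (\<Sum>X\<in>?M. of_int (turn X) + of_int (turn T)) + (\<Sum>X\<in>cycles R. 2 * total_winding X z)"
      unfolding sum using M by simp
    also have "(\<Sum>X\<in>?M. of_int (turn X) + of_int (turn T)) =
       (of_int (\<Sum>X\<in>?M. turn X) + of_int (turn T) * of_nat (card ?M) :: complex)"
      by (simp add: sum.distrib)
    also have "(\<Sum>X\<in>?M. turn X) = rotational S - (\<Sum>X\<in>cycles R. turn X)"
      unfolding rotational_eq_sum_turn[OF S] sum by simp
    finally show ?thesis .
  qed
  have s1: "2 * total_winding (R \<union> A) z = of_int (rotational (R \<union> A) - (\<Sum>X\<in>cycles R. turn X))
       + of_int (turn Q) * of_nat (card {X \<in> cycles (R \<union> A). X \<inter> A \<noteq> {}}) + (\<Sum>X\<in>cycles R. 2 * total_winding X z)"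
    by (rule split[OF S Q refl refl _ RA(1)]) (use AB noloop in auto)
  have s2: "2 * total_winding (R \<union> reversepath ` B) z = of_int (rotational (R \<union> reversepath ` B) - (\<Sum>X\<in>cycles R. turn X))
       + of_int (- turn Q) * of_nat (card {X \<in> cycles (R \<union> reversepath ` B). X \<inter> reversepath ` B \<noteq> {}})
       + (\<Sum>X\<in>cycles R. 2 * total_winding X z)"
    unfolding Q'(3)[symmetric]
    by (rule split[OF S' Q'(1,2) union_image_reversepath refl _ RA(2)]) (use AB noloop in force)+
  have fin: "finite R" "finite A" "finite B"
    using cycle_systemD(1)[OF S] cycle_systemD(1)[OF Q(1)] AB by (auto intro: finite_subset)
  have "winding_number (reversepath x) z = - winding_number x z" if "x \<in> Q" for x
  proof (rule winding_number_reversepath)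
    show "path x" using cycle_systemD(3)[OF Q(1) that] .
    show "z \<notin> path_image x" using avoid[of "{x}"] that z unfolding union_image_def by fastforce
  qed
  hence "winding_number (reversepath x) z = - winding_number x z" if "x \<in> B" for x
    using that AB(1) by blast
  hence "total_winding (reversepath ` B) z = - total_winding B z"
    unfolding total_winding_def using inj_reversepath[of B] by (simp add: sum.reindex sum_negf)
  moreover have "total_winding (R \<union> A) z = total_winding R z + total_winding A z" "total_winding (R \<union> reversepath ` B) z = total_winding R z + total_winding (reversepath ` B) z"
    "total_winding Q z = total_winding A z + total_winding B z"
    unfolding total_winding_def AB(1)[symmetric] using fin RA AB(2) by (auto intro: sum.union_disjoint)
  ultimately have w: "2 * total_winding (R \<union> A) z - 2 * total_winding (R \<union> reversepath ` B) z = 2 * of_int (turn Q)"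
    using cycle_winding(1)[OF Q z] by simp
  have "of_int (rotational (R \<union> A) - rotational (R \<union> reversepath ` B)) =
    (of_int (turn Q * (2 - int (card {X \<in> cycles (R \<union> A). X \<inter> A \<noteq> {}})
                - int (card {X \<in> cycles (R \<union> reversepath ` B). X \<inter> reversepath ` B \<noteq> {}}))) :: complex)"
    using w unfolding s1 s2 by (simp add: algebra_simps)
  thus ?thesis by (simp only: of_int_eq_iff)
qed

section \<open>Counting the cycles that meet a square\<close>

lemma card_cycles_connected:
  assumes "cycle_system S" "A \<subseteq> S" "A \<noteq> {}"
    "\<And>x y X. x \<in> A \<Longrightarrow> y \<in> A \<Longrightarrow> X \<in> cycles S \<Longrightarrow> x \<in> X \<Longrightarrow> y \<in> X"
  shows "card {X \<in> cycles S. X \<inter> A \<noteq> {}} = 1"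
proof -
  obtain x where x: "x \<in> A" using assms(3) by blast
  then obtain X where X: "X \<in> cycles S" "x \<in> X" using cycle_through[OF assms(1)] assms(2) by blast
  have "{X \<in> cycles S. X \<inter> A \<noteq> {}} = {X}"
    using cycle_eqI[OF assms(1)] X x assms(4) by blast
  thus ?thesis by simp
qed

lemma card_cycles_two:
  assumes "cycle_system S" "x \<in> S" "y \<in> S" "X \<in> cycles S" "x \<in> X"
  shows "card {X \<in> cycles S. X \<inter> {x, y} \<noteq> {}} = (if y \<in> X then 1 else 2)"
proof -
  obtain Y where Y: "Y \<in> cycles S" "y \<in> Y" using cycle_through[OF assms(1,3)] by blast
  have *: "{X \<in> cycles S. X \<inter> {x, y} \<noteq> {}} = {X, Y}"
    using cycle_eqI[OF assms(1)] assms(4,5) Y by blast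
  have "y \<in> X \<longleftrightarrow> X = Y" using cycle_eqI[OF assms(1,4) Y(1)] Y(2) by blast
  thus ?thesis unfolding * by simp
qed

text \<open>Changing the smoothing of a crossing either merges two cycles or splits one.\<close>

lemma card_cycles_alternating:
  assumes S: "cycle_system (R \<union> {s0, s2})" and S': "cycle_system (R \<union> {r1, r3})"
    and disj: "R \<inter> {s0, s2} = {}" "R \<inter> {r1, r3} = {}" and ne: "s0 \<noteq> s2" "r1 \<noteq> r3"
    and ends: "pathfinish r1 = pathfinish s0" "pathstart r1 = pathstart s2"
      "pathstart r3 = pathstart s0" "pathfinish r3 = pathfinish s2"
  shows "card {X \<in> cycles (R \<union> {s0, s2}). X \<inter> {s0, s2} \<noteq> {}} +
    card {X \<in> cycles (R \<union> {r1, r3}). X \<inter> {r1, r3} \<noteq> {}} = 3"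
proof -
  let ?S = "R \<union> {s0, s2}" and ?S' = "R \<union> {r1, r3}"
  obtain ps where ps: "closed_chain (s0 # ps)" "set (s0 # ps) \<subseteq> ?S"
    using closed_chain_exists[OF S] by blast
  obtain Y where Y: "Y \<in> cycles ?S'" "r1 \<in> Y" using cycle_through[OF S', of r1] by blast
  have X: "set (s0 # ps) \<in> cycles ?S" using ps unfolding cycles_def by blast
  have "r3 \<in> Y \<longleftrightarrow> s2 \<notin> set (s0 # ps)"
  proof (cases "s2 \<in> set ps")
    case True
    \<comment> \<open>The stretch \<open>us\<close> between \<open>s0\<close> and \<open>s2\<close>
      leads from the end of \<open>r1\<close> to its start. So \<open>r1\<close> closes up with
      \<open>us\<close> alone, and its cycle misses \<open>r3\<close>.\<close>
    then obtain us vs where uv: "ps = us @ s2 # vs" "s2 \<notin> set us" by (meson split_list_first)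
    have ch: "pathfinish ((s0 # ps) ! i) = pathstart ((s0 # ps) ! Suc i)" if "Suc i < length (s0 # ps)" for i
      using closed_chain_Suc[OF ps(1) that] .
    have d: "distinct (s0 # ps)" using ps(1) by (simp add: closed_chain_def)
    have usR: "set us \<subseteq> R" using ps(2) d uv by auto
    have "closed_chain (r1 # us)"
    proof (rule closed_chainI)
      show "distinct (r1 # us)" using d uv usR disj(2) by auto
      show "pathfinish (last (r1 # us)) = pathstart (hd (r1 # us))"
      proof (cases us rule: rev_cases)
        case Nil
        thus ?thesis using ch[of 0] ends uv by simp
      next
        case (snoc ws w)
        have "pathfinish w = pathstart s2"
          using ch[of "length us"] uv(1) by (simp add: snoc nth_append nth_Cons')
        thus ?thesis using snoc ends by simp
      qed
      fix i assume i: "Suc i < length (r1 # us)"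
      thus "pathfinish ((r1 # us) ! i) = pathstart ((r1 # us) ! Suc i)"
        using ch[of i] uv(1) ends(1) by (cases i) (auto simp: nth_append nth_Cons')
    qed simp
    moreover have "set (r1 # us) \<subseteq> ?S'" using usR by auto
    ultimately have "set (r1 # us) \<in> cycles ?S'" unfolding cycles_def by blast
    hence "Y = set (r1 # us)" using cycle_eqI[OF S' Y(1)] Y(2) by simp
    hence "r3 \<notin> Y" using usR disj ne by auto
    thus ?thesis using True by simp
  next
    case False
    \<comment> \<open>Here \<open>ps\<close> leads from the end of \<open>r1\<close> to the start of
      \<open>r3\<close> inside \<open>R\<close>, so following it puts both into one cycle.\<close>
    have psR: "set ps \<subseteq> R" using ps False by (auto simp: closed_chain_def)
    have "pathstart r3 \<in> pathfinish ` Y"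
    proof -
      have "pathfinish ((s0 # ps) ! i) \<in> pathfinish ` Y" if "i < length (s0 # ps)" for i
        using that
      proof (induction i)
        case 0
        thus ?case using ends(1)[symmetric] Y(2) by simp
      next
        case (Suc i)
        hence "pathfinish ((s0 # ps) ! i) \<in> pathfinish ` Y" by simp
        then obtain y where y: "y \<in> Y" "pathfinish y = pathstart (ps ! i)"
          using closed_chain_Suc[OF ps(1) Suc.prems] by force
        have "ps ! i \<in> R" using Suc.prems psR by (auto intro: subsetD[OF psR nth_mem])
        hence "ps ! i \<in> ?S'" by blast
        thus ?case using cycle_closed[OF S' Y(1) y(1) _ y(2)[symmetric]] by simp
      qed
      from this[of "length ps"] have "pathfinish ((s0 # ps) ! length ps) \<in> pathfinish ` Y" by simp
      moreover have "(s0 # ps) ! length ps = last (s0 # ps)" by (simp add: last_conv_nth del: last.simps)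
      ultimately show ?thesis
        using closed_chain_last[OF ps(1)] ends(3) by simp
    qed
    then obtain y where y: "y \<in> Y" "pathstart r3 = pathfinish y" by blast
    have "r3 \<in> Y" using cycle_closed[OF S' Y(1) y(1) _ y(2)] by simp
    thus ?thesis using False ne by simp
  qed
  thus ?thesis
    using card_cycles_two[OF S _ _ X] card_cycles_two[OF S' _ _ Y(1,2)] by auto
qed

text \<open>The value of \<open>2 - n\<close>. Here \<open>n\<close> is 1 if the whole square is
  switched at once, 3 if \<open>A\<close> is a pair of opposite sides, and 2 if \<open>A\<close> and
  its complement are both nonempty runs of consecutive sides.\<close>

definition side_sign :: "curve list \<Rightarrow> curve set \<Rightarrow> int" where
  "side_sign qs A = (if A = {} \<or> A = set qs then 1
     else if A = {qs ! 0, qs ! 2} \<or> A = {qs ! 1, qs ! 3} then - 1 else 0)"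

text \<open>Consecutive sides that are in use lie on the same cycle, so a nonempty run of sides
  meets one cycle only. Opposite sides are the case of
  \<open>card_cycles_alternating\<close>.\<close>

lemma rotational_switch_square:
  assumes S: "cycle_system (R \<union> A)" and S': "cycle_system (R \<union> reversepath ` B)"
    and Q: "cycle_system (set qs)" and qs: "closed_chain qs" "length qs = 4"
    and AB: "A \<union> B = set qs" "A \<inter> B = {}"
    and RA: "R \<inter> A = {}" "R \<inter> reversepath ` B = {}"
    and disj: "\<And>x. x \<in> R \<Longrightarrow> path_image x \<inter> inside (union_image (set qs)) = {}"
  shows "rotational (R \<union> A) - rotational (R \<union> reversepath ` B) = turn (set qs) * side_sign qs A"
proof -
  obtain s0 s1 s2 s3 where l: "qs = [s0, s1, s2, s3]"
    using qs(2) by (auto simp: length_Suc_conv eval_nat_numeral)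
  have d: "s0 \<noteq> s1" "s0 \<noteq> s2" "s0 \<noteq> s3" "s1 \<noteq> s2" "s1 \<noteq> s3" "s2 \<noteq> s3"
    using qs(1) by (auto simp: closed_chain_def l)
  have e: "pathfinish s0 = pathstart s1" "pathfinish s1 = pathstart s2"
    "pathfinish s2 = pathstart s3" "pathfinish s3 = pathstart s0"
    using closed_chain_Suc[OF qs(1), of 0] closed_chain_Suc[OF qs(1), of 1] closed_chain_Suc[OF qs(1), of 2]
      closed_chain_last[OF qs(1)] by (auto simp: l)
  have Qc: "set qs \<in> cycles (set qs)" using qs(1) unfolding cycles_def by blast
  have noloop: "pathfinish x \<noteq> pathstart x" if "x \<in> set qs" for x
    using that d e cycle_systemD(4)[OF Q] unfolding l by (metis list.set_intros(1,2) set_ConsD empty_iff empty_set)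
  let ?n = "card {X \<in> cycles (R \<union> A). X \<inter> A \<noteq> {}}"
  let ?n' = "card {X \<in> cycles (R \<union> reversepath ` B). X \<inter> reversepath ` B \<noteq> {}}"
  have sub: "A \<subseteq> {s0, s1, s2, s3}" "B = {s0, s1, s2, s3} - A" using AB l by auto
  have step: "x \<in> X \<longleftrightarrow> y \<in> X"
    if "x \<in> A" "y \<in> A" "pathfinish x = pathstart y" "X \<in> cycles (R \<union> A)" for x y X
    using that cycle_closed[OF S that(4), of x y] cycle_closed_back[OF S that(4), of y x] by auto
  have step': "reversepath x \<in> X \<longleftrightarrow> reversepath y \<in> X"
    if "x \<in> B" "y \<in> B" "pathfinish x = pathstart y" "X \<in> cycles (R \<union> reversepath ` B)" for x y X
    using that cycle_closed[OF S' that(4), of "reversepath y" "reversepath x"]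
      cycle_closed_back[OF S' that(4), of "reversepath x" "reversepath y"] by auto
  have A_iff: "A = {} \<longleftrightarrow> s0 \<notin> A \<and> s1 \<notin> A \<and> s2 \<notin> A \<and> s3 \<notin> A"
    "A = set qs \<longleftrightarrow> s0 \<in> A \<and> s1 \<in> A \<and> s2 \<in> A \<and> s3 \<in> A"
    "A = {qs ! 0, qs ! 2} \<longleftrightarrow> s0 \<in> A \<and> s1 \<notin> A \<and> s2 \<in> A \<and> s3 \<notin> A"
    "A = {qs ! 1, qs ! 3} \<longleftrightarrow> s0 \<notin> A \<and> s1 \<in> A \<and> s2 \<notin> A \<and> s3 \<in> A"
    using sub(1) d by (auto simp: l)
  have nA: "?n = 1" if ne: "A \<noteq> {}" and nalt: "A \<noteq> {qs ! 0, qs ! 2}" "A \<noteq> {qs ! 1, qs ! 3}"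
  proof (rule card_cycles_connected[OF S _ ne])
    fix x y X assume xy: "x \<in> A" "y \<in> A" "X \<in> cycles (R \<union> A)" "x \<in> X"
    have "x \<in> {s0, s1, s2, s3}" "y \<in> {s0, s1, s2, s3}" using xy sub by auto
    thus "y \<in> X"
      using xy nalt[unfolded A_iff] step[OF _ _ e(1) xy(3)] step[OF _ _ e(2) xy(3)] step[OF _ _ e(3) xy(3)]
        step[OF _ _ e(4) xy(3)] by (elim insertE emptyE) metis+
  qed simp
  have nB: "?n' = 1" if ne: "A \<noteq> set qs" and nalt: "A \<noteq> {qs ! 0, qs ! 2}" "A \<noteq> {qs ! 1, qs ! 3}"
  proof (rule card_cycles_connected[OF S'])
    show "reversepath ` B \<noteq> {}" using ne sub by (auto simp: l)
    have Bm: "s0 \<in> B \<longleftrightarrow> s0 \<notin> A" "s1 \<in> B \<longleftrightarrow> s1 \<notin> A" "s2 \<in> B \<longleftrightarrow> s2 \<notin> A" "s3 \<in> B \<longleftrightarrow> s3 \<notin> A"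
      using sub by auto
    fix x' y' X assume xy': "x' \<in> reversepath ` B" "y' \<in> reversepath ` B"
      and X: "X \<in> cycles (R \<union> reversepath ` B)" "x' \<in> X"
    then obtain x y where xy: "x \<in> B" "y \<in> B" "x' = reversepath x" "y' = reversepath y" by blast
    have "x \<in> {s0, s1, s2, s3}" "y \<in> {s0, s1, s2, s3}" using xy sub by auto
    thus "y' \<in> X"
      using xy X(2) nalt[unfolded A_iff] Bm step'[OF _ _ e(1) X(1)] step'[OF _ _ e(2) X(1)] step'[OF _ _ e(3) X(1)]
        step'[OF _ _ e(4) X(1)] by (elim insertE emptyE) metis+
  qed simp
  have alt: "?n + ?n' = 3"
    if A: "A = {t0, t2}" "B = {t1, t3}" and ee: "pathfinish t0 = pathstart t1" "pathfinish t1 = pathstart t2"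
    "pathfinish t2 = pathstart t3" "pathfinish t3 = pathstart t0" and ne: "t0 \<noteq> t2" "t1 \<noteq> t3" for t0 t1 t2 t3
  proof -
    have B: "reversepath ` B = {reversepath t1, reversepath t3}" using A by simp
    have "reversepath t1 \<noteq> reversepath t3" using ne(2) by (metis reversepath_reversepath)
    from card_cycles_alternating[OF S[unfolded A] S'[unfolded B] RA(1)[unfolded A] RA(2)[unfolded B] ne(1) this]
    show ?thesis using ee unfolding B unfolding A by simp
  qed
  have alt1: "?n + ?n' = 3" if "A = {qs ! 0, qs ! 2}"
  proof -
    have "A = {s0, s2}" "B = {s1, s3}" using that sub d by (auto simp: l)
    thus ?thesis using alt e d(2,5) by blast
  qed
  have alt2: "?n + ?n' = 3" if "A = {qs ! 1, qs ! 3}"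
  proof -
    have "A = {s1, s3}" "B = {s2, s0}" using that sub d by (auto simp: l)
    thus ?thesis using alt e d(2)[symmetric] d(5) by blast
  qed
  have empt: "?n = 0" if "A = {}" using that by simp
  have full: "?n' = 0" if "A = set qs" using that sub by (simp add: l)
  have "2 - int ?n - int ?n' = side_sign qs A"
  proof -
    consider "A = {}" | "A = set qs" | "A = {qs ! 0, qs ! 2} \<or> A = {qs ! 1, qs ! 3}" |
      "A \<noteq> {}" "A \<noteq> set qs" "A \<noteq> {qs ! 0, qs ! 2}" "A \<noteq> {qs ! 1, qs ! 3}" by blast
    thus ?thesis
    proof cases
      case 1
      have "?n' = 1" by (rule nB) (use 1 in \<open>auto simp: l\<close>)
      thus ?thesis using 1 empt by (simp add: side_sign_def)
    next
      case 2
      have "?n = 1" by (rule nA) (use 2 d in \<open>auto simp: l\<close>)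
      thus ?thesis using full[OF 2] 2 by (simp add: side_sign_def)
    next
      case 3
      hence "?n + ?n' = 3" using alt1 alt2 by blast
      moreover have "A \<noteq> {}" "A \<noteq> set qs" using 3 d by (auto simp: l)
      ultimately show ?thesis using 3 by (auto simp: side_sign_def)
    next
      case 4
      thus ?thesis using nA nB by (simp add: side_sign_def)
    qed
  qed
  thus ?thesis using rotational_switch[OF S S' Q Qc AB RA noloop disj] by simp
qed

section \<open>Cycle systems from partial orientations of a plane graph\<close>

text \<open>A state is a partial orientation: \<open>None\<close> leaves an edge out,
  \<open>Some \<delta>\<close> traverses it in direction \<open>\<delta>\<close>. Both
  \<open>C_prime\<close> and \<open>C_star\<close> have this form, so one local criterion serves for
  both.\<close>

definition directed :: "curve set \<Rightarrow> (curve \<Rightarrow> bool option) \<Rightarrow> curve set" where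
  "directed E st = {orient \<delta> e | \<delta> e. e \<in> E \<and> st e = Some \<delta>}"

lemma orient_simps [simp]:
  "orient True e = e" "orient False e = reversepath e"
  "path_image (orient \<delta> e) = path_image e" "simple_path (orient \<delta> e) \<longleftrightarrow> simple_path e"
  "pathfinish (orient (\<not> \<delta>) e) = pathstart (orient \<delta> e)"
  "pathstart (orient (\<not> \<delta>) e) = pathfinish (orient \<delta> e)"
  using simple_path_reversepath[of e] simple_path_reversepath[of "reversepath e"]
  by (auto simp: orient_def)

lemma plane_graphD:
  assumes "plane_graph V E"
  shows "finite V" "finite E" "e \<in> E \<Longrightarrow> simple_path e"
    "e \<in> E \<Longrightarrow> pathstart (orient \<delta> e) \<in> V \<longleftrightarrow> pathfinish (orient \<delta> e) \<in> V"
    "e \<in> E \<Longrightarrow> pathstart (orient \<delta> e) \<notin> V \<Longrightarrow> pathfinish (orient \<delta> e) = pathstart (orient \<delta> e)"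
    "e \<in> E \<Longrightarrow> t \<in> {0<..<1} \<Longrightarrow> e t \<notin> V"
    "e \<in> E \<Longrightarrow> f \<in> E \<Longrightarrow> e \<noteq> f \<Longrightarrow> path_image e \<inter> path_image f \<subseteq> V"
    "e \<in> E \<Longrightarrow> z \<in> path_image e \<Longrightarrow> z \<in> V \<Longrightarrow> z \<in> {pathstart e, pathfinish e}"
proof -
  show "finite V" "finite E" "e \<in> E \<Longrightarrow> simple_path e"
    "e \<in> E \<Longrightarrow> pathstart (orient \<delta> e) \<in> V \<longleftrightarrow> pathfinish (orient \<delta> e) \<in> V"
    "e \<in> E \<Longrightarrow> pathstart (orient \<delta> e) \<notin> V \<Longrightarrow> pathfinish (orient \<delta> e) = pathstart (orient \<delta> e)"
    "e \<in> E \<Longrightarrow> f \<in> E \<Longrightarrow> e \<noteq> f \<Longrightarrow> path_image e \<inter> path_image f \<subseteq> V"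
    using assms unfolding plane_graph_def orient_def by (auto split: if_splits)
  have int: "e t \<notin> V" if "e \<in> E" "t \<in> {0<..<1}" for e t
    using assms that unfolding plane_graph_def by blast
  thus "e \<in> E \<Longrightarrow> t \<in> {0<..<1} \<Longrightarrow> e t \<notin> V" .
  show "z \<in> {pathstart e, pathfinish e}" if "e \<in> E" "z \<in> path_image e" "z \<in> V"
  proof -
    obtain t where t: "z = e t" "0 \<le> t" "t \<le> 1" using \<open>z \<in> path_image e\<close> by (auto simp: path_image_def)
    with int[OF that(1), of t] that(3) have "t = 0 \<or> t = 1" by force
    thus ?thesis using t(1) by (auto simp: pathstart_def pathfinish_def)
  qed
qed

text \<open>The point \<open>e (1/2)\<close> is no vertex, so it lies on one edge only. A curve
  equal to its own reverse would take the same value at \<open>1/4\<close> and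
  \<open>3/4\<close>.\<close>

lemma orient_inject:
  assumes G: "plane_graph V E" and e: "e \<in> E" "f \<in> E" and eq: "orient \<delta> e = orient \<epsilon> f"
  shows "e = f \<and> \<delta> = \<epsilon>"
proof -
  have "path_image e = path_image f" using eq orient_simps(3) by metis
  moreover have "e (1/2) \<in> path_image e" by (auto simp: path_image_def)
  ultimately have ef: "e = f" using plane_graphD(6)[OF G e(1), of "1/2"] plane_graphD(7)[OF G e] by auto
  have "\<delta> = \<epsilon>"
  proof (rule ccontr)
    assume "\<delta> \<noteq> \<epsilon>"
    hence "e = reversepath e" using eq ef by (auto simp: orient_def split: if_splits)
    from fun_cong[OF this, of "1/4"] have "e (1/4) = e (3/4)" by (simp add: reversepath_def)
    moreover have "loop_free e" using plane_graphD(3)[OF G e(1)] by (simp add: simple_path_def)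
    ultimately have "(1/4 :: real) = 3/4 \<or> (1/4 :: real) = 0 \<and> (3/4 :: real) = 1 \<or> (1/4 :: real) = 1 \<and> (3/4 :: real) = 0"
      unfolding loop_free_def by (elim ballE[of _ _ "1/4"] ballE[of _ _ "3/4"]) simp_all
    thus False by simp
  qed
  with ef show ?thesis by simp
qed

text \<open>A half-edge \<open>(e, \<delta>)\<close> points into \<open>p\<close>, so
  \<open>st e = Some \<delta>\<close> means use towards \<open>p\<close> and
  \<open>Some (\<not> \<delta>)\<close> use away from \<open>p\<close>. Vertexless circles close up
  by themselves, which is why only the vertices need conditions.\<close>

lemma cycle_system_directed:
  assumes G: "plane_graph V E"
    and ins: "\<And>p h k. p \<in> V \<Longrightarrow> h \<in> half_edges E p \<Longrightarrow> k \<in> half_edges E p \<Longrightarrow>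
      st (fst h) = Some (snd h) \<Longrightarrow> st (fst k) = Some (snd k) \<Longrightarrow> h = k"
    and outs: "\<And>p h k. p \<in> V \<Longrightarrow> h \<in> half_edges E p \<Longrightarrow> k \<in> half_edges E p \<Longrightarrow>
      st (fst h) = Some (\<not> snd h) \<Longrightarrow> st (fst k) = Some (\<not> snd k) \<Longrightarrow> h = k"
    and bal: "\<And>p. p \<in> V \<Longrightarrow> (\<exists>h\<in>half_edges E p. st (fst h) = Some (snd h)) \<longleftrightarrow>
      (\<exists>h\<in>half_edges E p. st (fst h) = Some (\<not> snd h))"
  shows "cycle_system (directed E st)"
proof -
  note PG = plane_graphD[OF G]
  have mem: "orient \<delta> e \<in> directed E st" if "e \<in> E" "st e = Some \<delta>" for e \<delta>
    using that by (auto simp: directed_def)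
  have out: "(e, \<not> \<delta>) \<in> half_edges E p \<longleftrightarrow> e \<in> E \<and> pathstart (orient \<delta> e) = p" for e \<delta> p
    by (simp add: half_edges_def)
  have circ: "e = f" if "e \<in> E" "f \<in> E" "p \<notin> V" "p \<in> path_image e" "p \<in> path_image f" for e f p
    using PG(7)[OF that(1,2)] that by blast
  have ends: "pathstart (orient \<delta> e) \<in> path_image e" "pathfinish (orient \<delta> e) \<in> path_image e" for \<delta> e
    using pathstart_in_path_image pathfinish_in_path_image orient_simps(3) by metis+
  show ?thesis unfolding cycle_system_def
  proof (intro conjI ballI impI)
    have "directed E st \<subseteq> (\<lambda>(\<delta>, e). orient \<delta> e) ` (UNIV \<times> E)" by (auto simp: directed_def)
    thus "finite (directed E st)" using PG(2) finite_subset by fastforce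
    show "simple_path x" if "x \<in> directed E st" for x using that PG(3) by (auto simp: directed_def)
    show "inj_on pathstart (directed E st)"
    proof (rule inj_onI)
      fix x y assume "x \<in> directed E st" "y \<in> directed E st" and eq: "pathstart x = pathstart y"
      then obtain \<delta> e \<epsilon> f where xy: "x = orient \<delta> e" "e \<in> E" "st e = Some \<delta>" "y = orient \<epsilon> f" "f \<in> E" "st f = Some \<epsilon>"
        by (auto simp: directed_def)
      have "e = f"
      proof (cases "pathstart x \<in> V")
        case True
        have "(e, \<not> \<delta>) \<in> half_edges E (pathstart x)" "(f, \<not> \<epsilon>) \<in> half_edges E (pathstart x)"
          using xy eq by (simp_all only: out)
        from outs[OF True this] show ?thesis using xy by simp
      next
        case False
        thus ?thesis using circ[OF xy(2,5), of "pathstart x"] ends xy eq by metis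
      qed
      thus "x = y" using xy by simp
    qed
    show "inj_on pathfinish (directed E st)"
    proof (rule inj_onI)
      fix x y assume "x \<in> directed E st" "y \<in> directed E st" and eq: "pathfinish x = pathfinish y"
      then obtain \<delta> e \<epsilon> f where xy: "x = orient \<delta> e" "e \<in> E" "st e = Some \<delta>" "y = orient \<epsilon> f" "f \<in> E" "st f = Some \<epsilon>"
        by (auto simp: directed_def)
      have "e = f"
      proof (cases "pathfinish x \<in> V")
        case True
        have "(e, \<delta>) \<in> half_edges E (pathfinish x)" "(f, \<epsilon>) \<in> half_edges E (pathfinish x)"
          using xy eq by (simp_all add: half_edges_def)
        from ins[OF True this] show ?thesis using xy by simp
      next
        case False
        thus ?thesis using circ[OF xy(2,5), of "pathfinish x"] ends xy eq by metis
      qed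
      thus "x = y" using xy by simp
    qed
    show "pathstart ` directed E st = pathfinish ` directed E st"
    proof (intro set_eqI iffI)
      fix p assume "p \<in> pathstart ` directed E st"
      then obtain \<delta> e where e: "e \<in> E" "st e = Some \<delta>" "p = pathstart (orient \<delta> e)" by (auto simp: directed_def)
      show "p \<in> pathfinish ` directed E st"
      proof (cases "p \<in> V")
        case True
        have "(e, \<not> \<delta>) \<in> half_edges E p" using e by (simp only: out)
        hence "\<exists>h\<in>half_edges E p. st (fst h) = Some (\<not> snd h)" using e(2) by force
        then obtain h where "h \<in> half_edges E p" "st (fst h) = Some (snd h)" using bal[OF True] by blast
        thus ?thesis using mem[of "fst h" "snd h"] by (force simp: half_edges_def)
      next
        case False
        thus ?thesis using PG(5)[OF e(1), of \<delta>] e mem[OF e(1,2)] by (metis imageI)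
      qed
    next
      fix p assume "p \<in> pathfinish ` directed E st"
      then obtain \<delta> e where e: "e \<in> E" "st e = Some \<delta>" "p = pathfinish (orient \<delta> e)" by (auto simp: directed_def)
      show "p \<in> pathstart ` directed E st"
      proof (cases "p \<in> V")
        case True
        have "(e, \<delta>) \<in> half_edges E p" using e by (simp add: half_edges_def)
        hence "\<exists>h\<in>half_edges E p. st (fst h) = Some (snd h)" using e(2) by force
        then obtain h where h: "h \<in> half_edges E p" "st (fst h) = Some (\<not> snd h)" using bal[OF True] by blast
        have "(fst h, \<not> (\<not> snd h)) \<in> half_edges E p" using h(1) by simp
        hence "fst h \<in> E" "pathstart (orient (\<not> snd h) (fst h)) = p" by (simp_all only: out)
        thus ?thesis using mem[OF _ h(2)] by (metis imageI)
      next
        case False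
        hence "pathstart (orient \<delta> e) \<notin> V" using PG(4)[OF e(1)] e(3) by blast
        thus ?thesis using PG(5)[OF e(1), of \<delta>] e mem[OF e(1,2)] by (metis imageI)
      qed
    qed
    fix x y assume "x \<in> directed E st" "y \<in> directed E st" and ne: "x \<noteq> y"
    then obtain \<delta> e \<epsilon> f where xy: "x = orient \<delta> e" "e \<in> E" "st e = Some \<delta>" "y = orient \<epsilon> f" "f \<in> E" "st f = Some \<epsilon>"
      by (auto simp: directed_def)
    have "e \<noteq> f" using xy ne by auto
    show "path_image x \<inter> path_image y \<subseteq> {pathstart x, pathfinish x} \<inter> {pathstart y, pathfinish y}"
    proof
      fix z assume z: "z \<in> path_image x \<inter> path_image y"
      hence "z \<in> V" using PG(7)[OF xy(2,5) \<open>e \<noteq> f\<close>] xy by auto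
      hence "z \<in> {pathstart e, pathfinish e}" "z \<in> {pathstart f, pathfinish f}"
        using PG(8)[OF xy(2)] PG(8)[OF xy(5)] z xy by auto
      moreover have "{pathstart x, pathfinish x} = {pathstart e, pathfinish e}"
        "{pathstart y, pathfinish y} = {pathstart f, pathfinish f}"
        unfolding xy by (auto simp: orient_def)
      ultimately show "z \<in> {pathstart x, pathfinish x} \<inter> {pathstart y, pathfinish y}" by simp
    qed
  qed
qed

text \<open>Brings the switch into the form in which changes of colors produce it, as two states of
  the same edges. That the unchanged part \<open>R\<close> contains no side in either direction
  follows from \<open>orient_inject\<close>.\<close>

lemma rotational_toggle:
  assumes G: "plane_graph V E" and qs: "closed_chain qs" "length qs = 4" "set qs \<subseteq> E" "cycle_system (set qs)"
    and S: "cycle_system (directed E st)" "cycle_system (directed E st')"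
    and agree: "\<And>e. e \<in> E \<Longrightarrow> e \<notin> set qs \<Longrightarrow> st e = st' e"
    and A: "A \<subseteq> set qs" "\<And>s. s \<in> A \<Longrightarrow> st s = Some True \<and> st' s = None"
      "\<And>s. s \<in> set qs \<Longrightarrow> s \<notin> A \<Longrightarrow> st s = None \<and> st' s = Some False"
    and disj: "\<And>e. e \<in> E \<Longrightarrow> path_image e \<inter> inside (union_image (set qs)) = {}"
  shows "rotational (directed E st) - rotational (directed E st') = turn (set qs) * side_sign qs A"
proof -
  define R where "R = directed (E - set qs) st"
  have 1: "directed E st = R \<union> A"
  proof (intro set_eqI iffI)
    fix x assume "x \<in> directed E st"
    then obtain \<delta> e where "e \<in> E" "st e = Some \<delta>" "x = orient \<delta> e" by (auto simp: directed_def)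
    thus "x \<in> R \<union> A" using A(2,3)[of e] unfolding R_def directed_def by fastforce
  next
    fix x assume "x \<in> R \<union> A"
    thus "x \<in> directed E st" using A(1,2) qs(3) unfolding R_def directed_def by force
  qed
  have 2: "directed E st' = R \<union> reversepath ` (set qs - A)"
  proof (intro set_eqI iffI)
    fix x assume "x \<in> directed E st'"
    then obtain \<delta> e where "e \<in> E" "st' e = Some \<delta>" "x = orient \<delta> e" by (auto simp: directed_def)
    thus "x \<in> R \<union> reversepath ` (set qs - A)"
      using A(2,3)[of e] agree[of e] unfolding R_def directed_def by fastforce
  next
    fix x assume "x \<in> R \<union> reversepath ` (set qs - A)"
    thus "x \<in> directed E st'"
    proof
      assume "x \<in> R"
      thus ?thesis using agree unfolding R_def directed_def by force
    next
      assume "x \<in> reversepath ` (set qs - A)"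
      then obtain s where s: "s \<in> set qs" "s \<notin> A" "x = orient False s" by auto
      thus ?thesis using A(3)[OF s(1,2)] qs(3) unfolding directed_def by blast
    qed
  qed
  have Rne: "orient \<epsilon> s \<notin> R" if s: "s \<in> set qs" for s \<epsilon>
  proof
    assume "orient \<epsilon> s \<in> R"
    then obtain \<delta> e where "e \<in> E" "e \<notin> set qs" "orient \<epsilon> s = orient \<delta> e" by (auto simp: R_def directed_def)
    thus False using orient_inject[OF G, of s e] s qs(3) by blast
  qed
  have "R \<inter> A = {}" using Rne[of _ True] A(1) by auto
  moreover have "R \<inter> reversepath ` (set qs - A) = {}" using Rne[of _ False] by auto
  ultimately show ?thesis unfolding 1 2
    using S A(1) unfolding 1 2
    by (intro rotational_switch_square[OF _ _ qs(4,1,2)]) (auto simp: R_def directed_def disjoint_iff dest!: disj)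
qed

text \<open>Needed because, once \<open>b\<close> is added, \<open>C_prime\<close> for the pair
  \<open>a\<close>, \<open>b\<close> runs forwards along the sides without \<open>a\<close>, but
  \<open>C_star\<close> along those with \<open>a\<close>.\<close>

lemma side_sign_complement:
  assumes "A \<subseteq> set qs" "distinct qs" "length qs = 4"
  shows "side_sign qs (set qs - A) = side_sign qs A"
proof -
  obtain s0 s1 s2 s3 where l: "qs = [s0, s1, s2, s3]"
    using assms(3) by (auto simp: length_Suc_conv eval_nat_numeral)
  have "set qs - A = {} \<longleftrightarrow> A = set qs" "set qs - A = set qs \<longleftrightarrow> A = {}" using assms(1) by auto
  moreover have "set qs - A = {qs ! 0, qs ! 2} \<longleftrightarrow> A = {qs ! 1, qs ! 3}"
    "set qs - A = {qs ! 1, qs ! 3} \<longleftrightarrow> A = {qs ! 0, qs ! 2}"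
  proof -
    have *: "set qs - A = X \<longleftrightarrow> A = set qs - X" if "X \<subseteq> set qs" for X using that assms(1) by blast
    have d: "set qs - {s0, s2} = {s1, s3}" "set qs - {s1, s3} = {s0, s2}" using assms(2) by (auto simp: l)
    have n: "qs ! 0 = s0" "qs ! 1 = s1" "qs ! 2 = s2" "qs ! 3 = s3" by (simp_all add: l)
    have "{s0, s2} \<subseteq> set qs" "{s1, s3} \<subseteq> set qs" by (auto simp: l)
    from this[THEN *] show "set qs - A = {qs ! 0, qs ! 2} \<longleftrightarrow> A = {qs ! 1, qs ! 3}"
      "set qs - A = {qs ! 1, qs ! 3} \<longleftrightarrow> A = {qs ! 0, qs ! 2}" unfolding n d by blast+
  qed
  ultimately show ?thesis by (auto simp: side_sign_def)
qed

section \<open>The vertices of a web\<close>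

text \<open>The local rule of a coloring without parity, the bound \<open>N\<close> and
  extensionality. It survives the addition of a single color to a square, and it alone makes
  \<open>C_prime\<close> and \<open>C_star\<close> unions of cycles.\<close>

definition flow_coloring :: "web \<Rightarrow> (curve \<Rightarrow> bool) \<Rightarrow> (curve \<Rightarrow> nat set) \<Rightarrow> bool" where
  "flow_coloring W d c \<longleftrightarrow> (\<forall>e\<in>vect W. \<exists>a. c e = {a}) \<and>
     (\<forall>v\<in>verts W. \<forall>e\<in>vect W. \<forall>f\<in>spin W. \<forall>g\<in>spin W. \<forall>a.
        c e = {a} \<longrightarrow> pathfinish f = v \<longrightarrow> pathstart g = v \<longrightarrow>
        (pathfinish (orient (d e) e) = v \<longrightarrow> a \<notin> c f \<and> c g = c f \<union> {a}) \<and>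
        (pathstart (orient (d e) e) = v \<longrightarrow> a \<notin> c g \<and> c f = c g \<union> {a}))"

lemma web_vertex:
  assumes "web W" "p \<in> verts W"
  obtains e f g \<delta> where "e \<in> vect W" "f \<in> spin W" "g \<in> spin W" "e \<notin> spin W"
    "pathfinish (orient \<delta> e) = p" "pathfinish f = p" "pathstart g = p"
    "half_edges (vect W \<union> spin W) p = {(e, \<delta>), (f, True), (g, False)}"
    "\<forall>x\<in>spin W. pathfinish x = p \<longrightarrow> x = f" "\<forall>x\<in>spin W. pathstart x = p \<longrightarrow> x = g"
    "\<forall>x\<in>vect W. \<forall>\<epsilon>. pathfinish (orient \<epsilon> x) = p \<longrightarrow> x = e \<and> \<epsilon> = \<delta>"
proof -
  have V: "\<exists>!h. h \<in> half_edges (vect W) p" "\<exists>!e. e \<in> spin W \<and> pathfinish e = p"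
    "\<exists>!e. e \<in> spin W \<and> pathstart e = p" and dis: "vect W \<inter> spin W = {}"
    using assms unfolding web_def by blast+
  obtain e \<delta> where e: "(e, \<delta>) \<in> half_edges (vect W) p" "\<And>x \<epsilon>. (x, \<epsilon>) \<in> half_edges (vect W) p \<Longrightarrow> x = e \<and> \<epsilon> = \<delta>"
    using V(1) by (metis prod.inject surj_pair)
  obtain f where f: "f \<in> spin W" "pathfinish f = p" "\<And>x. x \<in> spin W \<Longrightarrow> pathfinish x = p \<Longrightarrow> x = f"
    using V(2) by blast
  obtain g where g: "g \<in> spin W" "pathstart g = p" "\<And>x. x \<in> spin W \<Longrightarrow> pathstart x = p \<Longrightarrow> x = g"
    using V(3) by blast
  have H: "half_edges (vect W \<union> spin W) p = {(e, \<delta>), (f, True), (g, False)}"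
  proof (intro set_eqI iffI)
    fix h assume h: "h \<in> half_edges (vect W \<union> spin W) p"
    obtain x \<epsilon> where x: "h = (x, \<epsilon>)" by (cases h)
    show "h \<in> {(e, \<delta>), (f, True), (g, False)}"
    proof (cases "x \<in> vect W")
      case True
      thus ?thesis using h e(2)[of x \<epsilon>] unfolding x half_edges_def by simp
    next
      case False
      thus ?thesis using h f(3)[of x] g(3)[of x] unfolding x half_edges_def by (cases \<epsilon>) auto
    qed
  next
    fix h assume "h \<in> {(e, \<delta>), (f, True), (g, False)}"
    thus "h \<in> half_edges (vect W \<union> spin W) p" using e(1) f(1,2) g(1,2)
      by (elim insertE) (simp_all add: half_edges_def)
  qed
  have ev: "e \<in> vect W" "pathfinish (orient \<delta> e) = p" using e(1) by (auto simp: half_edges_def)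
  have ev': "\<forall>x\<in>vect W. \<forall>\<epsilon>. pathfinish (orient \<epsilon> x) = p \<longrightarrow> x = e \<and> \<epsilon> = \<delta>"
    using e(2) by (simp add: half_edges_def)
  have "e \<notin> spin W" using ev(1) dis by blast
  from that[OF ev(1) f(1) g(1) this ev(2) f(2) g(2) H _ _ ev'] f(3) g(3) show ?thesis by blast
qed

definition state_prime :: "web \<Rightarrow> (curve \<Rightarrow> bool) \<Rightarrow> (curve \<Rightarrow> nat set) \<Rightarrow> nat \<Rightarrow> nat \<Rightarrow> curve \<Rightarrow> bool option" where
  "state_prime W d c a b e =
    (if e \<in> vect W then if c e = {b} then Some (d e) else if c e = {a} then Some (\<not> d e) else None
     else if b \<in> c e \<and> a \<notin> c e then Some True else if a \<in> c e \<and> b \<notin> c e then Some False else None)"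

definition state_star :: "web \<Rightarrow> (curve \<Rightarrow> bool) \<Rightarrow> (curve \<Rightarrow> nat set) \<Rightarrow> nat \<Rightarrow> nat \<Rightarrow> curve \<Rightarrow> bool option" where
  "state_star W d c a b e =
    (if e \<in> vect W then if c e = {a} \<or> c e = {b} then Some (d e) else None
     else if a \<in> c e \<and> b \<in> c e then Some True else if a \<notin> c e \<and> b \<notin> c e then Some False else None)"

lemma directedI: "e \<in> E \<Longrightarrow> st e = Some \<delta> \<Longrightarrow> orient \<delta> e \<in> directed E st"
  by (auto simp: directed_def)

lemma directedE:
  assumes "x \<in> directed E st"
  obtains \<delta> e where "e \<in> E" "st e = Some \<delta>" "x = orient \<delta> e"
  using assms by (auto simp: directed_def)

lemma C_prime_eq_directed:
  assumes "vect W \<inter> spin W = {}" "a \<noteq> b"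
  shows "C_prime W d c a b = directed (vect W \<union> spin W) (state_prime W d c a b)"
    (is "_ = directed ?E ?st")
proof (intro set_eqI iffI)
  fix x assume "x \<in> C_prime W d c a b"
  then consider e where "x = orient (d e) e" "e \<in> vect W" "c e = {b}"
    | e where "x = orient (\<not> d e) e" "e \<in> vect W" "c e = {a}"
    | "x \<in> spin W" "b \<in> c x" "a \<notin> c x" | e where "x = reversepath e" "e \<in> spin W" "a \<in> c e" "b \<notin> c e"
    unfolding C_prime_def by blast
  thus "x \<in> directed ?E ?st"
  proof cases
    case (1 e)
    hence "?st e = Some (d e)" by (simp add: state_prime_def)
    thus ?thesis using directedI[of e ?E ?st] 1 by simp
  next
    case (2 e)
    hence "?st e = Some (\<not> d e)" using assms(2) by (simp add: state_prime_def)
    thus ?thesis using directedI[of e ?E ?st] 2 by simp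
  next
    case 3
    hence "x \<notin> vect W" using assms(1) by blast
    hence "?st x = Some True" using 3 by (simp add: state_prime_def)
    thus ?thesis using directedI[of x ?E ?st True] 3 by simp
  next
    case (4 e)
    hence "e \<notin> vect W" using assms(1) by blast
    hence "?st e = Some False" using 4 by (simp add: state_prime_def)
    thus ?thesis using directedI[of e ?E ?st False] 4 by simp
  qed
next
  fix x assume "x \<in> directed ?E ?st"
  then obtain \<delta> e where e: "e \<in> ?E" "?st e = Some \<delta>" "x = orient \<delta> e" by (rule directedE)
  show "x \<in> C_prime W d c a b"
  proof (cases "e \<in> vect W")
    case True
    hence "c e = {b} \<and> \<delta> = d e \<or> c e = {a} \<and> \<delta> = (\<not> d e)"
      using e(2) by (simp add: state_prime_def split: if_splits)
    thus ?thesis unfolding C_prime_def e(3) using True by blast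
  next
    case False
    hence "b \<in> c e \<and> a \<notin> c e \<and> \<delta> \<or> a \<in> c e \<and> b \<notin> c e \<and> \<not> \<delta>" "e \<in> spin W"
      using e(1,2) by (auto simp: state_prime_def split: if_splits)
    thus ?thesis unfolding C_prime_def e(3) orient_def by auto
  qed
qed

lemma C_star_eq_directed:
  assumes "vect W \<inter> spin W = {}"
  shows "C_star W d c a b = directed (vect W \<union> spin W) (state_star W d c a b)"
    (is "_ = directed ?E ?st")
proof (intro set_eqI iffI)
  fix x assume "x \<in> C_star W d c a b"
  then consider e where "x = orient (d e) e" "e \<in> vect W" "c e = {a} \<or> c e = {b}"
    | "x \<in> spin W" "a \<in> c x" "b \<in> c x" | e where "x = reversepath e" "e \<in> spin W" "a \<notin> c e" "b \<notin> c e"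
    unfolding C_star_def by blast
  thus "x \<in> directed ?E ?st"
  proof cases
    case (1 e)
    hence "?st e = Some (d e)" by (simp add: state_star_def)
    thus ?thesis using directedI[of e ?E ?st] 1 by simp
  next
    case 2
    hence "x \<notin> vect W" using assms(1) by blast
    hence "?st x = Some True" using 2 by (simp add: state_star_def)
    thus ?thesis using directedI[of x ?E ?st True] 2 by simp
  next
    case (3 e)
    hence "e \<notin> vect W" using assms(1) by blast
    hence "?st e = Some False" using 3 by (simp add: state_star_def)
    thus ?thesis using directedI[of e ?E ?st False] 3 by simp
  qed
next
  fix x assume "x \<in> directed ?E ?st"
  then obtain \<delta> e where e: "e \<in> ?E" "?st e = Some \<delta>" "x = orient \<delta> e" by (rule directedE)
  show "x \<in> C_star W d c a b"
  proof (cases "e \<in> vect W")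
    case True
    hence "(c e = {a} \<or> c e = {b}) \<and> \<delta> = d e"
      using e(2) by (simp add: state_star_def split: if_splits)
    thus ?thesis unfolding C_star_def e(3) using True by blast
  next
    case False
    hence "a \<in> c e \<and> b \<in> c e \<and> \<delta> \<or> a \<notin> c e \<and> b \<notin> c e \<and> \<not> \<delta>" "e \<in> spin W"
      using e(1,2) by (auto simp: state_star_def split: if_splits)
    thus ?thesis unfolding C_star_def e(3) orient_def by auto
  qed
qed

lemma web_plane_graph: "web W \<Longrightarrow> plane_graph (verts W) (vect W \<union> spin W)"
  and web_vect_spin: "web W \<Longrightarrow> vect W \<inter> spin W = {}"
  by (auto simp: web_def)

lemma flow_coloring_vertex:
  assumes W: "web W" and F: "flow_coloring W d c" and p: "p \<in> verts W"
  obtains e f g \<delta> x where "e \<in> vect W" "f \<in> spin W" "g \<in> spin W" "e \<notin> spin W" "f \<notin> vect W" "g \<notin> vect W"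
    "half_edges (vect W \<union> spin W) p = {(e, \<delta>), (f, True), (g, False)}"
    "c e = {x}" "d e = \<delta> \<and> x \<notin> c f \<and> c g = insert x (c f) \<or> d e = (\<not> \<delta>) \<and> x \<notin> c g \<and> c f = insert x (c g)"
proof -
  obtain e f g \<delta> where v: "e \<in> vect W" "f \<in> spin W" "g \<in> spin W" "e \<notin> spin W"
    "pathfinish (orient \<delta> e) = p" "pathfinish f = p" "pathstart g = p"
    "half_edges (vect W \<union> spin W) p = {(e, \<delta>), (f, True), (g, False)}"
    "\<forall>x\<in>spin W. pathfinish x = p \<longrightarrow> x = f" "\<forall>x\<in>spin W. pathstart x = p \<longrightarrow> x = g"
    "\<forall>x\<in>vect W. \<forall>\<epsilon>. pathfinish (orient \<epsilon> x) = p \<longrightarrow> x = e \<and> \<epsilon> = \<delta>"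
    by (rule web_vertex[OF W p])
  obtain x where x: "c e = {x}" using F v(1) unfolding flow_coloring_def by blast
  have "(pathfinish (orient (d e) e) = p \<longrightarrow> x \<notin> c f \<and> c g = c f \<union> {x}) \<and>
        (pathstart (orient (d e) e) = p \<longrightarrow> x \<notin> c g \<and> c f = c g \<union> {x})"
    using F p v(1-3,6,7) x unfolding flow_coloring_def by blast
  moreover have "d e = \<delta> \<or> d e = (\<not> \<delta>)" by auto
  moreover have "d e = \<delta> \<Longrightarrow> pathfinish (orient (d e) e) = p" "d e = (\<not> \<delta>) \<Longrightarrow> pathstart (orient (d e) e) = p"
    using v(5) by auto
  ultimately have "d e = \<delta> \<and> x \<notin> c f \<and> c g = insert x (c f) \<or> d e = (\<not> \<delta>) \<and> x \<notin> c g \<and> c f = insert x (c g)"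
    by auto
  thus ?thesis using that[OF v(1-4) _ _ v(8) x] v web_vect_spin[OF W] by blast
qed

lemma cycle_system_C:
  assumes W: "web W" and F: "flow_coloring W d c" and ab: "a \<noteq> b"
  shows "cycle_system (C_prime W d c a b)" "cycle_system (C_star W d c a b)"
proof -
  note PG = web_plane_graph[OF W]
  show "cycle_system (C_prime W d c a b)"
    unfolding C_prime_eq_directed[OF web_vect_spin[OF W] ab]
  proof (rule cycle_system_directed[OF PG])
    fix p assume p: "p \<in> verts W"
    obtain e f g \<delta> x where v: "e \<in> vect W" "f \<in> spin W" "g \<in> spin W" "e \<notin> spin W" "f \<notin> vect W" "g \<notin> vect W"
      and H: "half_edges (vect W \<union> spin W) p = {(e, \<delta>), (f, True), (g, False)}"
      and c: "c e = {x}" "d e = \<delta> \<and> x \<notin> c f \<and> c g = insert x (c f) \<or> d e = (\<not> \<delta>) \<and> x \<notin> c g \<and> c f = insert x (c g)"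
      by (rule flow_coloring_vertex[OF W F p])
    have st: "state_prime W d c a b e = (if x = b then Some (d e) else if x = a then Some (\<not> d e) else None)"
      "state_prime W d c a b f = (if b \<in> c f \<and> a \<notin> c f then Some True else if a \<in> c f \<and> b \<notin> c f then Some False else None)"
      "state_prime W d c a b g = (if b \<in> c g \<and> a \<notin> c g then Some True else if a \<in> c g \<and> b \<notin> c g then Some False else None)"
      using v c by (auto simp: state_prime_def)
    show "(\<exists>h\<in>half_edges (vect W \<union> spin W) p. state_prime W d c a b (fst h) = Some (snd h)) \<longleftrightarrow>
      (\<exists>h\<in>half_edges (vect W \<union> spin W) p. state_prime W d c a b (fst h) = Some (\<not> snd h))"
      unfolding H using st c(2) ab by (elim disjE conjE) (auto split: if_splits)
    fix h k assume "h \<in> half_edges (vect W \<union> spin W) p" "k \<in> half_edges (vect W \<union> spin W) p"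
    hence hk: "h = (e, \<delta>) \<or> h = (f, True) \<or> h = (g, False)" "k = (e, \<delta>) \<or> k = (f, True) \<or> k = (g, False)"
      unfolding H by auto
    show "h = k" if "state_prime W d c a b (fst h) = Some (snd h)" "state_prime W d c a b (fst k) = Some (snd k)"
      using that st c(2) ab hk by (elim disjE conjE) (auto split: if_splits)
    show "h = k" if "state_prime W d c a b (fst h) = Some (\<not> snd h)" "state_prime W d c a b (fst k) = Some (\<not> snd k)"
      using that st c(2) ab hk by (elim disjE conjE) (auto split: if_splits)
  qed
  show "cycle_system (C_star W d c a b)"
    unfolding C_star_eq_directed[OF web_vect_spin[OF W]]
  proof (rule cycle_system_directed[OF PG])
    fix p assume p: "p \<in> verts W"
    obtain e f g \<delta> x where v: "e \<in> vect W" "f \<in> spin W" "g \<in> spin W" "e \<notin> spin W" "f \<notin> vect W" "g \<notin> vect W"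
      and H: "half_edges (vect W \<union> spin W) p = {(e, \<delta>), (f, True), (g, False)}"
      and c: "c e = {x}" "d e = \<delta> \<and> x \<notin> c f \<and> c g = insert x (c f) \<or> d e = (\<not> \<delta>) \<and> x \<notin> c g \<and> c f = insert x (c g)"
      by (rule flow_coloring_vertex[OF W F p])
    have st: "state_star W d c a b e = (if x = a \<or> x = b then Some (d e) else None)"
      "state_star W d c a b f = (if a \<in> c f \<and> b \<in> c f then Some True else if a \<notin> c f \<and> b \<notin> c f then Some False else None)"
      "state_star W d c a b g = (if a \<in> c g \<and> b \<in> c g then Some True else if a \<notin> c g \<and> b \<notin> c g then Some False else None)"
      using v c by (auto simp: state_star_def)
    show "(\<exists>h\<in>half_edges (vect W \<union> spin W) p. state_star W d c a b (fst h) = Some (snd h)) \<longleftrightarrow>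
      (\<exists>h\<in>half_edges (vect W \<union> spin W) p. state_star W d c a b (fst h) = Some (\<not> snd h))"
      unfolding H using st c(2) ab by (elim disjE conjE) (auto split: if_splits)
    fix h k assume "h \<in> half_edges (vect W \<union> spin W) p" "k \<in> half_edges (vect W \<union> spin W) p"
    hence hk: "h = (e, \<delta>) \<or> h = (f, True) \<or> h = (g, False)" "k = (e, \<delta>) \<or> k = (f, True) \<or> k = (g, False)"
      unfolding H by auto
    show "h = k" if "state_star W d c a b (fst h) = Some (snd h)" "state_star W d c a b (fst k) = Some (snd k)"
      using that st c(2) ab hk by (elim disjE conjE) (auto split: if_splits)
    show "h = k" if "state_star W d c a b (fst h) = Some (\<not> snd h)" "state_star W d c a b (fst k) = Some (\<not> snd k)"
      using that st c(2) ab hk by (elim disjE conjE) (auto split: if_splits)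
  qed
qed

section \<open>Webs whose spin edges form squares\<close>

lemma closed_chain_next:
  assumes "closed_chain ps" "x \<in> set ps"
  obtains y where "y \<in> set ps" "pathstart y = pathfinish x"
proof -
  have "\<exists>i<length ps. ps ! i = x" using assms(2) by (simp only: in_set_conv_nth)
  then obtain i where i: "i < length ps" "ps ! i = x" by blast
  have n: "0 < length ps" using i(1) by (cases ps) auto
  have "pathstart (ps ! (Suc i mod length ps)) = pathfinish x"
    using assms(1) i unfolding closed_chain_def by metis
  thus ?thesis using that nth_mem[OF mod_less_divisor[OF n]] by blast
qed

lemma closed_chain_const:
  assumes ps: "closed_chain ps"
    and step: "\<And>f g. f \<in> set ps \<Longrightarrow> g \<in> set ps \<Longrightarrow> pathfinish f = pathstart g \<Longrightarrow> P f \<longleftrightarrow> P g"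
    and xy: "x \<in> set ps" "y \<in> set ps"
  shows "P x \<longleftrightarrow> P y"
proof -
  have "P (ps ! i) \<longleftrightarrow> P (ps ! 0)" if "i < length ps" for i
    using that
  proof (induction i)
    case (Suc i)
    have "P (ps ! i) \<longleftrightarrow> P (ps ! Suc i)"
      by (rule step[OF _ _ closed_chain_Suc[OF ps Suc.prems]]) (use Suc.prems in \<open>simp_all\<close>)
    thus ?case using Suc by simp
  qed simp
  hence "P z \<longleftrightarrow> P (ps ! 0)" if "z \<in> set ps" for z
  proof -
    have "\<exists>i<length ps. ps ! i = z" using that by (simp only: in_set_conv_nth)
    thus ?thesis using \<open>\<And>i. i < length ps \<Longrightarrow> P (ps ! i) \<longleftrightarrow> P (ps ! 0)\<close> by blast
  qed
  thus ?thesis using xy by blast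
qed

text \<open>What the sums over colors need of a square resolution. The points of \<open>V\<close>
  merely index the squares, and the last assumption keeps all edges out of the discs, as the
  comparison of winding numbers requires.\<close>

locale squared_web =
  fixes W :: web and V :: "complex set" and sq :: "complex \<Rightarrow> curve list"
  assumes web: "web W" and finite_V: "finite V"
    and square: "v \<in> V \<Longrightarrow> square (sq v)"
    and even_eq: "spin_even W = (\<Union>v\<in>V. {sq v ! 0, sq v ! 2})"
    and odd_eq: "spin_odd W = (\<Union>v\<in>V. {sq v ! 1, sq v ! 3})"
    and verts_eq: "verts W = (\<Union>v\<in>V. corners (sq v))"
    and disjoint: "v \<in> V \<Longrightarrow> w \<in> V \<Longrightarrow> v \<noteq> w \<Longrightarrow> set (sq v) \<inter> set (sq w) = {}"
    and inside: "v \<in> V \<Longrightarrow> e \<in> vect W \<union> spin W \<Longrightarrow> path_image e \<inter> sq_inside (sq v) = {}"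
begin

abbreviation "E \<equiv> vect W \<union> spin W"

lemma sq_props:
  assumes "v \<in> V"
  shows "closed_chain (sq v)" "length (sq v) = 4" "distinct (sq v)"
    "set (sq v) = {sq v ! 0, sq v ! 1, sq v ! 2, sq v ! 3}"
    "i < 4 \<Longrightarrow> sq v ! i \<in> set (sq v)"
proof -
  show c: "closed_chain (sq v)" and l: "length (sq v) = 4" using square[OF assms] by (auto simp: square_def)
  show "distinct (sq v)" using c by (simp add: closed_chain_def)
  obtain s0 s1 s2 s3 where "sq v = [s0, s1, s2, s3]"
    using l by (auto simp: length_Suc_conv eval_nat_numeral)
  thus "set (sq v) = {sq v ! 0, sq v ! 1, sq v ! 2, sq v ! 3}" by simp
  show "i < 4 \<Longrightarrow> sq v ! i \<in> set (sq v)" using l by (intro nth_mem) simp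
qed

lemma spin_eq: "spin W = (\<Union>v\<in>V. set (sq v))"
  unfolding spin_def even_eq odd_eq using sq_props(4) by blast

lemma sq_spin: "v \<in> V \<Longrightarrow> s \<in> set (sq v) \<Longrightarrow> s \<in> spin W"
  using spin_eq by blast

lemma sq_not_vect: "v \<in> V \<Longrightarrow> s \<in> set (sq v) \<Longrightarrow> s \<notin> vect W"
  using sq_spin web_vect_spin[OF web] by blast

lemma corner_verts: "v \<in> V \<Longrightarrow> s \<in> set (sq v) \<Longrightarrow> pathstart s \<in> verts W"
  unfolding verts_eq corners_def by blast

text \<open>Only one spin edge starts at a given vertex, so the spin edge following a side of a
  square is the next side of the same square.\<close>

lemma same_square:
  assumes v: "v \<in> V" and fg: "f \<in> spin W" "g \<in> spin W" "pathfinish f = pathstart g"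
  shows "f \<in> set (sq v) \<longleftrightarrow> g \<in> set (sq v)"
proof -
  have nxt: "g \<in> set (sq w)" if w: "w \<in> V" and f: "f \<in> set (sq w)" for w
  proof -
    obtain y where y: "y \<in> set (sq w)" "pathstart y = pathfinish f"
      using closed_chain_next[OF sq_props(1)[OF w] f] .
    have p: "pathstart y \<in> verts W" using corner_verts[OF w y(1)] .
    have "\<exists>!e. e \<in> spin W \<and> pathstart e = pathstart y" using web p unfolding web_def by blast
    hence "g = y" using fg y sq_spin[OF w y(1)] by metis
    thus ?thesis using y(1) by simp
  qed
  obtain w where w: "w \<in> V" "f \<in> set (sq w)" using fg(1) spin_eq by blast
  have "g \<in> set (sq w)" using nxt[OF w] .
  show ?thesis
  proof (cases "v = w")
    case True thus ?thesis using w \<open>g \<in> set (sq w)\<close> by simp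
  next
    case False
    thus ?thesis using disjoint[OF v w(1)] w \<open>g \<in> set (sq w)\<close> by blast
  qed
qed

text \<open>Applies the local criterion to the state that uses the sides of this square forwards and
  nothing else.\<close>

lemma cycle_system_sq:
  assumes v: "v \<in> V"
  shows "cycle_system (set (sq v))"
proof -
  define st where "st e = (if e \<in> set (sq v) then Some True else None)" for e
  have "cycle_system (directed E st)"
  proof (rule cycle_system_directed[OF web_plane_graph[OF web]])
    fix p assume p: "p \<in> verts W"
    obtain e f g \<delta> where w: "e \<in> vect W" "f \<in> spin W" "g \<in> spin W" "e \<notin> spin W"
      "pathfinish (orient \<delta> e) = p" "pathfinish f = p" "pathstart g = p"
      "half_edges (vect W \<union> spin W) p = {(e, \<delta>), (f, True), (g, False)}"
      "\<forall>x\<in>spin W. pathfinish x = p \<longrightarrow> x = f" "\<forall>x\<in>spin W. pathstart x = p \<longrightarrow> x = g"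
      "\<forall>x\<in>vect W. \<forall>\<epsilon>. pathfinish (orient \<epsilon> x) = p \<longrightarrow> x = e \<and> \<epsilon> = \<delta>"
      by (rule web_vertex[OF web p])
    have e: "st e = None" using w(1) sq_not_vect[OF v] by (auto simp: st_def)
    have fg: "st f = Some True \<longleftrightarrow> st g = Some True" "st f \<noteq> Some False" "st g \<noteq> Some False"
      using same_square[OF v w(2,3)] w(6,7) by (auto simp: st_def)
    show "(\<exists>h\<in>half_edges (vect W \<union> spin W) p. st (fst h) = Some (snd h)) \<longleftrightarrow>
      (\<exists>h\<in>half_edges (vect W \<union> spin W) p. st (fst h) = Some (\<not> snd h))"
      unfolding w(8) using e fg by simp
    fix h k assume "h \<in> half_edges (vect W \<union> spin W) p" "k \<in> half_edges (vect W \<union> spin W) p"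
    hence hk: "h = (e, \<delta>) \<or> h = (f, True) \<or> h = (g, False)" "k = (e, \<delta>) \<or> k = (f, True) \<or> k = (g, False)"
      unfolding w(8) by auto
    show "h = k" if "st (fst h) = Some (snd h)" "st (fst k) = Some (snd k)"
      using that e fg hk by (elim disjE) auto
    show "h = k" if "st (fst h) = Some (\<not> snd h)" "st (fst k) = Some (\<not> snd k)"
      using that e fg hk by (elim disjE) auto
  qed
  moreover have "directed E st = set (sq v)"
  proof (intro set_eqI iffI)
    fix x assume "x \<in> directed E st"
    then obtain \<delta> e where "e \<in> E" "st e = Some \<delta>" "x = orient \<delta> e" by (rule directedE)
    thus "x \<in> set (sq v)" by (auto simp: st_def split: if_splits)
  next
    fix x assume x: "x \<in> set (sq v)"
    hence "st x = Some True" by (simp add: st_def)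
    thus "x \<in> directed E st" using directedI[of x E st True] sq_spin[OF v x] by simp
  qed
  ultimately show ?thesis by simp
qed

lemma sq_inside_eq: "v \<in> V \<Longrightarrow> sq_inside (sq v) = inside (union_image (set (sq v)))"
  unfolding sq_inside_def using cycle_loop(3)[OF cycle_system_sq sq_props(1)] by simp

section \<open>Involved and uninvolved colors at a square\<close>

text \<open>The choice is unique at every vertex of \<open>W\<close>; elsewhere it is an arbitrary
  default.\<close>

definition vedge :: "complex \<Rightarrow> curve" where
  "vedge p = (SOME e. e \<in> vect W \<and> (\<exists>\<delta>. pathfinish (orient \<delta> e) = p))"

definition color_at :: "(curve \<Rightarrow> nat set) \<Rightarrow> complex \<Rightarrow> nat" where
  "color_at c p = the_elem (c (vedge p))"

definition inward :: "(curve \<Rightarrow> bool) \<Rightarrow> complex \<Rightarrow> bool" where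
  "inward d p \<longleftrightarrow> pathfinish (orient (d (vedge p)) (vedge p)) = p"

lemma vedge:
  assumes "p \<in> verts W"
  shows "vedge p \<in> vect W" "inward d p \<or> pathstart (orient (d (vedge p)) (vedge p)) = p"
    "e \<in> vect W \<Longrightarrow> pathfinish (orient (d e) e) = p \<Longrightarrow> e = vedge p \<and> inward d p"
    "e \<in> vect W \<Longrightarrow> pathstart (orient (d e) e) = p \<Longrightarrow> e = vedge p \<and> \<not> inward d p"
proof -
  obtain e f g \<delta> where w: "e \<in> vect W" "f \<in> spin W" "g \<in> spin W" "e \<notin> spin W"
    "pathfinish (orient \<delta> e) = p" "pathfinish f = p" "pathstart g = p"
    "half_edges (vect W \<union> spin W) p = {(e, \<delta>), (f, True), (g, False)}"
    "\<forall>x\<in>spin W. pathfinish x = p \<longrightarrow> x = f" "\<forall>x\<in>spin W. pathstart x = p \<longrightarrow> x = g"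
    "\<forall>x\<in>vect W. \<forall>\<epsilon>. pathfinish (orient \<epsilon> x) = p \<longrightarrow> x = e \<and> \<epsilon> = \<delta>"
    by (rule web_vertex[OF web assms])
  have "vedge p \<in> vect W \<and> (\<exists>\<delta>. pathfinish (orient \<delta> (vedge p)) = p)"
    unfolding vedge_def by (rule someI[of _ e]) (use w(1,5) in blast)
  hence ve: "vedge p = e" using w(11) by blast
  show "vedge p \<in> vect W" using ve w(1) by simp
  have "d e = \<delta> \<or> d e = (\<not> \<delta>)" by auto
  thus "inward d p \<or> pathstart (orient (d (vedge p)) (vedge p)) = p"
    unfolding inward_def ve using w(5) by auto
  show "x = vedge p \<and> inward d p" if "x \<in> vect W" "pathfinish (orient (d x) x) = p" for x
    using w(11) that unfolding ve inward_def by blast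
  show "x = vedge p \<and> \<not> inward d p" if x: "x \<in> vect W" "pathstart (orient (d x) x) = p" for x
  proof -
    have "pathfinish (orient (\<not> d x) x) = p" using x(2) by simp
    hence "x = e" "(\<not> d x) = \<delta>" using w(11) x(1) by blast+
    moreover have "pathfinish (orient (d e) e) \<noteq> p" if "(\<not> d e) = \<delta>" using w(1,11) that by blast
    ultimately show ?thesis unfolding ve inward_def by blast
  qed
qed

text \<open>Indexing the rule by consecutive spin edges instead of vertices turns it into a
  recursion around the square; the corner is the start of the second edge.\<close>

lemma flow_coloring_iff:
  "flow_coloring W d c \<longleftrightarrow> (\<forall>e\<in>vect W. \<exists>a. c e = {a}) \<and>
    (\<forall>f\<in>spin W. \<forall>g\<in>spin W. pathfinish f = pathstart g \<longrightarrow>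
      (if inward d (pathstart g)
       then color_at c (pathstart g) \<notin> c f \<and> c g = insert (color_at c (pathstart g)) (c f)
       else color_at c (pathstart g) \<notin> c g \<and> c f = insert (color_at c (pathstart g)) (c g)))"
  (is "_ \<longleftrightarrow> ?S \<and> (\<forall>f\<in>spin W. \<forall>g\<in>spin W. pathfinish f = pathstart g \<longrightarrow> ?P f g)")
proof (intro iffI conjI ballI impI)
  assume F: "flow_coloring W d c"
  show "\<exists>a. c e = {a}" if "e \<in> vect W" for e using F that unfolding flow_coloring_def by blast
  fix f g assume fg: "f \<in> spin W" "g \<in> spin W" "pathfinish f = pathstart g"
  let ?p = "pathstart g"
  have p: "?p \<in> verts W" using fg(2) corner_verts spin_eq by blast
  obtain a where a: "c (vedge ?p) = {a}" using F vedge(1)[OF p] unfolding flow_coloring_def by blast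
  hence ca: "color_at c ?p = a" by (simp add: color_at_def)
  have "(pathfinish (orient (d (vedge ?p)) (vedge ?p)) = ?p \<longrightarrow> a \<notin> c f \<and> c g = c f \<union> {a}) \<and>
        (pathstart (orient (d (vedge ?p)) (vedge ?p)) = ?p \<longrightarrow> a \<notin> c g \<and> c f = c g \<union> {a})"
    using F p vedge(1)[OF p] fg a unfolding flow_coloring_def by blast
  thus "?P f g" unfolding ca using vedge(2)[OF p, of d] unfolding inward_def by auto
next
  assume A: "?S \<and> (\<forall>f\<in>spin W. \<forall>g\<in>spin W. pathfinish f = pathstart g \<longrightarrow> ?P f g)"
  show "flow_coloring W d c" unfolding flow_coloring_def
  proof (intro conjI ballI allI impI)
    show "\<exists>a. c e = {a}" if "e \<in> vect W" for e using A that by blast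
    fix p e f g a
    assume p: "p \<in> verts W" and e: "e \<in> vect W" and fg: "f \<in> spin W" "g \<in> spin W"
      and c: "c e = {a}" and ends: "pathfinish f = p" "pathstart g = p"
    have "pathfinish f = pathstart g" using ends by simp
    with bspec[OF bspec[OF conjunct2[OF A] fg(1)] fg(2)] have P: "?P f g" by (rule mp)
    have ca: "color_at c p = a" if "e = vedge p" using that c by (simp add: color_at_def)
    show "a \<notin> c f" "c g = c f \<union> {a}" if "pathfinish (orient (d e) e) = p"
      using vedge(3)[where d = d, OF p e that] ca P ends(2) by auto
    show "a \<notin> c g" "c f = c g \<union> {a}" if "pathstart (orient (d e) e) = p"
      using vedge(4)[where d = d, OF p e that] ca P ends(2) by auto
  qed
qed

definition involved :: "(curve \<Rightarrow> nat set) \<Rightarrow> complex \<Rightarrow> nat set" where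
  "involved c v = color_at c ` corners (sq v)"

lemma color_at_cong: "p \<in> verts W \<Longrightarrow> (\<And>e. e \<in> vect W \<Longrightarrow> c e = c' e) \<Longrightarrow> color_at c p = color_at c' p"
  using vedge(1) by (simp add: color_at_def)

lemma involved_cong:
  assumes "v \<in> V" "\<And>e. e \<in> vect W \<Longrightarrow> c e = c' e"
  shows "involved c v = involved c' v"
proof -
  have "color_at c p = color_at c' p" if "p \<in> corners (sq v)" for p
    using that assms verts_eq by (intro color_at_cong) auto
  thus ?thesis unfolding involved_def by simp
qed

lemma color_at_involved: "s \<in> set (sq v) \<Longrightarrow> color_at c (pathstart s) \<in> involved c v"
  by (simp add: involved_def corners_def)

text \<open>Membership of a color flips exactly at the corners of that color, and there the
  orientation of the vectorial edge tells on which of the two sides the color lies.\<close>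

lemma flow_step:
  assumes "flow_coloring W d c" "v \<in> V" "f \<in> set (sq v)" "g \<in> set (sq v)" "pathfinish f = pathstart g"
  shows "a \<in> c f \<longleftrightarrow> (a \<in> c g) \<noteq> (a = color_at c (pathstart g))"
    "a = color_at c (pathstart g) \<Longrightarrow> a \<in> c g \<longleftrightarrow> inward d (pathstart g)"
proof -
  let ?x = "color_at c (pathstart g)"
  have "if inward d (pathstart g) then ?x \<notin> c f \<and> c g = insert ?x (c f) else ?x \<notin> c g \<and> c f = insert ?x (c g)"
    using assms(1) sq_spin[OF assms(2)] assms(3-5) unfolding flow_coloring_iff by blast
  thus "a \<in> c f \<longleftrightarrow> (a \<in> c g) \<noteq> (a = ?x)" "a = ?x \<Longrightarrow> a \<in> c g \<longleftrightarrow> inward d (pathstart g)"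
    by (auto split: if_splits)
qed

lemma uninvolved_const:
  assumes "flow_coloring W d c" "v \<in> V" "a \<notin> involved c v" "x \<in> set (sq v)" "y \<in> set (sq v)"
  shows "a \<in> c x \<longleftrightarrow> a \<in> c y"
proof (rule closed_chain_const[OF sq_props(1)[OF assms(2)] _ assms(4,5)])
  fix f g assume fg: "f \<in> set (sq v)" "g \<in> set (sq v)" "pathfinish f = pathstart g"
  have "a \<noteq> color_at c (pathstart g)" using color_at_involved[OF fg(2)] assms(3) by metis
  thus "a \<in> c f \<longleftrightarrow> a \<in> c g" using flow_step(1)[OF assms(1,2) fg] by blast
qed

text \<open>At a corner of color \<open>a\<close> the orientation decides whether \<open>a\<close>
  lies on the side starting there. Around the square, \<open>c\<close> and \<open>c'\<close> flip at
  the same corners, so agreement on one side spreads to all.\<close>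

lemma involved_determined:
  assumes F: "flow_coloring W d c" "flow_coloring W d c'" and v: "v \<in> V"
    and eq: "\<And>e. e \<in> vect W \<Longrightarrow> c e = c' e" and a: "a \<in> involved c v" and s: "s \<in> set (sq v)"
  shows "a \<in> c s \<longleftrightarrow> a \<in> c' s"
proof -
  have ca: "color_at c (pathstart g) = color_at c' (pathstart g)" if "g \<in> set (sq v)" for g
    using color_at_cong[OF corner_verts[OF v that] eq] .
  obtain g where g: "g \<in> set (sq v)" "a = color_at c (pathstart g)"
    using a by (auto simp: involved_def corners_def)
  have "\<exists>f\<in>set (sq v). pathfinish f = pathstart g"
    using cycle_systemD(7)[OF cycle_system_sq[OF v] g(1)] .
  then obtain f where f: "f \<in> set (sq v)" "pathfinish f = pathstart g" by blast
  have "(a \<in> c s \<longleftrightarrow> a \<in> c' s) \<longleftrightarrow> (a \<in> c g \<longleftrightarrow> a \<in> c' g)"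
  proof (rule closed_chain_const[OF sq_props(1)[OF v] _ s g(1)])
    fix h k assume hk: "h \<in> set (sq v)" "k \<in> set (sq v)" "pathfinish h = pathstart k"
    show "(a \<in> c h \<longleftrightarrow> a \<in> c' h) \<longleftrightarrow> (a \<in> c k \<longleftrightarrow> a \<in> c' k)"
      using flow_step(1)[OF F(1) v hk, of a] flow_step(1)[OF F(2) v hk, of a] ca[OF hk(2)] by auto
  qed
  moreover have "a \<in> c g \<longleftrightarrow> a \<in> c' g"
    using flow_step(2)[OF F(1) v f(1) g(1) f(2) g(2)] flow_step(2)[OF F(2) v f(1) g(1) f(2)] g(2) ca[OF g(1)] by simp
  ultimately show ?thesis by simp
qed

section \<open>The effect of one additional color on the degree\<close>

definition add_color :: "complex \<Rightarrow> nat \<Rightarrow> (curve \<Rightarrow> nat set) \<Rightarrow> curve \<Rightarrow> nat set" where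
  "add_color v b c e = (if e \<in> set (sq v) then insert b (c e) else c e)"

text \<open>No corner of the square has color \<open>b\<close>, and \<open>b\<close> is put on both
  sides at each corner, so the rule there is unaffected.\<close>

lemma flow_coloring_add_color:
  assumes F: "flow_coloring W d c" and v: "v \<in> V" and b: "b \<notin> involved c v" and nb: "\<And>s. s \<in> set (sq v) \<Longrightarrow> b \<notin> c s"
  shows "flow_coloring W d (add_color v b c)"
proof -
  have vect: "add_color v b c e = c e" if "e \<in> vect W" for e
    using that sq_not_vect[OF v] by (auto simp: add_color_def)
  show ?thesis unfolding flow_coloring_iff
  proof (intro conjI ballI impI)
    show "\<exists>a. add_color v b c e = {a}" if "e \<in> vect W" for e
      using F that vect[OF that] unfolding flow_coloring_iff by simp
    fix f g assume fg: "f \<in> spin W" "g \<in> spin W" "pathfinish f = pathstart g"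
    let ?p = "pathstart g"
    have p: "?p \<in> verts W" using fg(2) corner_verts spin_eq by blast
    have ca: "color_at (add_color v b c) ?p = color_at c ?p" using color_at_cong[OF p vect] .
    have P: "if inward d ?p then color_at c ?p \<notin> c f \<and> c g = insert (color_at c ?p) (c f)
       else color_at c ?p \<notin> c g \<and> c f = insert (color_at c ?p) (c g)"
      using F fg unfolding flow_coloring_iff by blast
    have same: "f \<in> set (sq v) \<longleftrightarrow> g \<in> set (sq v)" using same_square[OF v fg] .
    have "color_at c ?p \<noteq> b" if "g \<in> set (sq v)" using color_at_involved[OF that] b by metis
    thus "if inward d ?p then color_at (add_color v b c) ?p \<notin> add_color v b c f \<and>
            add_color v b c g = insert (color_at (add_color v b c) ?p) (add_color v b c f)
       else color_at (add_color v b c) ?p \<notin> add_color v b c g \<and>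
            add_color v b c f = insert (color_at (add_color v b c) ?p) (add_color v b c g)"
      unfolding ca using P same by (auto simp: add_color_def split: if_splits)
  qed
qed

lemma rotational_add_color:
  assumes F: "flow_coloring W d c" and v: "v \<in> V" and b: "b \<notin> involved c v" and nb: "\<And>s. s \<in> set (sq v) \<Longrightarrow> b \<notin> c s"
    and ab: "a \<noteq> b"
  defines "c' \<equiv> add_color v b c"
  defines "t \<equiv> turn (set (sq v)) * side_sign (sq v) {s \<in> set (sq v). a \<in> c s}"
  shows "rotational (C_prime W d c' a b) - rotational (C_prime W d c a b) = t"
    "rotational (C_star W d c' a b) - rotational (C_star W d c a b) = t"
    "rotational (C_prime W d c b a) - rotational (C_prime W d c' b a) = t"
    "rotational (C_star W d c' b a) - rotational (C_star W d c b a) = t"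
proof -
  let ?A = "{s \<in> set (sq v). a \<in> c s}"
  have F': "flow_coloring W d c'" unfolding c'_def using flow_coloring_add_color[OF F v b nb] .
  have ba: "b \<noteq> a" using ab by simp
  note dis = web_vect_spin[OF web]
  have tog: "rotational (directed E st) - rotational (directed E st') = turn (set (sq v)) * side_sign (sq v) A"
    if "cycle_system (directed E st)" "cycle_system (directed E st')"
      "\<And>e. e \<in> E \<Longrightarrow> e \<notin> set (sq v) \<Longrightarrow> st e = st' e"
      "A \<subseteq> set (sq v)" "\<And>s. s \<in> A \<Longrightarrow> st s = Some True \<and> st' s = None"
      "\<And>s. s \<in> set (sq v) \<Longrightarrow> s \<notin> A \<Longrightarrow> st s = None \<and> st' s = Some False" for st st' A
  proof (rule rotational_toggle[OF web_plane_graph[OF web] sq_props(1,2)[OF v] _ cycle_system_sq[OF v] that])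
    show "set (sq v) \<subseteq> E" using sq_spin[OF v] by blast
    show "path_image e \<inter> inside (union_image (set (sq v))) = {}" if "e \<in> E" for e
      using inside[OF v that] sq_inside_eq[OF v] by simp
  qed
  have nv: "s \<notin> vect W" if "s \<in> set (sq v)" for s using sq_not_vect[OF v that] .
  have c': "c' s = insert b (c s)" if "s \<in> set (sq v)" for s using that by (simp add: c'_def add_color_def)
  have c'': "c' s = c s" if "s \<notin> set (sq v)" for s using that by (simp add: c'_def add_color_def)
  have "rotational (C_prime W d c' a b) - rotational (C_prime W d c a b)
      = turn (set (sq v)) * side_sign (sq v) (set (sq v) - ?A)"
    unfolding C_prime_eq_directed[OF dis ab]
  proof (rule tog)
    show "cycle_system (directed E (state_prime W d c' a b))" "cycle_system (directed E (state_prime W d c a b))"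
      using cycle_system_C(1)[OF web F' ab] cycle_system_C(1)[OF web F ab] unfolding C_prime_eq_directed[OF dis ab] .
  qed (use nb ab nv in \<open>auto simp: state_prime_def c' c''\<close>)
  thus "rotational (C_prime W d c' a b) - rotational (C_prime W d c a b) = t"
    unfolding t_def using side_sign_complement[of ?A "sq v"] sq_props(2,3)[OF v] by simp
  show "rotational (C_star W d c' a b) - rotational (C_star W d c a b) = t"
    unfolding t_def C_star_eq_directed[OF dis]
  proof (rule tog)
    show "cycle_system (directed E (state_star W d c' a b))" "cycle_system (directed E (state_star W d c a b))"
      using cycle_system_C(2)[OF web F' ab] cycle_system_C(2)[OF web F ab] unfolding C_star_eq_directed[OF dis] .
  qed (use nb ab nv in \<open>auto simp: state_star_def c' c''\<close>)
  show "rotational (C_prime W d c b a) - rotational (C_prime W d c' b a) = t"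
    unfolding t_def C_prime_eq_directed[OF dis ba]
  proof (rule tog)
    show "cycle_system (directed E (state_prime W d c' b a))" "cycle_system (directed E (state_prime W d c b a))"
      using cycle_system_C(1)[OF web F' ba] cycle_system_C(1)[OF web F ba] unfolding C_prime_eq_directed[OF dis ba] .
  qed (use nb ab nv in \<open>auto simp: state_prime_def c' c''\<close>)
  show "rotational (C_star W d c' b a) - rotational (C_star W d c b a) = t"
    unfolding t_def C_star_eq_directed[OF dis]
  proof (rule tog)
    show "cycle_system (directed E (state_star W d c' b a))" "cycle_system (directed E (state_star W d c b a))"
      using cycle_system_C(2)[OF web F' ba] cycle_system_C(2)[OF web F ba] unfolding C_star_eq_directed[OF dis] .
  qed (use nb ab nv in \<open>auto simp: state_star_def c' c''\<close>)
qed

lemma C_add_color_other: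
  assumes "x \<noteq> b" "y \<noteq> b" "v \<in> V"
  shows "C_prime W d (add_color v b c) x y = C_prime W d c x y"
    "C_star W d (add_color v b c) x y = C_star W d c x y"
proof -
  have v: "add_color v b c e = c e" if "e \<in> vect W" for e
    using that sq_not_vect[OF assms(3)] by (auto simp: add_color_def)
  have m: "z \<in> add_color v b c e \<longleftrightarrow> z \<in> c e" if "z \<noteq> b" for z e using that by (simp add: add_color_def)
  show "C_prime W d (add_color v b c) x y = C_prime W d c x y"
    "C_star W d (add_color v b c) x y = C_star W d c x y"
    unfolding C_prime_def C_star_def m[OF assms(1)] m[OF assms(2)] using v by (auto; metis)+
qed

text \<open>Only the colors below \<open>b\<close> contribute: for \<open>a > b\<close> the changes in \<open>C_prime\<close> and \<open>C_star\<close> cancel.\<close>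

lemma degree_add_color:
  assumes F: "flow_coloring W d c" and v: "v \<in> V" and b: "b \<notin> involved c v" and nb: "\<And>s. s \<in> set (sq v) \<Longrightarrow> b \<notin> c s"
    and bN: "b \<in> {1..N}"
  shows "degree_of N W d (add_color v b c) = degree_of N W d c +
    2 * turn (set (sq v)) * (\<Sum>a\<in>{1..<b}. side_sign (sq v) {s \<in> set (sq v). a \<in> c s})"
proof -
  let ?P = "{(x, y). 1 \<le> x \<and> x < y \<and> y \<le> N}"
  let ?g = "\<lambda>a. side_sign (sq v) {s \<in> set (sq v). a \<in> c s}"
  define D where "D c x y = rotational (C_prime W d c x y) + rotational (C_star W d c x y)" for c x y
  have fin: "finite ?P" by (rule finite_subset[of _ "{..N} \<times> {..N}"]) auto
  \<comment> \<open>With \<open>b\<close> as the larger color, \<open>C_prime\<close> and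
    \<open>C_star\<close> change by the same amount; this is the origin of the factor
    \<open>2\<close>.\<close>
  have D: "D (add_color v b c) x y - D c x y = (if y = b then 2 * (turn (set (sq v)) * ?g x) else 0)"
    if "x < y" for x y
  proof (cases "y = b")
    case True
    hence "x \<noteq> b" using that by simp
    from rotational_add_color(1,2)[OF F v b nb this] show ?thesis unfolding True D_def by simp
  next
    case y: False
    show ?thesis
    proof (cases "x = b")
      case True
      from rotational_add_color(3,4)[OF F v b nb y] show ?thesis using y unfolding True D_def by simp
    next
      case False
      thus ?thesis using y C_add_color_other[OF False y v] by (simp add: D_def)
    qed
  qed
  have "degree_of N W d (add_color v b c) - degree_of N W d c
      = (\<Sum>(x, y)\<in>?P. D (add_color v b c) x y) - (\<Sum>(x, y)\<in>?P. D c x y)"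
    by (simp add: degree_of_def D_def)
  also have "\<dots> = (\<Sum>(x, y)\<in>?P. D (add_color v b c) x y - D c x y)"
    unfolding sum_subtractf[symmetric] by (simp add: case_prod_unfold)
  also have "\<dots> = (\<Sum>(x, y)\<in>?P. if y = b then 2 * (turn (set (sq v)) * ?g x) else 0)"
    using D by (intro sum.cong) auto
  also have "\<dots> = (\<Sum>(x, y)\<in>(\<lambda>x. (x, b)) ` {1..<b}. if y = b then 2 * (turn (set (sq v)) * ?g x) else 0)"
    using bN fin by (intro sum.mono_neutral_right) auto
  also have "\<dots> = (\<Sum>x\<in>{1..<b}. 2 * (turn (set (sq v)) * ?g x))"
    by (subst sum.reindex) (auto simp: inj_on_def)
  also have "\<dots> = 2 * turn (set (sq v)) * (\<Sum>a\<in>{1..<b}. ?g a)"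
    by (simp add: sum_distrib_left mult.assoc)
  finally show ?thesis by simp
qed

end

section \<open>Laurent polynomials with nonnegative coefficients\<close>

lemma sum_in_Nats: "(\<And>i. i \<in> A \<Longrightarrow> f i \<in> \<nat>) \<Longrightarrow> sum f A \<in> \<nat>"
  by (induction A rule: infinite_finite_induct) auto

text \<open>Coefficients of a product are finite sums of products of coefficients, and they vanish
  outside the sumset of the two supports.\<close>

lemma nonneg_laurent_polys_times:
  assumes "f \<in> nonneg_laurent_polys" "g \<in> nonneg_laurent_polys"
  shows "f * g \<in> nonneg_laurent_polys"
proof -
  let ?F = "{n. fls_nth f n \<noteq> 0}" and ?G = "{n. fls_nth g n \<noteq> 0}"
  have f: "finite ?F" "\<And>n. fls_nth f n \<in> \<nat>" and g: "finite ?G" "\<And>n. fls_nth g n \<in> \<nat>"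
    using assms by (auto simp: nonneg_laurent_polys_def)
  have "fls_nth (f * g) n \<in> \<nat>" for n
    unfolding fls_times_nth(1) using f(2) g(2) by (intro sum_in_Nats Nats_mult) auto
  moreover have "{n. fls_nth (f * g) n \<noteq> 0} \<subseteq> (\<lambda>(u, v). u + v) ` (?F \<times> ?G)"
  proof
    fix n assume "n \<in> {n. fls_nth (f * g) n \<noteq> 0}"
    then obtain i where "fls_nth f (i - fls_subdegree g) * fls_nth g (fls_subdegree g + n - i) \<noteq> 0"
      unfolding mem_Collect_eq fls_times_nth(1) by (rule sum.not_neutral_contains_not_neutral)
    thus "n \<in> (\<lambda>(u, v). u + v) ` (?F \<times> ?G)"
      by (intro image_eqI[of _ _ "(i - fls_subdegree g, fls_subdegree g + n - i)"]) auto
  qed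
  from finite_subset[OF this finite_imageI[OF finite_cartesian_product[OF f(1) g(1)]]]
  have "finite {n. fls_nth (f * g) n \<noteq> 0}" .
  ultimately show ?thesis by (simp add: nonneg_laurent_polys_def)
qed

lemma nonneg_laurent_polys_add:
  assumes "f \<in> nonneg_laurent_polys" "g \<in> nonneg_laurent_polys"
  shows "f + g \<in> nonneg_laurent_polys"
proof -
  have "{n. fls_nth (f + g) n \<noteq> 0} \<subseteq> {n. fls_nth f n \<noteq> 0} \<union> {n. fls_nth g n \<noteq> 0}" by auto
  moreover have "finite ({n. fls_nth f n \<noteq> 0} \<union> {n. fls_nth g n \<noteq> 0})"
    using assms by (simp add: nonneg_laurent_polys_def)
  ultimately have "finite {n. fls_nth (f + g) n \<noteq> 0}" by (rule finite_subset)
  thus ?thesis using assms by (simp add: nonneg_laurent_polys_def Nats_add)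
qed

lemma nonneg_laurent_polys_X: "fls_X_intpow k \<in> nonneg_laurent_polys"
proof -
  have "{n. fls_nth (fls_X_intpow k :: rat fls) n \<noteq> 0} \<subseteq> {k}" by auto
  thus ?thesis by (auto simp: nonneg_laurent_polys_def intro: finite_subset)
qed

lemma nonneg_laurent_polys_0: "0 \<in> nonneg_laurent_polys"
  by (simp add: nonneg_laurent_polys_def)

lemma nonneg_laurent_polys_1: "1 \<in> nonneg_laurent_polys"
  using nonneg_laurent_polys_X[of 0] by simp

lemma nonneg_laurent_polys_sum:
  "(\<And>x. x \<in> A \<Longrightarrow> f x \<in> nonneg_laurent_polys) \<Longrightarrow> sum f A \<in> nonneg_laurent_polys"
  by (induction A rule: infinite_finite_induct)
    (auto simp: nonneg_laurent_polys_0 nonneg_laurent_polys_add)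

lemma nonneg_laurent_polys_prod:
  "(\<And>x. x \<in> A \<Longrightarrow> f x \<in> nonneg_laurent_polys) \<Longrightarrow> prod f A \<in> nonneg_laurent_polys"
  by (induction A rule: infinite_finite_induct)
    (auto simp: nonneg_laurent_polys_1 nonneg_laurent_polys_times)

lemma fls_X_intpow_add: "fls_X_intpow (i + j) = (fls_X_intpow i :: rat fls) * fls_X_intpow j"
  by (rule fls_X_intpow_times_fls_X_intpow[symmetric])

lemma fls_X_intpow_sum: "fls_X_intpow (\<Sum>x\<in>A. f x) = (\<Prod>x\<in>A. fls_X_intpow (f x) :: rat fls)"
proof (induction A rule: infinite_finite_induct)
  case (insert x A)
  thus ?case using fls_X_intpow_add by simp
qed auto

lemma q_two_nonzero: "q_two k \<noteq> 0"
proof -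
  have "fls_X_intpow (int i) + fls_X_intpow (- int i) \<noteq> (0 :: rat fls)" for i
  proof
    assume "fls_X_intpow (int i) + fls_X_intpow (- int i) = (0 :: rat fls)"
    from arg_cong[OF this, of "\<lambda>f. fls_nth f (int i)"] show False by (auto split: if_splits)
  qed
  thus ?thesis unfolding q_two_def by (simp add: prod_zero_iff)
qed

section \<open>The contribution of a vertex\<close>

text \<open>As \<open>b0\<close> has weight \<open>1\<close>, it can be inserted or removed to reach
  the required parity without changing the product. What remains is a free sum over subsets of
  \<open>U - {b0}\<close>; \<open>r\<close> only selects the parity.\<close>

lemma sum_parity_subsets:
  fixes w :: "'b \<Rightarrow> 'a::comm_semiring_1"
  assumes "finite U" "b0 \<in> U" "w b0 = 1"
  shows "(\<Sum>A | A \<subseteq> U \<and> even (card A + r). \<Prod>b\<in>A. w b) = (\<Prod>b\<in>U - {b0}. 1 + w b)"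
proof -
  have "(\<Sum>A | A \<subseteq> U \<and> even (card A + r). \<Prod>b\<in>A. w b) = (\<Sum>B\<in>Pow (U - {b0}). \<Prod>b\<in>B. w b)"
  proof (rule sum.reindex_bij_witness[of _ "\<lambda>B. if even (card B + r) then B else insert b0 B" "\<lambda>A. A - {b0}"])
    fix A assume "A \<in> {A. A \<subseteq> U \<and> even (card A + r)}"
    hence A: "A \<subseteq> U" "even (card A + r)" "finite A" using assms(1) finite_subset by auto
    show "A - {b0} \<in> Pow (U - {b0})" using A(1) by blast
    show "(if even (card (A - {b0}) + r) then A - {b0} else insert b0 (A - {b0})) = A"
    proof (cases "b0 \<in> A")
      case True
      have "card A = Suc (card (A - {b0}))" using card.remove[OF A(3) True] .
      thus ?thesis using A(2) True by auto
    next
      case False thus ?thesis using A(2) by simp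
    qed
    show "(\<Prod>b\<in>A - {b0}. w b) = (\<Prod>b\<in>A. w b)"
      using assms(3) prod.remove[OF A(3), of b0 w] by (cases "b0 \<in> A") simp_all
  next
    fix B assume "B \<in> Pow (U - {b0})"
    hence B: "B \<subseteq> U - {b0}" "finite B" "b0 \<notin> B" using assms(1) finite_subset by auto
    show "(if even (card B + r) then B else insert b0 B) - {b0} = B" using B(3) by auto
    show "(if even (card B + r) then B else insert b0 B) \<in> {A. A \<subseteq> U \<and> even (card A + r)}"
      using B assms(2) by auto
  qed
  also have "\<dots> = (\<Prod>b\<in>U - {b0}. w b + 1)" using assms(1) by (subst prod_add) simp_all
  finally show ?thesis by (simp add: add.commute)
qed

lemma bij_betw_rank:
  fixes U :: "nat set"
  assumes "finite U"
  shows "bij_betw (\<lambda>b. card {a \<in> U. a < b}) U {..<card U}"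
proof -
  have less: "card {a \<in> U. a < b} < card {a \<in> U. a < c}" if "b \<in> U" "b < c" for b c
    using assms that by (intro psubset_card_mono) auto
  have inj: "inj_on (\<lambda>b. card {a \<in> U. a < b}) U"
  proof (rule inj_onI, rule ccontr)
    fix b c assume "b \<in> U" "c \<in> U" "card {a \<in> U. a < b} = card {a \<in> U. a < c}" "b \<noteq> c"
    thus False using less[of b c] less[of c b] by (cases "b < c") auto
  qed
  have "(\<lambda>b. card {a \<in> U. a < b}) ` U \<subseteq> {..<card U}"
    using assms by (auto intro!: psubset_card_mono)
  hence "(\<lambda>b. card {a \<in> U. a < b}) ` U = {..<card U}"
    using card_image[OF inj] by (intro card_subset_eq) auto
  thus ?thesis using inj by (simp add: bij_betw_def)
qed

text \<open>For a sign \<open>t\<close>, \<open>1 + q^(2ti) = q^(ti) (q^i + q^(-i))\<close>; the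
  powers \<open>q^(ti)\<close> are collected in \<open>k\<close>.\<close>

lemma factor_q_two:
  assumes t: "t = 1 \<or> t = (- 1 :: int)"
  obtains k where "(\<Prod>i=1..n. 1 + fls_X_intpow (2 * t * int i)) = q_two n * fls_X_intpow k"
proof -
  have "1 + fls_X_intpow (2 * t * int i) = (fls_X_intpow (int i) + fls_X_intpow (- int i)) * (fls_X_intpow (t * int i) :: rat fls)" for i
  proof -
    have "(fls_X_intpow (int i) + fls_X_intpow (- int i)) * (fls_X_intpow (t * int i) :: rat fls)
      = fls_X_intpow (int i + t * int i) + fls_X_intpow (- int i + t * int i)"
      by (simp only: distrib_right fls_X_intpow_add)
    moreover have "int i + t * int i = 2 * t * int i \<and> - int i + t * int i = 0 \<or>
      int i + t * int i = 0 \<and> - int i + t * int i = 2 * t * int i"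
      using t by auto
    ultimately show ?thesis by (elim disjE conjE) (simp_all only: minus_zero fls_shift_0 add.commute)
  qed
  hence "(\<Prod>i=1..n. 1 + fls_X_intpow (2 * t * int i)) = q_two n * (\<Prod>i=1..n. fls_X_intpow (t * int i) :: rat fls)"
    unfolding q_two_def by (simp add: prod.distrib)
  also have "(\<Prod>i=1..n. fls_X_intpow (t * int i) :: rat fls) = fls_X_intpow (\<Sum>i=1..n. t * int i)"
    using fls_X_intpow_sum[of "\<lambda>i. t * int i" "{1..n}"] by simp
  finally show ?thesis by (rule that)
qed

text \<open>
  On the uninvolved colors, except for one of them if all four edges at the vertex have the same
  color \<open>x\<close>, the exponent is the rank, so that the factors \<open>q^i + q^(-i)\<close> for \<open>i \<le> N - 3\<close> split off.
\<close>

lemma sum_vertex_divisible: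
  fixes g :: "nat \<Rightarrow> int"
  assumes N: "N \<ge> 3" and I: "I \<subseteq> {1..N}" and t: "t = 1 \<or> t = (- 1 :: int)"
    and g1: "\<And>a. a \<notin> I \<Longrightarrow> g a = 1"
    and gI: "(\<exists>x y. x \<noteq> y \<and> I = {x, y} \<and> g x = 0 \<and> g y = 0) \<or> (\<exists>x. I = {x} \<and> g x = - 1)"
  shows "\<exists>h\<in>nonneg_laurent_polys. (\<Sum>A | A \<subseteq> {1..N} - I \<and> even (card A + r).
     fls_X_intpow (\<Sum>b\<in>A. 2 * t * (\<Sum>a\<in>{1..<b}. g a))) = q_two (N - 3) * h"
proof -
  define U where "U = {1..N} - I"
  define m where "m b = (\<Sum>a\<in>{1..<b}. g a)" for b
  have finU: "finite U" by (simp add: U_def)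
  have "\<exists>U'\<subseteq>U. card U' = N - 2 \<and> (\<forall>b\<in>U'. m b = int (card {a \<in> U'. a < b}))"
    using gI
  proof (elim disjE exE conjE)
    fix x y assume xy: "x \<noteq> y" "I = {x, y}" "g x = 0" "g y = 0"
    have "card U = N - 2" using I xy by (simp add: U_def card_Diff_subset)
    moreover have "m b = int (card {a \<in> U. a < b})" if b: "b \<in> U" for b
    proof -
      have "m b = (\<Sum>a\<in>{a \<in> U. a < b}. g a)" unfolding m_def
        using b xy by (intro sum.mono_neutral_right) (auto simp: U_def)
      also have "\<dots> = (\<Sum>a\<in>{a \<in> U. a < b}. 1)" using g1 by (intro sum.cong) (auto simp: U_def)
      finally show ?thesis by simp
    qed
    ultimately show ?thesis by blast
  next
    fix x assume x: "I = {x}" "g x = - 1"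
    \<comment> \<open>\<open>b'\<close> is adjacent to \<open>x\<close>, so no third color separates
      them, and the \<open>1\<close> of \<open>b'\<close> cancels the \<open>-1\<close> of
      \<open>x\<close> in \<open>m b\<close> for every other \<open>b\<close>. If
      \<open>x = 1\<close>, the neighbor \<open>2\<close> exists because
      \<open>N \<ge> 3\<close>.\<close>
    define b' where "b' = (if x = 1 then 2 else x - 1)"
    have xN: "1 \<le> x" "x \<le> N" using I x by auto
    have b': "b' \<in> U" "b' \<noteq> x" using xN N x by (auto simp: b'_def U_def)
    have "card U = N - 1" using I x by (simp add: U_def card_Diff_subset)
    hence "card (U - {b'}) = N - 2" using b' finU by simp
    moreover have "m b = int (card {a \<in> U - {b'}. a < b})" if b: "b \<in> U - {b'}" for b
    proof -
      let ?R = "{a \<in> U - {b'}. a < b}"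
      have iff: "x < b \<longleftrightarrow> b' < b" using b b' xN x by (auto simp: b'_def U_def split: if_splits)
      have "{1..<b} = ?R \<union> (if x < b then {x, b'} else {})"
        using b b' xN x iff by (auto simp: U_def)
      hence "m b = (\<Sum>a\<in>?R \<union> (if x < b then {x, b'} else {}). g a)" by (simp add: m_def)
      also have "\<dots> = (\<Sum>a\<in>?R. g a) + (\<Sum>a\<in>(if x < b then {x, b'} else {}). g a)"
        using finU x by (intro sum.union_disjoint) (auto simp: U_def)
      also have "(\<Sum>a\<in>(if x < b then {x, b'} else {}). g a) = 0"
        using x b'(2) g1[of b'] by simp
      also have "(\<Sum>a\<in>?R. g a) = (\<Sum>a\<in>?R. 1)" using g1 by (intro sum.cong) (auto simp: U_def)
      finally show ?thesis by simp
    qed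
    ultimately show ?thesis by blast
  qed
  then obtain U' where U': "U' \<subseteq> U" "card U' = N - 2" and m: "\<And>b. b \<in> U' \<Longrightarrow> m b = int (card {a \<in> U'. a < b})"
    by blast
  let ?rk = "\<lambda>b. card {a \<in> U'. a < b}"
  have finU': "finite U'" using U'(1) finU finite_subset by blast
  have bij: "bij_betw ?rk U' {..<N - 2}" using bij_betw_rank[OF finU'] U'(2) by simp
  \<comment> \<open>\<open>N \<ge> 3\<close> makes \<open>U'\<close> nonempty. Its least element has
    exponent \<open>0\<close>, hence weight \<open>1\<close>, and takes care of the parity.\<close>
  have "0 \<in> ?rk ` U'" unfolding bij_betw_imp_surj_on[OF bij] using N by simp
  then obtain b0 where b0: "b0 \<in> U'" "?rk b0 = 0" by (elim imageE) simp
  define w :: "nat \<Rightarrow> rat fls" where "w b = fls_X_intpow (2 * t * m b)" for b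
  have "w b0 = 1" using m[OF b0(1)] b0(2) by (simp add: w_def)
  have "(\<Sum>A | A \<subseteq> U \<and> even (card A + r). fls_X_intpow (\<Sum>b\<in>A. 2 * t * m b)) =
    (\<Sum>A | A \<subseteq> U \<and> even (card A + r). \<Prod>b\<in>A. w b)"
    unfolding w_def by (simp only: fls_X_intpow_sum)
  also have "\<dots> = (\<Prod>b\<in>U - {b0}. 1 + w b)"
    by (rule sum_parity_subsets[where w = w]) (use finU b0 U' \<open>w b0 = 1\<close> in auto)
  \<comment> \<open>By construction \<open>U - U'\<close> is empty or \<open>{b'}\<close>. Its
    factor has nonnegative coefficients and becomes part of the cofactor.\<close>
  also have "U - {b0} = (U' - {b0}) \<union> (U - U')" using b0 U' by blast
  also have "(\<Prod>b\<in>(U' - {b0}) \<union> (U - U'). 1 + w b) = (\<Prod>b\<in>U' - {b0}. 1 + w b) * (\<Prod>b\<in>U - U'. 1 + w b)"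
    using finU finU' by (intro prod.union_disjoint) auto
  also have "(\<Prod>b\<in>U' - {b0}. 1 + w b) = (\<Prod>b\<in>U' - {b0}. 1 + fls_X_intpow (2 * t * int (?rk b)))"
    using m by (intro prod.cong) (auto simp: w_def)
  also have "\<dots> = (\<Prod>i\<in>{1..N - 3}. 1 + fls_X_intpow (2 * t * int i))"
  proof (rule prod.reindex_bij_betw)
    have "bij_betw ?rk (U' - {b0}) ({..<N - 2} - {?rk b0})"
      using bij b0(1) by (intro bij_betw_DiffI) (auto simp: bij_betw_def)
    moreover have "{..<N - 2} - {?rk b0} = {1..N - 3}" unfolding b0(2) using N by auto
    ultimately show "bij_betw ?rk (U' - {b0}) {1..N - 3}" by simp
  qed
  finally have S: "(\<Sum>A | A \<subseteq> U \<and> even (card A + r). fls_X_intpow (\<Sum>b\<in>A. 2 * t * m b)) =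
    (\<Prod>i\<in>{1..N - 3}. 1 + fls_X_intpow (2 * t * int i)) * (\<Prod>b\<in>U - U'. 1 + w b)" .
  obtain k where k: "(\<Prod>i=1..N - 3. 1 + fls_X_intpow (2 * t * int i)) = q_two (N - 3) * fls_X_intpow k"
    using factor_q_two[OF t] .
  show ?thesis
  proof (rule bexI)
    show "(\<Sum>A | A \<subseteq> {1..N} - I \<and> even (card A + r). fls_X_intpow (\<Sum>b\<in>A. 2 * t * (\<Sum>a\<in>{1..<b}. g a)))
       = q_two (N - 3) * (fls_X_intpow k * (\<Prod>b\<in>U - U'. 1 + w b))"
      using S unfolding k U_def m_def by (simp only: mult.assoc)
    show "fls_X_intpow k * (\<Prod>b\<in>U - U'. 1 + w b) \<in> nonneg_laurent_polys"
      unfolding w_def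
      by (intro nonneg_laurent_polys_times nonneg_laurent_polys_X nonneg_laurent_polys_prod
          nonneg_laurent_polys_add nonneg_laurent_polys_1)
  qed
qed

section \<open>Summing over the colors of the squares\<close>

context squared_web
begin

text \<open>Keeps the involved colors of \<open>c\<close> on each side and replaces the uninvolved
  ones by one set \<open>T v\<close>, the same for all sides at \<open>v\<close>. Off the web the
  value is \<open>undefined\<close>, as extensionality demands.\<close>

definition recolor :: "(curve \<Rightarrow> nat set) \<Rightarrow> (complex \<Rightarrow> nat set) \<Rightarrow> curve \<Rightarrow> nat set" where
  "recolor c T e = (if e \<in> vect W then c e
     else if e \<in> spin W then let v = (THE v. v \<in> V \<and> e \<in> set (sq v)) in (c e \<inter> involved c v) \<union> T v
     else undefined)"

lemma recolor_vect: "e \<in> vect W \<Longrightarrow> recolor c T e = c e"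
  by (simp add: recolor_def)

lemma recolor_side:
  assumes "v \<in> V" "s \<in> set (sq v)"
  shows "recolor c T s = (c s \<inter> involved c v) \<union> T v"
proof -
  have "(THE v. v \<in> V \<and> s \<in> set (sq v)) = v"
    by (rule the_equality) (use assms disjoint in blast)+
  thus ?thesis using sq_spin[OF assms] sq_not_vect[OF assms] by (simp add: recolor_def)
qed

lemma recolor_outside: "e \<notin> E \<Longrightarrow> recolor c T e = undefined"
  by (simp add: recolor_def)

lemma involved_recolor: "v \<in> V \<Longrightarrow> involved (recolor c T) v = involved c v"
  by (rule involved_cong) (simp_all add: recolor_vect)

lemma flow_coloring_recolor:
  assumes F: "flow_coloring W d c" and T: "\<And>v. v \<in> V \<Longrightarrow> T v \<inter> involved c v = {}"
  shows "flow_coloring W d (recolor c T)"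
  unfolding flow_coloring_iff
proof (intro conjI ballI impI)
  show "\<exists>a. recolor c T e = {a}" if "e \<in> vect W" for e
    using F that recolor_vect unfolding flow_coloring_iff by metis
  fix f g assume fg: "f \<in> spin W" "g \<in> spin W" "pathfinish f = pathstart g"
  let ?x = "color_at c (pathstart g)"
  obtain v where v: "v \<in> V" "g \<in> set (sq v)" using fg(2) spin_eq by blast
  have f: "f \<in> set (sq v)" using same_square[OF v(1) fg] v(2) by simp
  have ca: "color_at (recolor c T) (pathstart g) = ?x"
    using color_at_cong[OF corner_verts[OF v]] recolor_vect by metis
  have x: "?x \<in> involved c v" "?x \<notin> T v" using color_at_involved[OF v(2)] T[OF v(1)] by blast+
  have "if inward d (pathstart g) then ?x \<notin> c f \<and> c g = insert ?x (c f) else ?x \<notin> c g \<and> c f = insert ?x (c g)"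
    using F fg unfolding flow_coloring_iff by blast
  thus "if inward d (pathstart g)
       then color_at (recolor c T) (pathstart g) \<notin> recolor c T f \<and>
         recolor c T g = insert (color_at (recolor c T) (pathstart g)) (recolor c T f)
       else color_at (recolor c T) (pathstart g) \<notin> recolor c T g \<and>
         recolor c T f = insert (color_at (recolor c T) (pathstart g)) (recolor c T g)"
    unfolding ca recolor_side[OF v(1) f] recolor_side[OF v] using x by (auto split: if_splits)
qed

text \<open>The sign of \<open>a\<close> made independent of \<open>T\<close>: an uninvolved color
  lies on all sides or on none, and \<open>side_sign\<close> is \<open>1\<close> either way.\<close>

definition vertex_sign :: "(curve \<Rightarrow> nat set) \<Rightarrow> complex \<Rightarrow> nat \<Rightarrow> int" where
  "vertex_sign c v a = (if a \<in> involved c v then side_sign (sq v) {s \<in> set (sq v). a \<in> c s} else 1)"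

lemma side_sign_recolor:
  assumes "v \<in> V" "T v \<inter> involved c v = {}"
  shows "side_sign (sq v) {s \<in> set (sq v). a \<in> recolor c T s} = vertex_sign c v a"
proof (cases "a \<in> involved c v")
  case True
  have "{s \<in> set (sq v). a \<in> recolor c T s} = {s \<in> set (sq v). a \<in> c s}"
    using recolor_side[OF assms(1)] True assms(2) by auto
  thus ?thesis using True by (simp add: vertex_sign_def)
next
  case False
  have "{s \<in> set (sq v). a \<in> recolor c T s} = (if a \<in> T v then set (sq v) else {})"
    using recolor_side[OF assms(1)] False by auto
  thus ?thesis using False by (simp add: vertex_sign_def side_sign_def)
qed

definition weight :: "(curve \<Rightarrow> nat set) \<Rightarrow> complex \<Rightarrow> nat \<Rightarrow> int" where
  "weight c v b = 2 * turn (set (sq v)) * (\<Sum>a\<in>{1..<b}. vertex_sign c v a)"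

text \<open>Colors are added one at a time, by induction on the set of pairs \<open>(v, b)\<close>.
  By \<open>side_sign_recolor\<close> each increment is independent of what was added before, so the
  increments simply add up.\<close>

lemma degree_recolor:
  assumes F: "flow_coloring W d c" and T: "\<And>v. v \<in> V \<Longrightarrow> T v \<subseteq> {1..N} - involved c v"
  shows "degree_of N W d (recolor c T) =
    degree_of N W d (recolor c (\<lambda>_. {})) + (\<Sum>v\<in>V. \<Sum>b\<in>T v. weight c v b)"
proof -
  have gen: "degree_of N W d (recolor c (\<lambda>v. {b. (v, b) \<in> P})) =
    degree_of N W d (recolor c (\<lambda>_. {})) + (\<Sum>(v, b)\<in>P. weight c v b)"
    if "finite P" "P \<subseteq> Sigma V (\<lambda>v. {1..N} - involved c v)" for P
    using that
  proof (induction P rule: finite_induct)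
    case empty thus ?case by simp
  next
    case (insert vb P)
    obtain v b where vb: "vb = (v, b)" by (cases vb)
    let ?T = "\<lambda>v. {b. (v, b) \<in> P}" and ?T' = "\<lambda>u. {a. (u, a) \<in> insert vb P}"
    have v: "v \<in> V" and b: "b \<in> {1..N}" "b \<notin> involved c v" using insert.prems vb by auto
    have disj: "?T u \<inter> involved c u = {}" if "u \<in> V" for u using insert.prems by auto
    have F': "flow_coloring W d (recolor c ?T)" by (rule flow_coloring_recolor[OF F disj])
    have nb: "b \<notin> recolor c ?T s" if "s \<in> set (sq v)" for s
      using recolor_side[OF v that] b(2) insert.hyps(2) vb by simp
    have "recolor c ?T' = add_color v b (recolor c ?T)"
    proof
      fix e
      consider "e \<in> vect W" | u where "u \<in> V" "e \<in> set (sq u)" | "e \<notin> E" using spin_eq by blast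
      thus "recolor c ?T' e = add_color v b (recolor c ?T) e"
      proof cases
        case 1
        thus ?thesis using sq_not_vect[OF v] by (auto simp: add_color_def recolor_vect)
      next
        case (2 u)
        have "e \<in> set (sq v) \<longleftrightarrow> u = v" using disjoint[OF v 2(1)] 2 by blast
        thus ?thesis using recolor_side[OF 2] vb by (auto simp: add_color_def)
      next
        case 3
        hence "e \<notin> set (sq v)" using sq_spin[OF v] by blast
        thus ?thesis using 3 by (simp add: add_color_def recolor_outside)
      qed
    qed
    moreover have "(\<Sum>a\<in>{1..<b}. side_sign (sq v) {s \<in> set (sq v). a \<in> recolor c ?T s}) =
       (\<Sum>a\<in>{1..<b}. vertex_sign c v a)"
      using side_sign_recolor[of v ?T c, OF v disj[OF v]] by simp
    ultimately have "degree_of N W d (recolor c ?T') = degree_of N W d (recolor c ?T) + weight c v b"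
      using degree_add_color[OF F' v _ nb b(1)] b(2) involved_recolor[OF v] by (simp add: weight_def)
    thus ?case using insert vb by simp
  qed
  have fT: "finite (T v)" if "v \<in> V" for v using T[OF that] finite_subset by blast
  have "recolor c T = recolor c (\<lambda>v. {b. (v, b) \<in> Sigma V T})"
  proof
    fix e
    consider "e \<in> vect W" | u where "u \<in> V" "e \<in> set (sq u)" | "e \<notin> E" using spin_eq by blast
    thus "recolor c T e = recolor c (\<lambda>v. {b. (v, b) \<in> Sigma V T}) e"
      by cases (simp_all add: recolor_vect recolor_outside recolor_side)
  qed
  moreover have "Sigma V T \<subseteq> Sigma V (\<lambda>v. {1..N} - involved c v)" using T by blast
  moreover have "finite (Sigma V T)" using finite_V fT by blast
  ultimately have "degree_of N W d (recolor c T) =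
    degree_of N W d (recolor c (\<lambda>_. {})) + (\<Sum>(v, b)\<in>Sigma V T. weight c v b)"
    using gen[of "Sigma V T"] by simp
  thus ?thesis using finite_V fT by (simp add: sum.Sigma)
qed

text \<open>Propositional core of \<open>vertex_types\<close>: \<open>m0\<close> to
  \<open>m3\<close> say whether a color lies on the respective side, \<open>b0\<close> to
  \<open>b3\<close> whether it is the color of the corner where that side starts. Around the square
  the number of flips is even, and a color flips at all four corners exactly if it
  alternates.\<close>

lemma side_toggles:
  assumes "m0 \<longleftrightarrow> m1 \<noteq> b1" "m1 \<longleftrightarrow> m2 \<noteq> b2" "m2 \<longleftrightarrow> m3 \<noteq> b3" "m3 \<longleftrightarrow> m0 \<noteq> b0"
  shows "(b0 \<noteq> b1) \<longleftrightarrow> (b2 \<noteq> b3)"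
    "b0 \<or> b1 \<or> b2 \<or> b3 \<Longrightarrow>
      (if (m0 \<longleftrightarrow> m1) \<and> (m1 \<longleftrightarrow> m2) \<and> (m2 \<longleftrightarrow> m3) then 1
       else if (m0 \<longleftrightarrow> \<not> m1) \<and> (m1 \<longleftrightarrow> \<not> m2) \<and> (m2 \<longleftrightarrow> \<not> m3) then - 1 else 0) =
      (if b0 \<and> b1 \<and> b2 \<and> b3 then - 1 else 0 :: int)"
proof -
  have b: "b1 \<longleftrightarrow> m0 \<noteq> m1" "b2 \<longleftrightarrow> m1 \<noteq> m2" "b3 \<longleftrightarrow> m2 \<noteq> m3" "b0 \<longleftrightarrow> m3 \<noteq> m0"
    using assms by blast+
  show "(b0 \<noteq> b1) \<longleftrightarrow> (b2 \<noteq> b3)" unfolding b by blast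
  show "b0 \<or> b1 \<or> b2 \<or> b3 \<Longrightarrow>
      (if (m0 \<longleftrightarrow> m1) \<and> (m1 \<longleftrightarrow> m2) \<and> (m2 \<longleftrightarrow> m3) then 1
       else if (m0 \<longleftrightarrow> \<not> m1) \<and> (m1 \<longleftrightarrow> \<not> m2) \<and> (m2 \<longleftrightarrow> \<not> m3) then - 1 else 0) =
      (if b0 \<and> b1 \<and> b2 \<and> b3 then - 1 else 0 :: int)"
    unfolding b by (cases m0; cases m1; cases m2; cases m3) simp_all
qed

text \<open>Going around the square, a color flips an even number of times, so it occurs at an even
  number of corners. Hence the corners carry two colors twice each or one color four times.\<close>

lemma vertex_types:
  assumes F: "flow_coloring W d c" and v: "v \<in> V"
  shows "(\<exists>x y. x \<noteq> y \<and> involved c v = {x, y} \<and> vertex_sign c v x = 0 \<and> vertex_sign c v y = 0) \<or>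
    (\<exists>x. involved c v = {x} \<and> vertex_sign c v x = - 1)"
proof -
  obtain s0 s1 s2 s3 where l: "sq v = [s0, s1, s2, s3]"
    using sq_props(2)[OF v] by (auto simp: length_Suc_conv eval_nat_numeral)
  have e: "pathfinish s0 = pathstart s1" "pathfinish s1 = pathstart s2"
    "pathfinish s2 = pathstart s3" "pathfinish s3 = pathstart s0"
    using closed_chain_Suc[OF sq_props(1)[OF v], of 0] closed_chain_Suc[OF sq_props(1)[OF v], of 1]
      closed_chain_Suc[OF sq_props(1)[OF v], of 2] closed_chain_last[OF sq_props(1)[OF v]] by (auto simp: l)
  define x0 x1 x2 x3 where x: "x0 = color_at c (pathstart s0)" "x1 = color_at c (pathstart s1)"
    "x2 = color_at c (pathstart s2)" "x3 = color_at c (pathstart s3)"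
  have I: "involved c v = {x0, x1, x2, x3}" by (simp add: involved_def corners_def l x)
  have d: "s0 \<noteq> s1" "s0 \<noteq> s2" "s0 \<noteq> s3" "s1 \<noteq> s2" "s1 \<noteq> s3" "s2 \<noteq> s3"
    using sq_props(3)[OF v] by (auto simp: l)
  have m: "s0 \<in> set (sq v)" "s1 \<in> set (sq v)" "s2 \<in> set (sq v)" "s3 \<in> set (sq v)"
    by (simp_all add: l)
  have step: "a \<in> c s0 \<longleftrightarrow> (a \<in> c s1) \<noteq> (a = x1)" "a \<in> c s1 \<longleftrightarrow> (a \<in> c s2) \<noteq> (a = x2)"
    "a \<in> c s2 \<longleftrightarrow> (a \<in> c s3) \<noteq> (a = x3)" "a \<in> c s3 \<longleftrightarrow> (a \<in> c s0) \<noteq> (a = x0)" for a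
    unfolding x
    by (rule flow_step(1)[OF F v m(1,2) e(1)], rule flow_step(1)[OF F v m(2,3) e(2)],
        rule flow_step(1)[OF F v m(3,4) e(3)], rule flow_step(1)[OF F v m(4,1) e(4)])
  have sign: "side_sign (sq v) {s \<in> set (sq v). a \<in> c s} =
    (if (a \<in> c s0 \<longleftrightarrow> a \<in> c s1) \<and> (a \<in> c s1 \<longleftrightarrow> a \<in> c s2) \<and> (a \<in> c s2 \<longleftrightarrow> a \<in> c s3) then 1
     else if (a \<in> c s0 \<longleftrightarrow> a \<notin> c s1) \<and> (a \<in> c s1 \<longleftrightarrow> a \<notin> c s2) \<and> (a \<in> c s2 \<longleftrightarrow> a \<notin> c s3) then - 1 else 0)" for a
  proof -
    let ?A = "{s \<in> set (sq v). a \<in> c s}"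
    have e12: "?A = {} \<longleftrightarrow> a \<notin> c s0 \<and> a \<notin> c s1 \<and> a \<notin> c s2 \<and> a \<notin> c s3"
      "?A = set (sq v) \<longleftrightarrow> a \<in> c s0 \<and> a \<in> c s1 \<and> a \<in> c s2 \<and> a \<in> c s3"
      by (auto simp: l)
    have e3: "?A = {sq v ! 0, sq v ! 2} \<longleftrightarrow> a \<in> c s0 \<and> a \<notin> c s1 \<and> a \<in> c s2 \<and> a \<notin> c s3"
    proof
      assume *: "?A = {sq v ! 0, sq v ! 2}"
      have "s \<in> ?A \<longleftrightarrow> s = s0 \<or> s = s2" for s unfolding * by (simp add: l)
      from this[of s0] this[of s1] this[of s2] this[of s3] d
      show "a \<in> c s0 \<and> a \<notin> c s1 \<and> a \<in> c s2 \<and> a \<notin> c s3" by (simp add: l)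
    qed (auto simp: l)
    have e4: "?A = {sq v ! 1, sq v ! 3} \<longleftrightarrow> a \<notin> c s0 \<and> a \<in> c s1 \<and> a \<notin> c s2 \<and> a \<in> c s3"
    proof
      assume *: "?A = {sq v ! 1, sq v ! 3}"
      have "s \<in> ?A \<longleftrightarrow> s = s1 \<or> s = s3" for s unfolding * by (simp add: l)
      from this[of s0] this[of s1] this[of s2] this[of s3] d
      show "a \<notin> c s0 \<and> a \<in> c s1 \<and> a \<notin> c s2 \<and> a \<in> c s3" by (simp add: l)
    qed (auto simp: l)
    show ?thesis unfolding side_sign_def e12 e3 e4
      by (cases "a \<in> c s0"; cases "a \<in> c s1"; cases "a \<in> c s2"; cases "a \<in> c s3"; simp)
  qed
  have sign': "vertex_sign c v a = (if a = x0 \<and> a = x1 \<and> a = x2 \<and> a = x3 then - 1 else 0)"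
    if "a \<in> involved c v" for a
  proof -
    have "a = x0 \<or> a = x1 \<or> a = x2 \<or> a = x3" using that I by auto
    from side_toggles(2)[OF step this] show ?thesis unfolding vertex_sign_def sign using that by simp
  qed
  have par: "((a = x0) \<noteq> (a = x1)) \<longleftrightarrow> ((a = x2) \<noteq> (a = x3))" for a
    using side_toggles(1)[OF step] .
  have "x0 = x1 \<and> x2 = x3 \<or> x0 = x2 \<and> x1 = x3 \<or> x0 = x3 \<and> x1 = x2"
  proof (cases "x0 = x1")
    case True
    thus ?thesis using par[of x2] by simp
  next
    case False
    thus ?thesis using par[of x0] par[of x1] by (cases "x0 = x2") auto
  qed
  \<comment> \<open>The case of a single color is included as \<open>x = y\<close>.\<close>
  hence "\<exists>x y. involved c v = {x, y} \<and> (x = y \<longrightarrow> x0 = x \<and> x1 = x \<and> x2 = x \<and> x3 = x)"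
  proof (elim disjE conjE)
    assume "x0 = x1" "x2 = x3"
    thus ?thesis unfolding I by (intro exI[of _ x0] exI[of _ x2]) auto
  next
    assume "x0 = x2" "x1 = x3"
    thus ?thesis unfolding I by (intro exI[of _ x0] exI[of _ x1]) auto
  next
    assume "x0 = x3" "x1 = x2"
    thus ?thesis unfolding I by (intro exI[of _ x0] exI[of _ x1]) auto
  qed
  then obtain x y where xy: "involved c v = {x, y}" "x = y \<longrightarrow> x0 = x \<and> x1 = x \<and> x2 = x \<and> x3 = x" by blast
  show ?thesis
  proof (cases "x = y")
    case True
    have "x \<in> involved c v" using xy(1) by simp
    from sign'[OF this] have "vertex_sign c v x = - 1" using xy(2) True by simp
    moreover have "involved c v = {x}" using xy(1) True by simp
    ultimately show ?thesis by blast
  next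
    case False
    have "x \<in> {x0, x1, x2, x3}" "y \<in> {x0, x1, x2, x3}" using xy(1) I by auto
    hence n: "\<not> (a = x0 \<and> a = x1 \<and> a = x2 \<and> a = x3)" for a using False by blast
    have "x \<in> involved c v" "y \<in> involved c v" using xy(1) by simp_all
    from this[THEN sign'] have "vertex_sign c v x = 0" "vertex_sign c v y = 0"
      using n[of x] n[of y] by (simp_all only: if_False)
    thus ?thesis using False xy(1) by blast
  qed
qed

lemma colorings_iff:
  "(d, c) \<in> colorings N W \<longleftrightarrow> d \<in> vect W \<rightarrow>\<^sub>E UNIV \<and> c \<in> E \<rightarrow>\<^sub>E Pow {1..N} \<and>
    (\<forall>e\<in>spin_even W. even (card (c e))) \<and> (\<forall>e\<in>spin_odd W. odd (card (c e))) \<and> flow_coloring W d c"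
  unfolding colorings_def flow_coloring_def mem_Collect_eq case_prod_conv One_nat_def card_1_singleton_iff
  by (rule iffI; elim conjE; intro conjI; assumption)

text \<open>The involved colors on the sides are fixed by the vectorial data
  (\<open>involved_determined\<close>), and the others form a set common to all four sides
  (\<open>uninvolved_const\<close>). This set is free up to parity; one condition per square
  suffices because the uninvolved part of \<open>c\<close> is also the same on all sides.\<close>

lemma colorings_same_vect:
  assumes c: "(d, c) \<in> colorings N W"
  defines "B \<equiv> \<lambda>v. {A. A \<subseteq> {1..N} - involved c v \<and> even (card A + card (c (sq v ! 0) - involved c v))}"
  shows "bij_betw (\<lambda>T. (d, recolor c T)) (PiE V B)
    {x \<in> colorings N W. fst x = d \<and> restrict (snd x) (vect W) = restrict c (vect W)}"
proof -
  have C: "d \<in> vect W \<rightarrow>\<^sub>E UNIV" "c \<in> E \<rightarrow>\<^sub>E Pow {1..N}" "\<forall>e\<in>spin_even W. even (card (c e))"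
    "\<forall>e\<in>spin_odd W. odd (card (c e))" "flow_coloring W d c" using c unfolding colorings_iff by blast+
  have sub: "c e \<subseteq> {1..N}" if "e \<in> E" for e using C(2) that by blast
  have const: "c' s - involved c v = c' (sq v ! 0) - involved c v"
    if "flow_coloring W d c'" "v \<in> V" "s \<in> set (sq v)" "involved c' v = involved c v" for c' v s
    using uninvolved_const[OF that(1,2) _ that(3) sq_props(5)[OF that(2), of 0]] that(4) by auto
  have card: "even (card (X s)) \<longleftrightarrow> (even (card (c s)) \<longleftrightarrow> even (card T + card (c (sq v ! 0) - involved c v)))"
    if v: "v \<in> V" "s \<in> set (sq v)" and X: "X s = (c s \<inter> involved c v) \<union> T" "T \<subseteq> {1..N} - involved c v" for X v s T
  proof -
    have fin: "finite (c s)" "finite T" using sub[of s] sq_spin[OF v] X(2) finite_subset by blast+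
    have "card (X s) = card (c s \<inter> involved c v) + card T"
      unfolding X(1) using fin X(2) by (intro card_Un_disjoint) auto
    moreover have "card (c s) = card (c s \<inter> involved c v) + card (c s - involved c v)"
      using card_Int_Diff[OF fin(1)] .
    ultimately show ?thesis using const[OF C(5) v refl] by auto
  qed
  show ?thesis
  proof (rule bij_betw_imageI)
    show "inj_on (\<lambda>T. (d, recolor c T)) (PiE V B)"
    proof (rule inj_onI)
      fix T T' assume T: "T \<in> PiE V B" "T' \<in> PiE V B" and eq: "(d, recolor c T) = (d, recolor c T')"
      show "T = T'"
      proof (rule PiE_ext[OF T])
        fix v assume v: "v \<in> V"
        let ?s = "sq v ! 0"
        have s: "?s \<in> set (sq v)" using sq_props(5)[OF v, of 0] by simp
        have "T v \<inter> involved c v = {}" using PiE_mem[OF T(1) v] by (auto simp: B_def)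
        hence 1: "T v = recolor c T ?s - involved c v" unfolding recolor_side[OF v s] by blast
        have "T' v \<inter> involved c v = {}" using PiE_mem[OF T(2) v] by (auto simp: B_def)
        hence "T' v = recolor c T' ?s - involved c v" unfolding recolor_side[OF v s] by blast
        with 1 eq show "T v = T' v" by simp
      qed
    qed
    show "(\<lambda>T. (d, recolor c T)) ` PiE V B = {x \<in> colorings N W. fst x = d \<and> restrict (snd x) (vect W) = restrict c (vect W)}"
    proof (intro set_eqI iffI)
      fix x assume "x \<in> (\<lambda>T. (d, recolor c T)) ` PiE V B"
      then obtain T where T: "T \<in> PiE V B" and x: "x = (d, recolor c T)" by blast
      have Tv: "T v \<subseteq> {1..N} - involved c v" "even (card (T v) + card (c (sq v ! 0) - involved c v))"
        if "v \<in> V" for v using PiE_mem[OF T that] by (auto simp: B_def)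
      have par: "even (card (recolor c T s)) \<longleftrightarrow> even (card (c s))" if "v \<in> V" "s \<in> set (sq v)" for v s
        using card[where X = "recolor c T", OF that recolor_side[OF that] Tv(1)[OF that(1)]] Tv(2)[OF that(1)] by simp
      have par': "even (card (recolor c T s)) \<longleftrightarrow> even (card (c s))" if "s \<in> spin W" for s
        using that par unfolding spin_eq by blast
      have "(d, recolor c T) \<in> colorings N W" unfolding colorings_iff
      proof (intro conjI ballI)
        show "recolor c T \<in> E \<rightarrow>\<^sub>E Pow {1..N}"
        proof (rule PiE_I)
          fix e assume "e \<in> E"
          then consider "e \<in> vect W" | v where "v \<in> V" "e \<in> set (sq v)" using spin_eq by blast
          thus "recolor c T e \<in> Pow {1..N}"
          proof cases
            case 1 thus ?thesis using sub[of e] by (simp add: recolor_vect)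
          next
            case (2 v) thus ?thesis using recolor_side[OF 2] Tv(1)[OF 2(1)] sub[OF \<open>e \<in> E\<close>] by auto
          qed
        qed (simp add: recolor_outside)
        show "flow_coloring W d (recolor c T)" using flow_coloring_recolor[OF C(5), of T] Tv(1) by blast
        show "even (card (recolor c T e))" if "e \<in> spin_even W" for e
          using C(3) that par'[of e] by (simp add: spin_def)
        show "odd (card (recolor c T e))" if "e \<in> spin_odd W" for e
          using C(4) that par'[of e] by (simp add: spin_def)
      qed (rule C(1))
      moreover have "restrict (recolor c T) (vect W) = restrict c (vect W)"
        by (rule restrict_ext) (simp add: recolor_vect)
      ultimately show "x \<in> {x \<in> colorings N W. fst x = d \<and> restrict (snd x) (vect W) = restrict c (vect W)}"
        unfolding x by simp
    next
      fix x assume "x \<in> {x \<in> colorings N W. fst x = d \<and> restrict (snd x) (vect W) = restrict c (vect W)}"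
      then obtain c' where x: "x = (d, c')" and c': "(d, c') \<in> colorings N W"
        and "restrict c' (vect W) = restrict c (vect W)" by (cases x) auto
      hence eq: "c' e = c e" if "e \<in> vect W" for e using that by (metis restrict_apply')
      have C': "c' \<in> E \<rightarrow>\<^sub>E Pow {1..N}" "\<forall>e\<in>spin_even W. even (card (c' e))"
        "\<forall>e\<in>spin_odd W. odd (card (c' e))" "flow_coloring W d c'" using c' unfolding colorings_iff by blast+
      define T where "T = restrict (\<lambda>v. c' (sq v ! 0) - involved c v) V"
      have Tv: "T v = c' (sq v ! 0) - involved c v" if "v \<in> V" for v using that by (simp add: T_def)
      have inv: "involved c' v = involved c v" if "v \<in> V" for v using involved_cong[OF that eq] by simp
      have side: "c' s = (c s \<inter> involved c v) \<union> T v" if v: "v \<in> V" "s \<in> set (sq v)" for v s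
      proof -
        have "c' s - involved c v = T v" using const[OF C'(4) v inv[OF v(1)]] Tv[OF v(1)] by simp
        moreover have "c' s \<inter> involved c v = c s \<inter> involved c v"
          using involved_determined[OF C(5) C'(4) v(1) eq[symmetric] _ v(2)] by blast
        ultimately show ?thesis by blast
      qed
      have Tsub: "T v \<subseteq> {1..N} - involved c v" if "v \<in> V" for v
        using C'(1) sq_spin[OF that sq_props(5)[OF that, of 0]] unfolding Tv[OF that] by auto
      have "T \<in> PiE V B"
      proof (rule PiE_I)
        fix v assume v: "v \<in> V"
        have s: "sq v ! 0 \<in> set (sq v)" "sq v ! 0 \<in> spin_even W" using sq_props(5)[OF v, of 0] v even_eq by auto
        have "even (card (T v) + card (c (sq v ! 0) - involved c v))"
          using card[where X = c', OF v s(1) side[OF v s(1)] Tsub[OF v]] C(3) C'(2) s(2) by blast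
        thus "T v \<in> B v" using Tsub[OF v] by (simp add: B_def)
      qed (simp add: T_def)
      moreover have "c' = recolor c T"
      proof
        fix e
        consider "e \<in> vect W" | v where "v \<in> V" "e \<in> set (sq v)" | "e \<notin> E" using spin_eq by blast
        thus "c' e = recolor c T e"
        proof cases
          case 1 thus ?thesis by (simp add: recolor_vect eq)
        next
          case (2 v) thus ?thesis using side[OF 2] recolor_side[OF 2] by simp
        next
          case 3 thus ?thesis using PiE_arb[OF C'(1)] by (simp add: recolor_outside)
        qed
      qed
      ultimately show "x \<in> (\<lambda>T. (d, recolor c T)) ` PiE V B" unfolding x by blast
    qed
  qed
qed

text \<open>The bijection gives a sum over functions \<open>T\<close> of products over the vertices.
  By distributivity this is a product of vertex sums, to each of which
  \<open>sum_vertex_divisible\<close> applies.\<close>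

lemma sum_colorings_same_vect:
  assumes N: "N \<ge> 3" and c: "(d, c) \<in> colorings N W"
  shows "\<exists>h\<in>nonneg_laurent_polys.
    (\<Sum>x | x \<in> colorings N W \<and> fst x = d \<and> restrict (snd x) (vect W) = restrict c (vect W).
       fls_X_intpow (degree_of N W (fst x) (snd x))) = q_two (N - 3) ^ card V * h"
proof -
  define B where "B v = {A. A \<subseteq> {1..N} - involved c v \<and> even (card A + card (c (sq v ! 0) - involved c v))}" for v
  have C: "c \<in> E \<rightarrow>\<^sub>E Pow {1..N}" and F: "flow_coloring W d c" using c unfolding colorings_iff by blast+
  let ?X = "fls_X_intpow (degree_of N W d (recolor c (\<lambda>_. {}))) :: rat fls"
  have "\<exists>h\<in>nonneg_laurent_polys. (\<Sum>A\<in>B v. fls_X_intpow (\<Sum>b\<in>A. weight c v b)) = q_two (N - 3) * h"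
    if v: "v \<in> V" for v
  proof -
    have "involved c v \<subseteq> {1..N}"
    proof
      fix a assume "a \<in> involved c v"
      then obtain p where p: "p \<in> verts W" "a = color_at c p" using v verts_eq by (auto simp: involved_def)
      have "vedge p \<in> vect W" using vedge(1)[OF p(1)] .
      moreover from this obtain x where "c (vedge p) = {x}" using F unfolding flow_coloring_iff by blast
      moreover have "c (vedge p) \<in> Pow {1..N}" using C \<open>vedge p \<in> vect W\<close> by blast
      ultimately show "a \<in> {1..N}" using p(2) by (simp add: color_at_def)
    qed
    from sum_vertex_divisible[OF N this turn_cases _ vertex_types[OF F v]]
    show ?thesis unfolding B_def weight_def by (simp add: vertex_sign_def)
  qed
  then obtain h where h: "\<And>v. v \<in> V \<Longrightarrow> h v \<in> nonneg_laurent_polys"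
    "\<And>v. v \<in> V \<Longrightarrow> (\<Sum>A\<in>B v. fls_X_intpow (\<Sum>b\<in>A. weight c v b)) = q_two (N - 3) * h v" by metis
  have deg: "fls_X_intpow (degree_of N W d (recolor c T)) = ?X * (\<Prod>v\<in>V. fls_X_intpow (\<Sum>b\<in>T v. weight c v b))"
    if "T \<in> PiE V B" for T
  proof -
    have "T v \<subseteq> {1..N} - involved c v" if "v \<in> V" for v
      using PiE_mem[OF \<open>T \<in> PiE V B\<close> that] by (simp add: B_def)
    from degree_recolor[OF F this] show ?thesis by (simp only: fls_X_intpow_add fls_X_intpow_sum)
  qed
  have "(\<Sum>x | x \<in> colorings N W \<and> fst x = d \<and> restrict (snd x) (vect W) = restrict c (vect W).
       fls_X_intpow (degree_of N W (fst x) (snd x))) =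
     (\<Sum>T\<in>PiE V B. fls_X_intpow (degree_of N W d (recolor c T)))"
  proof -
    have bij: "bij_betw (\<lambda>T. (d, recolor c T)) (PiE V B)
      {x \<in> colorings N W. fst x = d \<and> restrict (snd x) (vect W) = restrict c (vect W)}"
      using colorings_same_vect[OF c] unfolding B_def[abs_def] .
    show ?thesis by (subst sum.reindex_bij_betw[OF bij, symmetric]) (simp only: fst_conv snd_conv)
  qed
  also have "\<dots> = (\<Sum>T\<in>PiE V B. ?X * (\<Prod>v\<in>V. fls_X_intpow (\<Sum>b\<in>T v. weight c v b)))"
    using deg by (rule sum.cong[OF refl])
  also have "\<dots> = ?X * (\<Sum>T\<in>PiE V B. \<Prod>v\<in>V. fls_X_intpow (\<Sum>b\<in>T v. weight c v b))"
    by (simp only: sum_distrib_left)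
  also have "(\<Sum>T\<in>PiE V B. \<Prod>v\<in>V. fls_X_intpow (\<Sum>b\<in>T v. weight c v b)) =
    (\<Prod>v\<in>V. \<Sum>A\<in>B v. fls_X_intpow (\<Sum>b\<in>A. weight c v b))"
    using finite_V by (intro prod_sum_PiE[symmetric]) (auto simp: B_def)
  also have "\<dots> = q_two (N - 3) ^ card V * (\<Prod>v\<in>V. h v)"
    using h(2) by (simp add: prod.distrib)
  finally have "(\<Sum>x | x \<in> colorings N W \<and> fst x = d \<and> restrict (snd x) (vect W) = restrict c (vect W).
       fls_X_intpow (degree_of N W (fst x) (snd x))) = q_two (N - 3) ^ card V * (?X * (\<Prod>v\<in>V. h v))"
    by (simp only: mult.left_commute)
  moreover have "?X * (\<Prod>v\<in>V. h v) \<in> nonneg_laurent_polys"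
    using h(1) by (intro nonneg_laurent_polys_times nonneg_laurent_polys_X nonneg_laurent_polys_prod)
  ultimately show ?thesis by blast
qed

lemma finite_colorings: "finite (colorings N W)"
proof (rule finite_subset)
  have "finite E" using plane_graphD(2)[OF web_plane_graph[OF web]] .
  thus "finite ((vect W \<rightarrow>\<^sub>E (UNIV :: bool set)) \<times> (E \<rightarrow>\<^sub>E Pow {1..N}))"
    by (intro finite_cartesian_product finite_PiE) auto
  show "colorings N W \<subseteq> (vect W \<rightarrow>\<^sub>E UNIV) \<times> (E \<rightarrow>\<^sub>E Pow {1..N})"
    unfolding colorings_def by blast
qed

text \<open>Colorings are grouped by their data on the vectorial edges. Every group contributes the
  same power of \<open>q_two (N - 3)\<close>, which can be taken out of the sum.\<close>

lemma web_eval_divisible: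
  assumes N: "N \<ge> 3"
  shows "\<exists>h\<in>nonneg_laurent_polys. web_eval N W = q_two (N - 3) ^ card V * h"
proof -
  let ?C = "colorings N W"
  let ?key = "\<lambda>x. (fst x, restrict (snd x) (vect W))"
  let ?f = "\<lambda>x. fls_X_intpow (degree_of N W (fst x) (snd x)) :: rat fls"
  have "\<forall>y\<in>?key ` ?C. \<exists>h. h \<in> nonneg_laurent_polys \<and>
    (\<Sum>x | x \<in> ?C \<and> ?key x = y. ?f x) = q_two (N - 3) ^ card V * h"
  proof
    fix y assume "y \<in> ?key ` ?C"
    then obtain d c where c: "(d, c) \<in> ?C" "y = (d, restrict c (vect W))" by auto
    from sum_colorings_same_vect[OF N c(1)] show "\<exists>h. h \<in> nonneg_laurent_polys \<and>
      (\<Sum>x | x \<in> ?C \<and> ?key x = y. ?f x) = q_two (N - 3) ^ card V * h" unfolding c(2) by (simp add: Bex_def)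
  qed
  from bchoice[OF this] obtain h where h: "\<forall>y\<in>?key ` ?C. h y \<in> nonneg_laurent_polys \<and>
    (\<Sum>x | x \<in> ?C \<and> ?key x = y. ?f x) = q_two (N - 3) ^ card V * h y" by (elim exE)
  have "web_eval N W = (\<Sum>x\<in>?C. ?f x)" by (simp add: web_eval_def case_prod_unfold)
  also have "\<dots> = (\<Sum>y\<in>?key ` ?C. \<Sum>x | x \<in> ?C \<and> ?key x = y. ?f x)"
    by (rule sum.image_gen[OF finite_colorings])
  also have "\<dots> = q_two (N - 3) ^ card V * (\<Sum>y\<in>?key ` ?C. h y)"
    unfolding sum_distrib_left
  proof (rule sum.cong[OF refl])
    fix y assume "y \<in> ?key ` ?C"
    from conjunct2[OF bspec[OF h this]]
    show "(\<Sum>x | x \<in> ?C \<and> ?key x = y. ?f x) = q_two (N - 3) ^ card V * h y" .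
  qed
  finally have "web_eval N W = q_two (N - 3) ^ card V * (\<Sum>y\<in>?key ` ?C. h y)" .
  moreover have "(\<Sum>y\<in>?key ` ?C. h y) \<in> nonneg_laurent_polys"
  proof (rule nonneg_laurent_polys_sum)
    fix y assume "y \<in> ?key ` ?C"
    from conjunct1[OF bspec[OF h this]] show "h y \<in> nonneg_laurent_polys" .
  qed
  ultimately show ?thesis by (rule rev_bexI[rotated])
qed

end

section \<open>From square resolutions to webs with squares\<close>

text \<open>The geometric point is that no edge enters the inside of a square: a truncated edge
  meets the closed discs only in its two ends, which are corners and thus lie on the
  boundaries.\<close>

lemma squared_webI:
  assumes G: "plane_graph (gverts G) (gedges G)" and web: "web W"
    and sq: "\<And>v. v \<in> gverts G \<Longrightarrow> square (sq v)"
    and disc: "\<And>v w. v \<in> gverts G \<Longrightarrow> w \<in> gverts G \<Longrightarrow> v \<noteq> w \<Longrightarrow> sq_disc (sq v) \<inter> sq_disc (sq w) = {}"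
    and circ: "\<And>e v. e \<in> circles G \<Longrightarrow> v \<in> gverts G \<Longrightarrow> path_image e \<inter> sq_disc (sq v) = {}"
    and st: "\<And>e. e \<in> proper_edges G \<Longrightarrow> s e < t e"
    and mid: "\<And>e v. e \<in> proper_edges G \<Longrightarrow> v \<in> gverts G \<Longrightarrow> e ` {s e<..<t e} \<inter> sq_disc (sq v) = {}"
    and cor: "\<And>v. v \<in> gverts G \<Longrightarrow> corners (sq v) =
        {e (s e) | e. e \<in> proper_edges G \<and> pathstart e = v} \<union>
        {e (t e) | e. e \<in> proper_edges G \<and> pathfinish e = v}"
    and verts: "verts W = (\<Union>v\<in>gverts G. corners (sq v))"
    and vect: "vect W = (\<lambda>e. subpath (s e) (t e) e) ` proper_edges G \<union> circles G"
    and even: "spin_even W = (\<Union>v\<in>gverts G. {sq v ! 0, sq v ! 2})"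
    and odd: "spin_odd W = (\<Union>v\<in>gverts G. {sq v ! 1, sq v ! 3})"
  shows "squared_web W (gverts G) sq"
proof -
  have four: "set (sq v) = {sq v ! 0, sq v ! 1, sq v ! 2, sq v ! 3}" if "v \<in> gverts G" for v
  proof -
    have "length (sq v) = 4" using sq[OF that] by (simp add: square_def)
    then obtain s0 s1 s2 s3 where "sq v = [s0, s1, s2, s3]"
      by (auto simp: length_Suc_conv eval_nat_numeral)
    thus ?thesis by simp
  qed
  have spin: "spin W = (\<Union>v\<in>gverts G. set (sq v))"
    unfolding spin_def even odd using four by blast
  have im: "path_image x \<subseteq> path_image (join_list (sq v))" if v: "v \<in> gverts G" and x: "x \<in> set (sq v)" for v x
  proof -
    have ch: "closed_chain (sq v)" using sq[OF v] by (simp add: square_def)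
    have "path y" if "y \<in> set (sq v)" for y
      using plane_graphD(3)[OF web_plane_graph[OF web], of y] that v spin simple_path_imp_path by blast
    from join_list_props(4)[OF _ this closed_chain_Suc[OF ch]] have "path_image (join_list (sq v)) = union_image (set (sq v))"
      using ch by (simp add: closed_chain_def)
    thus ?thesis using x by (auto simp: union_image_def)
  qed
  have avoid: "path_image (join_list (sq w)) \<inter> sq_inside (sq v) = {}" if "v \<in> gverts G" "w \<in> gverts G" for v w
  proof (cases "v = w")
    case True
    thus ?thesis using inside_no_overlap[of "path_image (join_list (sq w))"] by (simp add: sq_inside_def Int_commute)
  next
    case False
    thus ?thesis using disc[OF that False] unfolding sq_disc_def by blast
  qed
  have pr: "pathstart e \<in> gverts G \<and> pathfinish e \<in> gverts G" if "e \<in> proper_edges G" for e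
    using plane_graphD(4)[OF G, of e True] that by (simp add: proper_edges_def)
  have finite: "finite (gverts G)" using plane_graphD(1)[OF G] .
  show ?thesis
  proof
    show "web W" "finite (gverts G)" "spin_even W = (\<Union>v\<in>gverts G. {sq v ! 0, sq v ! 2})"
      "spin_odd W = (\<Union>v\<in>gverts G. {sq v ! 1, sq v ! 3})" "verts W = (\<Union>v\<in>gverts G. corners (sq v))"
      by fact+
    show "square (sq v)" if "v \<in> gverts G" for v using sq[OF that] .
    show "set (sq v) \<inter> set (sq w) = {}" if "v \<in> gverts G" "w \<in> gverts G" "v \<noteq> w" for v w
    proof (rule ccontr)
      assume "set (sq v) \<inter> set (sq w) \<noteq> {}"
      then obtain x where "x \<in> set (sq v)" "x \<in> set (sq w)" by blast
      hence "path_image x \<subseteq> sq_disc (sq v) \<inter> sq_disc (sq w)"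
        using im that unfolding sq_disc_def by blast
      thus False using disc[OF that] by simp
    qed
    show "path_image e \<inter> sq_inside (sq v) = {}" if v: "v \<in> gverts G" and e: "e \<in> vect W \<union> spin W" for v e
    proof -
      consider f where "f \<in> proper_edges G" "e = subpath (s f) (t f) f" | "e \<in> circles G"
        | w where "w \<in> gverts G" "e \<in> set (sq w)" using e vect spin by blast
      thus ?thesis
      proof cases
        case (1 f)
        have "path_image e = f ` {s f..t f}"
          using st[OF 1(1)] by (simp add: 1(2) path_image_subpath)
        also have "{s f..t f} = insert (s f) (insert (t f) {s f<..<t f})" using st[OF 1(1)] by auto
        finally have *: "path_image e = insert (f (s f)) (insert (f (t f)) (f ` {s f<..<t f}))" by simp
        have "f (s f) \<in> corners (sq (pathstart f))" "f (t f) \<in> corners (sq (pathfinish f))"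
          using cor pr[OF 1(1)] 1(1) by blast+
        moreover have "corners (sq w) \<subseteq> path_image (join_list (sq w))" if "w \<in> gverts G" for w
          using im[OF that] pathstart_in_path_image unfolding corners_def by blast
        ultimately have "f (s f) \<notin> sq_inside (sq v)" "f (t f) \<notin> sq_inside (sq v)"
          using pr[OF 1(1)] avoid[OF v] by blast+
        thus ?thesis using mid[OF 1(1) v] unfolding * sq_disc_def by blast
      next
        case 2
        thus ?thesis using circ[OF 2 v] unfolding sq_disc_def by blast
      next
        case (3 w)
        thus ?thesis using im[OF 3] avoid[OF v 3(1)] by blast
      qed
    qed
  qed
qed

lemma square_resolution_squared_web:
  assumes G: "plane_graph (gverts G) (gedges G)" and R: "square_resolution G W"
  obtains sq where "squared_web W (gverts G) sq"
proof -
  from R[unfolded square_resolution_def] show ?thesis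
  proof (elim exE conjE)
    fix sq s t
    assume web: "web W"
      and sq: "\<forall>v\<in>gverts G. square (sq v) \<and> v \<in> sq_inside (sq v)"
      and disc: "\<forall>v\<in>gverts G. \<forall>w\<in>gverts G. v \<noteq> w \<longrightarrow> sq_disc (sq v) \<inter> sq_disc (sq w) = {}"
      and circ: "\<forall>e\<in>circles G. \<forall>v\<in>gverts G. path_image e \<inter> sq_disc (sq v) = {}"
      and pieces: "\<forall>e\<in>proper_edges G.
        0 < s e \<and> s e < t e \<and> t e < 1 \<and>
        e ` {0..<s e} \<subseteq> sq_inside (sq (pathstart e)) \<and>
        e ` {t e<..1} \<subseteq> sq_inside (sq (pathfinish e)) \<and>
        (\<forall>v\<in>gverts G. e ` {s e<..<t e} \<inter> sq_disc (sq v) = {})"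
      and cor: "\<forall>v\<in>gverts G. corners (sq v) =
        {e (s e) | e. e \<in> proper_edges G \<and> pathstart e = v} \<union>
        {e (t e) | e. e \<in> proper_edges G \<and> pathfinish e = v}"
      and verts: "verts W = (\<Union>v\<in>gverts G. corners (sq v))"
      and vect: "vect W = (\<lambda>e. subpath (s e) (t e) e) ` proper_edges G \<union> circles G"
      and even: "spin_even W = (\<Union>v\<in>gverts G. {sq v ! 0, sq v ! 2})"
      and odd: "spin_odd W = (\<Union>v\<in>gverts G. {sq v ! 1, sq v ! 3})"
    have "squared_web W (gverts G) sq"
    proof (rule squared_webI[OF G web])
      show "\<And>v. v \<in> gverts G \<Longrightarrow> square (sq v)" using sq by blast
      show "\<And>v w. v \<in> gverts G \<Longrightarrow> w \<in> gverts G \<Longrightarrow> v \<noteq> w \<Longrightarrow> sq_disc (sq v) \<inter> sq_disc (sq w) = {}"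
        using disc by blast
      show "\<And>e v. e \<in> circles G \<Longrightarrow> v \<in> gverts G \<Longrightarrow> path_image e \<inter> sq_disc (sq v) = {}"
        using circ by blast
      show "\<And>e. e \<in> proper_edges G \<Longrightarrow> s e < t e"
        "\<And>e v. e \<in> proper_edges G \<Longrightarrow> v \<in> gverts G \<Longrightarrow> e ` {s e<..<t e} \<inter> sq_disc (sq v) = {}"
        using pieces by blast+
      show "\<And>v. v \<in> gverts G \<Longrightarrow> corners (sq v) =
        {e (s e) | e. e \<in> proper_edges G \<and> pathstart e = v} \<union>
        {e (t e) | e. e \<in> proper_edges G \<and> pathfinish e = v}"
        using cor by (rule bspec)
    qed (rule verts vect even odd)+
    thus ?thesis by (rule that)
  qed
qed

theorem theorem2:
  fixes N :: nat and G :: graph and p :: "rat fls"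
  assumes "N \<ge> 3"
    and "four_valent G"
    and "is_graph_eval N G p"
  shows "p \<in> nonneg_laurent_polys"
proof -
  have pg: "plane_graph (gverts G) (gedges G)" using assms(2) by (simp add: four_valent_def)
  obtain W where R: "square_resolution G W" and p: "q_two (N - 3) ^ card (gverts G) * p = web_eval N W"
    using assms(3) unfolding is_graph_eval_def by blast
  obtain sq where "squared_web W (gverts G) sq" using square_resolution_squared_web[OF pg R] .
  then interpret squared_web W "gverts G" sq .
  obtain h where h: "h \<in> nonneg_laurent_polys" "web_eval N W = q_two (N - 3) ^ card (gverts G) * h"
    using web_eval_divisible[OF assms(1)] by blast
  have "p = h" using p h(2) q_two_nonzero by simp
  thus ?thesis using h(1) by simp
qed

end
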